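(* Assume that the homogeneous subduction algorithm terminates for $A$, and let $f_1,\dots,f_k\in A$ be (non-zero) $\Delta$-homogeneous generators of $A$ as a $K$-algebra. The Khovanskii basis algorithm (described in the context) with input $f_1,\dots,f_k$ terminates after finitely many steps if and only if there exists a finite $\Delta$-homogeneous Khovanskii basis of $A$ with respect to $v$. If the algorithm terminates, its output is such a basis.
   Context: $K$ is a field; $A\le B$ are finitely generated commutative $K$-algebras and domains ($A$ a $K$-subalgebra of $B$). $(\Gamma,+,\succeq)$ is a linearly ordered abelian group (total order with $\gamma_1\succeq\gamma_2\Rightarrow\gamma_1+\gamma_3\succeq\gamma_2+\gamma_3$). $v:B\setminus\{0\}\to\Gamma$ is a valuation over $K$: $v(f+g)\succeq\min\{v(f),v(g)\}$ whenever $f,g,f+g\ne0$; $v(fg)=v(f)+v(g)$ for $f,g\neq 0$; $v(\lambda f)=v(f)$ for $0\ne\lambda\in K$, $f\neq0$. For $\gamma\in\Gamma$ let $F_{v\succeq\gamma}=\{f\in B\setminus\{0\}\mid v(f)\succeq\gamma\}\cup\{0\}$, similarly $F_{v\succ\gamma}$, and $\operatorname{gr}_v(B)=\bigoplus_{\gamma\in\Gamma}F_{v\succeq\gamma}/F_{v\succ\gamma}$ (associated graded algebra). For $0\ne f\in B$ with $v(f)=\gamma$, $\operatorname{in}_v(f)$ is the class of $f$ in $F_{v\succeq\gamma}/F_{v\succ\gamma}$. $A$ is graded by a finitely generated abelian group $\Delta$, with degree function $\deg_\Delta$. For $\Delta$-homogeneous $0\neq f\in A$ of degree $\delta$ put $\operatorname{in}_v^\Delta(f)=\operatorname{in}_v(f)\otimes\delta\in\operatorname{gr}_v(B)\otimes_KK\Delta$,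 where $K\Delta$ is the group ring. For $S\subseteq A$, $\operatorname{in}_v^\Delta(S)\le\operatorname{gr}_v(B)\otimes_KK\Delta$ is the $K$-subalgebra generated by all $\operatorname{in}_v^\Delta(f)$ with $0\ne f\in S$ $\Delta$-homogeneous. A set $\mathcal G\subseteq A$ of $\Delta$-homogeneous $K$-algebra generators of $A$ is a $\Delta$-homogeneous Khovanskii basis of $A$ with respect to $v$ if $\{\operatorname{in}_v^\Delta(f)\mid f\in\mathcal G\}$ generates $\operatorname{in}_v^\Delta(A)$ as a $K$-algebra. For a polynomial $h$, $\operatorname{Supp}(h)$ is the set of its non-zero terms. Homogeneous subduction algorithm. Input: a $\Delta$-homogeneous $f\in A$ and a (possibly infinite) set $\mathcal G\subseteq A$ of (non-zero) $\Delta$-homogeneous elements. Polynomials live in $K[X_g\mid g\in\mathcal G]$. Initialize $\mathcal G'=\emptyset$, $h=0$, $r=f$. While $r\neq0$ and $\operatorname{in}_v^\Delta(r)\in\operatorname{in}_v^\Delta(\mathcal G)$: choose a finite subset $\{f_1,\dots,f_k\}\subseteq\mathcal G$ and a polynomial $h'\in K[X_{f_1},\dots,X_{f_k}]$ with $h'(\operatorname{in}_v^\Delta(f_1),\dots,\operatorname{in}_v^\Delta(f_k))=\operatorname{in}_v^\Delta(r)$ and with $v(t(f_1,\dots,f_k))\succeq v(r)$ and $\deg_\Delta(t(f_1,\dots,f_k))=\deg_\Delta(r)$ for every $t\in\operatorname{Supp}(h')$ (such a choice always exists; it is made by an arbitrary but fixed rule); then replace $\mathcal G'$ by $\mathcal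 G'\cup\{f_1,\dots,f_k\}$, $r$ by $r-h'(f_1,\dots,f_k)$, and $h$ by $h+h'$. When the loop ends, return $\mathcal G'$, $h$ and the remainder $r$. The algorithm "terminates for $A$" if it terminates after finitely many steps for every $\Delta$-homogeneous $f\in A$ and every set $\mathcal G\subseteq A$ of $\Delta$-homogeneous elements. Khovanskii basis algorithm. Input: $\Delta$-homogeneous generators $f_1,\dots,f_k$ of $A$. Initialize $\mathcal G=\mathcal G'=\{f_1,\dots,f_k\}$. While $\mathcal G'\ne\emptyset$: set $\mathcal G'=\emptyset$; writing $\mathcal G=\{f_1',\dots,f_l'\}$, consider $\beta:K[X_1,\dots,X_l]\to\operatorname{in}_v^\Delta(A)$, $X_i\mapsto\operatorname{in}_v^\Delta(f_i')$, with $K[X_1,\dots,X_l]$ graded by $\deg_\Gamma(X_i)=v(f_i')$ and $\deg_\Delta(X_i)=\deg_\Delta(f_i')$, and choose finitely many generators $h_1,\dots,h_s$ of $\ker(\beta)$ that are both $\Gamma$- and $\Delta$-homogeneous; for each $h\in\{h_1,\dots,h_s\}$ run the homogeneous subduction algorithm on $h(f_1',\dots,f_l')$ and $\mathcal G$, and if the remainder $r$ is non-zero, add $r$ to $\mathcal G'$; finally replace $\mathcal G$ by $\mathcal G\cup\mathcal G'$. When the loop ends, return $\mathcal G$. *)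

theory Defs
  imports
    "HOL-Algebra.Generated_Rings"
    "HOL-Algebra.QuotRing"
    "HOL-Library.Poly_Mapping"
    "HOL-Library.While_Combinator"
begin

text \<open>
  Conventions. The field \<open>K\<close>, the domain \<open>B\<close>, the ordered group \<open>\<Gamma>\<close> and the grading group \<open>\<Delta>\<close> are
  types of the corresponding classes. A commutative \<open>K\<close>-algebra is a commutative ring together
  with its structure homomorphism from \<open>K\<close> (for \<open>B\<close> it is called \<open>\<iota>\<close>), so that a \<open>K\<close>-subalgebra is
  a subring containing the image of \<open>K\<close>. The algebras that depend on the valuation are records of
  HOL-Algebra. A valuation is a total function on \<open>B\<close>; its value at \<open>0\<close> is never used.
\<close>

definition class_ring :: "'a::comm_ring_1 ring" where
  "class_ring = \<lparr>carrier = UNIV, mult = (*), one = 1, zero = 0, add = (+)\<rparr>"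

definition generated_algebra :: "('r, 'm) ring_scheme \<Rightarrow> ('k \<Rightarrow> 'r) \<Rightarrow> 'r set \<Rightarrow> 'r set" where
  "generated_algebra R \<iota> S = generate_ring R (range \<iota> \<union> S)"


section \<open>Polynomials\<close>

text \<open>
  Polynomials are finitely supported maps from monomials to coefficients, and monomials are
  finitely supported maps from variables to exponents. The variable \<open>X\<^sub>g\<close> is indexed by \<open>g\<close> itself.
\<close>

type_synonym ('x, 'k) mpoly = "('x \<Rightarrow>\<^sub>0 nat) \<Rightarrow>\<^sub>0 'k"

definition polys_in :: "'x set \<Rightarrow> ('x, 'k::zero) mpoly set" where
  "polys_in X = {p. \<forall>m\<in>Poly_Mapping.keys p. Poly_Mapping.keys m \<subseteq> X}"

definition poly_ring :: "'x set \<Rightarrow> ('x, 'k::comm_ring_1) mpoly ring" where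
  "poly_ring X = class_ring\<lparr>carrier := polys_in X\<rparr>"

definition poly_eval ::
    "('r, 'm) ring_scheme \<Rightarrow> ('k::zero \<Rightarrow> 'r) \<Rightarrow> ('x \<Rightarrow> 'r) \<Rightarrow> ('x, 'k) mpoly \<Rightarrow> 'r" where
  "poly_eval R \<iota> a p =
     (\<Oplus>\<^bsub>R\<^esub>m\<in>Poly_Mapping.keys p.
        \<iota> (Poly_Mapping.lookup p m) \<otimes>\<^bsub>R\<^esub>
        (\<Otimes>\<^bsub>R\<^esub>x\<in>Poly_Mapping.keys m. a x [^]\<^bsub>R\<^esub> Poly_Mapping.lookup m x))"

definition Supp :: "('x, 'k::zero) mpoly \<Rightarrow> ('x, 'k) mpoly set" where
  "Supp p = (\<lambda>m. Poly_Mapping.single m (Poly_Mapping.lookup p m)) ` Poly_Mapping.keys p"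

definition monomial_degree :: "('x \<Rightarrow> 'a::comm_monoid_add) \<Rightarrow> ('x \<Rightarrow>\<^sub>0 nat) \<Rightarrow> 'a" where
  "monomial_degree w m = (\<Sum>x\<in>Poly_Mapping.keys m. \<Sum>_<Poly_Mapping.lookup m x. w x)"

definition homogeneous_poly ::
    "('x \<Rightarrow> 'a::comm_monoid_add) \<Rightarrow> ('x, 'k::zero) mpoly \<Rightarrow> bool" where
  "homogeneous_poly w p \<longleftrightarrow> (\<exists>\<gamma>. \<forall>m\<in>Poly_Mapping.keys p. monomial_degree w m = \<gamma>)"


section \<open>Tensor products of commutative algebras\<close>

text \<open>
  \<open>M \<otimes>\<^sub>K N\<close> is the quotient of the free abelian group on the pairs \<open>(m, n)\<close> by the bilinearity
  relations. The free group carries the multiplication \<open>(m, n) (m', n') = (m m', n n')\<close>, for which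
  the relations span an ideal.
\<close>

definition free_pair_ring ::
    "('m, 'r) ring_scheme \<Rightarrow> ('n, 's) ring_scheme \<Rightarrow> ('m \<times> 'n \<Rightarrow>\<^sub>0 int) ring" where
  "free_pair_ring M N =
     \<lparr>carrier = {p. Poly_Mapping.keys p \<subseteq> carrier M \<times> carrier N},
      mult = (\<lambda>p q. \<Sum>x\<in>Poly_Mapping.keys p. \<Sum>y\<in>Poly_Mapping.keys q.
        Poly_Mapping.single (fst x \<otimes>\<^bsub>M\<^esub> fst y, snd x \<otimes>\<^bsub>N\<^esub> snd y)
          (Poly_Mapping.lookup p x * Poly_Mapping.lookup q y)),
      one = Poly_Mapping.single (\<one>\<^bsub>M\<^esub>, \<one>\<^bsub>N\<^esub>) 1,
      zero = 0,
      add = (+)\<rparr>"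

abbreviation pair_gen :: "'m \<Rightarrow> 'n \<Rightarrow> ('m \<times> 'n \<Rightarrow>\<^sub>0 int)" where
  "pair_gen m n \<equiv> Poly_Mapping.single (m, n) 1"

definition tensor_relations ::
    "('m, 'r) ring_scheme \<Rightarrow> ('k \<Rightarrow> 'm) \<Rightarrow> ('n, 's) ring_scheme \<Rightarrow> ('k \<Rightarrow> 'n) \<Rightarrow> ('m \<times> 'n \<Rightarrow>\<^sub>0 int) set"
  where
  "tensor_relations M \<iota>M N \<iota>N =
     {pair_gen (m \<oplus>\<^bsub>M\<^esub> m') n - pair_gen m n - pair_gen m' n | m m' n.
        m \<in> carrier M \<and> m' \<in> carrier M \<and> n \<in> carrier N} \<union>
     {pair_gen m (n \<oplus>\<^bsub>N\<^esub> n') - pair_gen m n - pair_gen m n' | m n n'.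
        m \<in> carrier M \<and> n \<in> carrier N \<and> n' \<in> carrier N} \<union>
     {pair_gen (\<iota>M c \<otimes>\<^bsub>M\<^esub> m) n - pair_gen m (\<iota>N c \<otimes>\<^bsub>N\<^esub> n) | c m n.
        m \<in> carrier M \<and> n \<in> carrier N}"

definition tensor_ideal ::
    "('m, 'r) ring_scheme \<Rightarrow> ('k \<Rightarrow> 'm) \<Rightarrow> ('n, 's) ring_scheme \<Rightarrow> ('k \<Rightarrow> 'n) \<Rightarrow> ('m \<times> 'n \<Rightarrow>\<^sub>0 int) set"
  where
  "tensor_ideal M \<iota>M N \<iota>N = Idl\<^bsub>free_pair_ring M N\<^esub> (tensor_relations M \<iota>M N \<iota>N)"

definition tensor_algebra ::
    "('m, 'r) ring_scheme \<Rightarrow> ('k \<Rightarrow> 'm) \<Rightarrow> ('n, 's) ring_scheme \<Rightarrow> ('k \<Rightarrow> 'n)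
      \<Rightarrow> ('m \<times> 'n \<Rightarrow>\<^sub>0 int) set ring" where
  "tensor_algebra M \<iota>M N \<iota>N = free_pair_ring M N Quot tensor_ideal M \<iota>M N \<iota>N"

definition tensor ::
    "('m, 'r) ring_scheme \<Rightarrow> ('k \<Rightarrow> 'm) \<Rightarrow> ('n, 's) ring_scheme \<Rightarrow> ('k \<Rightarrow> 'n)
      \<Rightarrow> 'm \<Rightarrow> 'n \<Rightarrow> ('m \<times> 'n \<Rightarrow>\<^sub>0 int) set" where
  "tensor M \<iota>M N \<iota>N m n = tensor_ideal M \<iota>M N \<iota>N +>\<^bsub>free_pair_ring M N\<^esub> pair_gen m n"


section \<open>Valuations and the associated graded algebra\<close>

definition valuation_over ::
    "('k::field \<Rightarrow> 'b::idom) \<Rightarrow> ('b \<Rightarrow> 'g::linordered_ab_group_add) \<Rightarrow> bool" where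
  "valuation_over \<iota> v \<longleftrightarrow>
     (\<forall>f g. f \<noteq> 0 \<longrightarrow> g \<noteq> 0 \<longrightarrow> f + g \<noteq> 0 \<longrightarrow> v (f + g) \<ge> min (v f) (v g)) \<and>
     (\<forall>f g. f \<noteq> 0 \<longrightarrow> g \<noteq> 0 \<longrightarrow> v (f * g) = v f + v g) \<and>
     (\<forall>c f. c \<noteq> 0 \<longrightarrow> f \<noteq> 0 \<longrightarrow> v (\<iota> c * f) = v f)"

definition F_ge :: "('b::zero \<Rightarrow> 'g::linorder) \<Rightarrow> 'g \<Rightarrow> 'b set" where
  "F_ge v \<gamma> = {f. f \<noteq> 0 \<and> v f \<ge> \<gamma>} \<union> {0}"

definition F_gt :: "('b::zero \<Rightarrow> 'g::linorder) \<Rightarrow> 'g \<Rightarrow> 'b set" where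
  "F_gt v \<gamma> = {f. f \<noteq> 0 \<and> v f > \<gamma>} \<union> {0}"

text \<open>
  The direct sum of the quotients \<open>F\<^sub>\<ge> / F\<^sub>>\<close> is the direct sum of the \<open>F\<^sub>\<ge>\<close> modulo the direct sum
  of the \<open>F\<^sub>>\<close>. The former is a subring, with product \<open>(f in degree \<alpha>) (g in degree \<beta>) =
  (f g in degree \<alpha> + \<beta>)\<close>, of the group ring of \<open>\<Gamma>\<close> over \<open>B\<close>, and the latter is an ideal in it.
\<close>

definition filtration_ring ::
    "('b::comm_ring_1 \<Rightarrow> 'g::linordered_ab_group_add) \<Rightarrow> ('g \<Rightarrow>\<^sub>0 'b) ring" where
  "filtration_ring v = class_ring\<lparr>carrier := {x. \<forall>\<gamma>. Poly_Mapping.lookup x \<gamma> \<in> F_ge v \<gamma>}\<rparr>"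

definition filtration_ideal ::
    "('b::comm_ring_1 \<Rightarrow> 'g::linordered_ab_group_add) \<Rightarrow> ('g \<Rightarrow>\<^sub>0 'b) set" where
  "filtration_ideal v = {x. \<forall>\<gamma>. Poly_Mapping.lookup x \<gamma> \<in> F_gt v \<gamma>}"

definition gr ::
    "('b::comm_ring_1 \<Rightarrow> 'g::linordered_ab_group_add) \<Rightarrow> ('g \<Rightarrow>\<^sub>0 'b) set ring" where
  "gr v = filtration_ring v Quot filtration_ideal v"

definition gr_class ::
    "('b::comm_ring_1 \<Rightarrow> 'g::linordered_ab_group_add) \<Rightarrow> 'g \<Rightarrow> 'b \<Rightarrow> ('g \<Rightarrow>\<^sub>0 'b) set" where
  "gr_class v \<gamma> f = filtration_ideal v +>\<^bsub>filtration_ring v\<^esub> Poly_Mapping.single \<gamma> f"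

definition gr_scalar ::
    "('k \<Rightarrow> 'b::comm_ring_1) \<Rightarrow> ('b \<Rightarrow> 'g::linordered_ab_group_add) \<Rightarrow> 'k \<Rightarrow> ('g \<Rightarrow>\<^sub>0 'b) set" where
  "gr_scalar \<iota> v c = gr_class v 0 (\<iota> c)"

definition in_v ::
    "('b::comm_ring_1 \<Rightarrow> 'g::linordered_ab_group_add) \<Rightarrow> 'b \<Rightarrow> ('g \<Rightarrow>\<^sub>0 'b) set" where
  "in_v v f = gr_class v (v f) f"

definition group_ring :: "('d::ab_group_add \<Rightarrow>\<^sub>0 'k::field) ring" where
  "group_ring = class_ring"

definition group_ring_scalar :: "'k::field \<Rightarrow> ('d::ab_group_add \<Rightarrow>\<^sub>0 'k)" where
  "group_ring_scalar c = Poly_Mapping.single 0 c"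


section \<open>The graded setting\<close>

definition finitely_generated_group :: "'d::ab_group_add itself \<Rightarrow> bool" where
  "finitely_generated_group _ \<longleftrightarrow>
     (\<exists>S::'d set. finite S \<and> (\<lambda>H. 0 \<in> H \<and> (\<forall>x\<in>H. \<forall>y\<in>H. x - y \<in> H)) hull S = UNIV)"

locale valued_graded_algebra =
  fixes \<iota> :: "'k::field \<Rightarrow> 'b::idom"
    and v :: "'b \<Rightarrow> 'g::linordered_ab_group_add"
    and A :: "'b set"
    and grad :: "'d::ab_group_add \<Rightarrow> 'b set"
  assumes B_algebra: "\<iota> \<in> ring_hom class_ring class_ring"
    and B_finitely_generated: "\<exists>S. finite S \<and> generated_algebra class_ring \<iota> S = UNIV"
    and A_subring: "subring A class_ring"
    and A_scalars: "range \<iota> \<subseteq> A"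
    and A_finitely_generated: "\<exists>S. finite S \<and> generated_algebra class_ring \<iota> S = A"
    and valuation: "valuation_over \<iota> v"
    and Delta_finitely_generated: "finitely_generated_group TYPE('d)"
    and grad_subset: "grad \<delta> \<subseteq> A"
    and grad_zero: "0 \<in> grad \<delta>"
    and grad_add: "x \<in> grad \<delta> \<Longrightarrow> y \<in> grad \<delta> \<Longrightarrow> x + y \<in> grad \<delta>"
    and grad_scale: "x \<in> grad \<delta> \<Longrightarrow> \<iota> c * x \<in> grad \<delta>"
    and grad_mult: "x \<in> grad \<delta> \<Longrightarrow> y \<in> grad \<epsilon> \<Longrightarrow> x * y \<in> grad (\<delta> + \<epsilon>)"
    and grad_direct_sum:
      "a \<in> A \<Longrightarrow> \<exists>!c :: 'd \<Rightarrow>\<^sub>0 'b. (\<forall>\<delta>. Poly_Mapping.lookup c \<delta> \<in> grad \<delta>) \<and>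
         a = (\<Sum>\<delta>\<in>Poly_Mapping.keys c. Poly_Mapping.lookup c \<delta>)"

definition homogeneous :: "('d \<Rightarrow> 'b set) \<Rightarrow> 'b set" where
  "homogeneous grad = (\<Union>\<delta>. grad \<delta>)"

text \<open>Only meaningful for non-zero homogeneous elements, for which the degree is unique.\<close>

definition deg :: "('d \<Rightarrow> 'b set) \<Rightarrow> 'b \<Rightarrow> 'd" where
  "deg grad f = (THE \<delta>. f \<in> grad \<delta>)"

text \<open>The type of the elements of \<open>gr\<^sub>v(B) \<otimes>\<^sub>K K\<Delta>\<close>.\<close>

type_synonym ('k, 'b, 'g, 'd) grD = "(('g \<Rightarrow>\<^sub>0 'b) set \<times> ('d \<Rightarrow>\<^sub>0 'k) \<Rightarrow>\<^sub>0 int) set"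

definition gr_tensor ::
    "('k::field \<Rightarrow> 'b::idom) \<Rightarrow> ('b \<Rightarrow> 'g::linordered_ab_group_add)
      \<Rightarrow> ('k, 'b, 'g, 'd::ab_group_add) grD ring" where
  "gr_tensor \<iota> v = tensor_algebra (gr v) (gr_scalar \<iota> v) group_ring group_ring_scalar"

definition gr_tensor_scalar ::
    "('k::field \<Rightarrow> 'b::idom) \<Rightarrow> ('b \<Rightarrow> 'g::linordered_ab_group_add)
      \<Rightarrow> 'k \<Rightarrow> ('k, 'b, 'g, 'd::ab_group_add) grD" where
  "gr_tensor_scalar \<iota> v c =
     tensor (gr v) (gr_scalar \<iota> v) group_ring group_ring_scalar (gr_scalar \<iota> v c) \<one>\<^bsub>group_ring\<^esub>"

definition in_vD ::
    "('k::field \<Rightarrow> 'b::idom) \<Rightarrow> ('b \<Rightarrow> 'g::linordered_ab_group_add) \<Rightarrow> ('d::ab_group_add \<Rightarrow> 'b set)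
      \<Rightarrow> 'b \<Rightarrow> ('k, 'b, 'g, 'd) grD" where
  "in_vD \<iota> v grad f =
     tensor (gr v) (gr_scalar \<iota> v) group_ring group_ring_scalar
       (in_v v f) (Poly_Mapping.single (deg grad f) 1)"

definition in_vD_algebra ::
    "('k::field \<Rightarrow> 'b::idom) \<Rightarrow> ('b \<Rightarrow> 'g::linordered_ab_group_add) \<Rightarrow> ('d::ab_group_add \<Rightarrow> 'b set)
      \<Rightarrow> 'b set \<Rightarrow> ('k, 'b, 'g, 'd) grD set" where
  "in_vD_algebra \<iota> v grad S =
     generated_algebra (gr_tensor \<iota> v) (gr_tensor_scalar \<iota> v)
       (in_vD \<iota> v grad ` {f \<in> S. f \<noteq> 0 \<and> f \<in> homogeneous grad})"

text \<open>The elements of a Khovanskii basis have initial forms, hence are non-zero.\<close>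

definition khovanskii_basis ::
    "('k::field \<Rightarrow> 'b::idom) \<Rightarrow> ('b \<Rightarrow> 'g::linordered_ab_group_add) \<Rightarrow> 'b set
      \<Rightarrow> ('d::ab_group_add \<Rightarrow> 'b set) \<Rightarrow> 'b set \<Rightarrow> bool" where
  "khovanskii_basis \<iota> v A grad \<G> \<longleftrightarrow>
     \<G> \<subseteq> homogeneous grad - {0} \<and>
     generated_algebra class_ring \<iota> \<G> = A \<and>
     generated_algebra (gr_tensor \<iota> v) (gr_tensor_scalar \<iota> v) (in_vD \<iota> v grad ` \<G>)
       = in_vD_algebra \<iota> v grad A"


section \<open>The homogeneous subduction algorithm\<close>

text \<open>\<open>h(f\<^sub>1, \<dots>, f\<^sub>k)\<close>: every variable \<open>X\<^sub>g\<close> is replaced by \<open>g\<close>.\<close>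

abbreviation subst :: "('k::field \<Rightarrow> 'b::idom) \<Rightarrow> ('b, 'k) mpoly \<Rightarrow> 'b" where
  "subst \<iota> h \<equiv> poly_eval class_ring \<iota> (\<lambda>g. g) h"

text \<open>\<open>h(in(f\<^sub>1), \<dots>, in(f\<^sub>k))\<close>: every variable \<open>X\<^sub>g\<close> is replaced by the initial form of \<open>g\<close>.\<close>

abbreviation subst_in ::
    "('k::field \<Rightarrow> 'b::idom) \<Rightarrow> ('b \<Rightarrow> 'g::linordered_ab_group_add) \<Rightarrow> ('d::ab_group_add \<Rightarrow> 'b set)
      \<Rightarrow> ('b, 'k) mpoly \<Rightarrow> ('k, 'b, 'g, 'd) grD" where
  "subst_in \<iota> v grad h \<equiv>
     poly_eval (gr_tensor \<iota> v) (gr_tensor_scalar \<iota> v) (in_vD \<iota> v grad) h"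

text \<open>
  States are triples \<open>(\<G>', h, r)\<close>. A rule maps the input set \<open>\<G>\<close> and the current state to the chosen
  finite set \<open>{f\<^sub>1, \<dots>, f\<^sub>k}\<close> and the chosen polynomial \<open>h'\<close>.
\<close>

type_synonym ('k, 'b) sub_state = "'b set \<times> ('b, 'k) mpoly \<times> 'b"
type_synonym ('k, 'b) sub_rule = "'b set \<Rightarrow> ('k, 'b) sub_state \<Rightarrow> 'b set \<times> ('b, 'k) mpoly"

definition subduction_continues ::
    "('k::field \<Rightarrow> 'b::idom) \<Rightarrow> ('b \<Rightarrow> 'g::linordered_ab_group_add) \<Rightarrow> ('d::ab_group_add \<Rightarrow> 'b set)
      \<Rightarrow> 'b set \<Rightarrow> 'b \<Rightarrow> bool" where
  "subduction_continues \<iota> v grad \<G> r \<longleftrightarrow>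
     r \<noteq> 0 \<and> in_vD \<iota> v grad r \<in> in_vD_algebra \<iota> v grad \<G>"

definition subduction_rule ::
    "('k::field \<Rightarrow> 'b::idom) \<Rightarrow> ('b \<Rightarrow> 'g::linordered_ab_group_add) \<Rightarrow> ('d::ab_group_add \<Rightarrow> 'b set)
      \<Rightarrow> ('k, 'b) sub_rule \<Rightarrow> bool" where
  "subduction_rule \<iota> v grad \<rho> \<longleftrightarrow>
     (\<forall>\<G> \<G>' h r F h'.
        \<G> \<subseteq> homogeneous grad - {0} \<longrightarrow> r \<in> homogeneous grad \<longrightarrow>
        subduction_continues \<iota> v grad \<G> r \<longrightarrow> \<rho> \<G> (\<G>', h, r) = (F, h') \<longrightarrow>
        finite F \<and> F \<subseteq> \<G> \<and> h' \<in> polys_in F \<and>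
        subst_in \<iota> v grad h' = in_vD \<iota> v grad r \<and>
        (\<forall>t\<in>Supp h'. v (subst \<iota> t) \<ge> v r \<and> deg grad (subst \<iota> t) = deg grad r))"

definition subduction_step ::
    "('k::field \<Rightarrow> 'b::idom) \<Rightarrow> ('k, 'b) sub_rule \<Rightarrow> 'b set \<Rightarrow> ('k, 'b) sub_state \<Rightarrow> ('k, 'b) sub_state"
  where
  "subduction_step \<iota> \<rho> \<G> = (\<lambda>(\<G>', h, r).
     case \<rho> \<G> (\<G>', h, r) of (F, h') \<Rightarrow> (\<G>' \<union> F, h + h', r - subst \<iota> h'))"

text \<open>The results of the two algorithms are \<^const>\<open>None\<close> iff their loop does not terminate.\<close>

definition subduction ::
    "('k::field \<Rightarrow> 'b::idom) \<Rightarrow> ('b \<Rightarrow> 'g::linordered_ab_group_add) \<Rightarrow> ('d::ab_group_add \<Rightarrow> 'b set)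
      \<Rightarrow> ('k, 'b) sub_rule \<Rightarrow> 'b set \<Rightarrow> 'b \<Rightarrow> ('k, 'b) sub_state option" where
  "subduction \<iota> v grad \<rho> \<G> f =
     while_option (\<lambda>(\<G>', h, r). subduction_continues \<iota> v grad \<G> r)
       (subduction_step \<iota> \<rho> \<G>) ({}, 0, f)"

definition subduction_terminates ::
    "('k::field \<Rightarrow> 'b::idom) \<Rightarrow> ('b \<Rightarrow> 'g::linordered_ab_group_add) \<Rightarrow> ('d::ab_group_add \<Rightarrow> 'b set)
      \<Rightarrow> ('k, 'b) sub_rule \<Rightarrow> bool" where
  "subduction_terminates \<iota> v grad \<rho> \<longleftrightarrow>
     (\<forall>f \<G>. f \<in> homogeneous grad \<longrightarrow> \<G> \<subseteq> homogeneous grad - {0} \<longrightarrow>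
        subduction \<iota> v grad \<rho> \<G> f \<noteq> None)"


section \<open>The Khovanskii basis algorithm\<close>

definition beta_kernel ::
    "('k::field \<Rightarrow> 'b::idom) \<Rightarrow> ('b \<Rightarrow> 'g::linordered_ab_group_add) \<Rightarrow> ('d::ab_group_add \<Rightarrow> 'b set)
      \<Rightarrow> 'b set \<Rightarrow> ('b, 'k) mpoly set" where
  "beta_kernel \<iota> v grad \<G> =
     a_kernel (poly_ring \<G>) (gr_tensor \<iota> v :: ('k, 'b, 'g, 'd) grD ring) (subst_in \<iota> v grad)"

text \<open>A rule maps the current set \<open>\<G>\<close> to the chosen set \<open>{h\<^sub>1, \<dots>, h\<^sub>s}\<close> of generators of the kernel.\<close>

definition kernel_rule ::
    "('k::field \<Rightarrow> 'b::idom) \<Rightarrow> ('b \<Rightarrow> 'g::linordered_ab_group_add) \<Rightarrow> ('d::ab_group_add \<Rightarrow> 'b set)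
      \<Rightarrow> ('b set \<Rightarrow> ('b, 'k) mpoly set) \<Rightarrow> bool" where
  "kernel_rule \<iota> v grad \<kappa> \<longleftrightarrow>
     (\<forall>\<G>. finite \<G> \<longrightarrow> \<G> \<subseteq> homogeneous grad - {0} \<longrightarrow>
        finite (\<kappa> \<G>) \<and> \<kappa> \<G> \<subseteq> polys_in \<G> \<and>
        (\<forall>h\<in>\<kappa> \<G>. homogeneous_poly v h \<and> homogeneous_poly (deg grad) h) \<and>
        Idl\<^bsub>poly_ring \<G>\<^esub> (\<kappa> \<G>) = beta_kernel \<iota> v grad \<G>)"

definition new_remainders ::
    "('k::field \<Rightarrow> 'b::idom) \<Rightarrow> ('b \<Rightarrow> 'g::linordered_ab_group_add) \<Rightarrow> ('d::ab_group_add \<Rightarrow> 'b set)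
      \<Rightarrow> ('k, 'b) sub_rule \<Rightarrow> ('b set \<Rightarrow> ('b, 'k) mpoly set) \<Rightarrow> 'b set \<Rightarrow> 'b set" where
  "new_remainders \<iota> v grad \<rho> \<kappa> \<G> =
     {r. r \<noteq> 0 \<and> (\<exists>h\<in>\<kappa> \<G>. \<exists>\<G>' h'. subduction \<iota> v grad \<rho> \<G> (subst \<iota> h) = Some (\<G>', h', r))}"

text \<open>States are pairs \<open>(\<G>, \<G>')\<close>.\<close>

definition khovanskii_algorithm ::
    "('k::field \<Rightarrow> 'b::idom) \<Rightarrow> ('b \<Rightarrow> 'g::linordered_ab_group_add) \<Rightarrow> ('d::ab_group_add \<Rightarrow> 'b set)
      \<Rightarrow> ('k, 'b) sub_rule \<Rightarrow> ('b set \<Rightarrow> ('b, 'k) mpoly set) \<Rightarrow> 'b list \<Rightarrow> 'b set option" where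
  "khovanskii_algorithm \<iota> v grad \<rho> \<kappa> fs =
     map_option fst (while_option (\<lambda>(\<G>, \<G>'). \<G>' \<noteq> {})
       (\<lambda>(\<G>, \<G>'). (\<G> \<union> new_remainders \<iota> v grad \<rho> \<kappa> \<G>, new_remainders \<iota> v grad \<rho> \<kappa> \<G>))
       (set fs, set fs))"

end

theory Submission
  imports Defs "HOL-Computational_Algebra.Polynomial"
begin

text \<open>
  Termination of subduction forces \<open>v \<le> 0\<close> in degree \<open>0\<close>: if \<open>v x > 0\<close>, then the subduction of \<open>x\<close> by
  \<open>{x + x\<^sup>2}\<close> goes on forever. By Dickson's lemma, the values of the monomials of a fixed
  \<open>\<Delta>\<close>-degree in a finite set \<open>H\<close> therefore satisfy the ascending chain condition: of two comparable
  monomials, the quotient has degree \<open>0\<close> and the larger one has no larger value.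

  Let \<open>\<G>\<close> be a set reached by the algorithm, and represent a homogeneous \<open>f\<close> as a polynomial in \<open>\<G>\<close>. If
  the terms of lowest value cancel, then their initial forms are a relation in the kernel of \<open>\<beta>\<close>, and
  the subductions of the generators of the kernel rewrite them in the next set with terms of higher
  value. If \<open>\<G>\<close> is stable, or if there is a finite Khovanskii basis, then the lowest values cannot ascend
  forever by the chain condition (with \<open>H = \<G>\<close>, or \<open>H\<close> the basis), so the initial form of \<open>f\<close> is
  generated after finitely many steps. In the second case this holds for all of the finitely many
  basis elements simultaneously, and no remainder survives afterwards.
\<close>

section \<open>Polynomials and their evaluation\<close>

text \<open>The values lie in an arbitrary ordered group, with no well-ordering to stop an ascent,
  so every finiteness argument has to be extracted from the termination hypothesis. That hypothesis
  quantifies over all sets of homogeneous elements, and it is applied to \<open>{x + x * x}\<close>,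
  which is unrelated to the generators of \<open>A\<close>. The other obstacle is that the loop
  conditions are equations in a tensor product, given by cosets in a free abelian group. They are
  translated into congruences in \<open>B\<close>: the coefficient at \<delta> on one side and the
  component of degree \<gamma> on the other define a bilinear map modulo
  \<open>F_gt v \<gamma>\<close>, so equal tensors have congruent components. For bihomogeneous
  polynomials this makes membership in the kernel of \<beta> equivalent to cancellation of the
  lowest terms. A growing sequence of sets offers no common finite set of variables for Dickson's
  lemma. In the termination proof each monomial is therefore exchanged for a monomial in the finite
  basis with the same value and degree.\<close>

lemma class_ring_simps [simp]:
  "carrier class_ring = UNIV" "\<zero>\<^bsub>class_ring\<^esub> = 0" "\<one>\<^bsub>class_ring\<^esub> = 1"
  "x \<oplus>\<^bsub>class_ring\<^esub> y = x + y" "x \<otimes>\<^bsub>class_ring\<^esub> y = x * y"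
  by (auto simp: class_ring_def)

lemma class_ring_carrier_simps [simp]:
  "\<zero>\<^bsub>class_ring\<lparr>carrier := S\<rparr>\<^esub> = 0" "\<one>\<^bsub>class_ring\<lparr>carrier := S\<rparr>\<^esub> = 1"
  "x \<oplus>\<^bsub>class_ring\<lparr>carrier := S\<rparr>\<^esub> y = x + y" "x \<otimes>\<^bsub>class_ring\<lparr>carrier := S\<rparr>\<^esub> y = x * y"
  by (auto simp: class_ring_def)

text \<open>Serves three rings at once: a whole type, the polynomials in given variables, and the
  filtration ring. Zero lies in \<open>S\<close> as 1 + (-1).\<close>

lemma cring_class_ring_carrier:
  fixes S :: "'a::comm_ring_1 set"
  assumes "1 \<in> S" "\<And>x. x \<in> S \<Longrightarrow> - x \<in> S"
    and "\<And>x y. x \<in> S \<Longrightarrow> y \<in> S \<Longrightarrow> x + y \<in> S" "\<And>x y. x \<in> S \<Longrightarrow> y \<in> S \<Longrightarrow> x * y \<in> S"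
  shows "cring (class_ring\<lparr>carrier := S\<rparr>)"
proof (rule cringI)
  have "0 \<in> S"
    using assms(3)[OF assms(1) assms(2)[OF assms(1)]] by simp
  moreover have "\<exists>y\<in>S. y + x = 0" if "x \<in> S" for x
    using assms(2)[OF that] by force
  ultimately show "abelian_group (class_ring\<lparr>carrier := S\<rparr>)"
    by (intro abelian_groupI) (auto simp: assms algebra_simps)
qed (auto intro!: comm_monoidI simp: assms algebra_simps)

lemma cring_class_ring: "cring (class_ring :: 'a::comm_ring_1 ring)"
  using cring_class_ring_carrier[of "UNIV :: 'a set"] by (simp add: class_ring_def)

lemma nat_pow_class_ring [simp]: "x [^]\<^bsub>class_ring\<^esub> (n::nat) = x ^ n"
  by (induction n) (auto simp: nat_pow_def class_ring_def)

lemma finprod_class_ring: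
  fixes f :: "'i \<Rightarrow> 'a::comm_ring_1"
  assumes "finite I"
  shows "(\<Otimes>\<^bsub>class_ring\<^esub>i\<in>I. f i) = (\<Prod>i\<in>I. f i)"
proof -
  interpret cring "class_ring :: 'a ring" by (rule cring_class_ring)
  show ?thesis using assms by induction auto
qed

lemma sum_singles_keys:
  fixes p :: "'a \<Rightarrow>\<^sub>0 'b::comm_monoid_add"
  shows "(\<Sum>k\<in>Poly_Mapping.keys p. Poly_Mapping.single k (Poly_Mapping.lookup p k)) = p"
proof (rule poly_mapping_eqI)
  fix k
  have "(\<Sum>i\<in>Poly_Mapping.keys p. Poly_Mapping.lookup (Poly_Mapping.single i (Poly_Mapping.lookup p i)) k) =
     (\<Sum>i\<in>Poly_Mapping.keys p. if i = k then Poly_Mapping.lookup p i else 0)"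
    by (intro sum.cong) (auto simp: lookup_single when_def)
  then show "Poly_Mapping.lookup
      (\<Sum>i\<in>Poly_Mapping.keys p. Poly_Mapping.single i (Poly_Mapping.lookup p i)) k = Poly_Mapping.lookup p k"
    by (simp add: lookup_sum in_keys_iff)
qed

text \<open>The single terms are those of the fixed \<open>p\<close>, so assumptions on its keys
  stay usable, but the sum case meets arbitrary \<open>q\<close> and \<open>r\<close>. Side
  conditions wanted there, such as membership in \<open>polys_in X\<close>, must be part of
  \<open>P\<close>; this explains the conjunctions proved by this rule.\<close>

lemma poly_mapping_single_induct [case_names zero single add]:
  fixes p :: "'a \<Rightarrow>\<^sub>0 'b::comm_monoid_add"
  assumes "P 0"
    and "\<And>k. k \<in> Poly_Mapping.keys p \<Longrightarrow> P (Poly_Mapping.single k (Poly_Mapping.lookup p k))"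
    and "\<And>q r. P q \<Longrightarrow> P r \<Longrightarrow> P (q + r)"
  shows "P p"
proof -
  have "P (\<Sum>k\<in>I. Poly_Mapping.single k (Poly_Mapping.lookup p k))"
    if "I \<subseteq> Poly_Mapping.keys p" for I
    using finite_subset[OF that finite_keys] that
    by (induction I) (auto intro: assms)
  then show ?thesis
    using sum_singles_keys[of p] by fastforce
qed

section \<open>Polynomials with prescribed variables\<close>

lemma polys_in_zero [simp]: "0 \<in> polys_in X"
  by (simp add: polys_in_def)

lemma polys_in_single: "Poly_Mapping.keys m \<subseteq> X \<Longrightarrow> Poly_Mapping.single m c \<in> polys_in X"
  by (auto simp: polys_in_def)

lemma polys_in_add:
  fixes p :: "('x, 'k::comm_ring_1) mpoly"
  shows "p \<in> polys_in X \<Longrightarrow> q \<in> polys_in X \<Longrightarrow> p + q \<in> polys_in X"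
  using keys_add[of p q] unfolding polys_in_def by blast

lemma polys_in_uminus:
  fixes p :: "('x, 'k::comm_ring_1) mpoly"
  shows "p \<in> polys_in X \<Longrightarrow> - p \<in> polys_in X"
  by (auto simp: polys_in_def in_keys_iff)

lemma polys_in_mult:
  fixes p :: "('x, 'k::comm_ring_1) mpoly"
  assumes "p \<in> polys_in X" "q \<in> polys_in X"
  shows "p * q \<in> polys_in X"
  unfolding polys_in_def
proof clarify
  fix m x
  assume "m \<in> Poly_Mapping.keys (p * q)" and x: "x \<in> Poly_Mapping.keys m"
  then obtain k l where "m = k + l" "k \<in> Poly_Mapping.keys p" "l \<in> Poly_Mapping.keys q"
    using keys_mult[of p q] by blast
  then show "x \<in> X"
    using x keys_add[of k l] assms unfolding polys_in_def by blast
qed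

lemma polys_in_mono: "X \<subseteq> Y \<Longrightarrow> polys_in X \<subseteq> polys_in Y"
  by (auto simp: polys_in_def)

lemma cring_poly_ring: "cring (poly_ring X :: ('x, 'k::comm_ring_1) mpoly ring)"
proof -
  have "(1 :: ('x, 'k) mpoly) \<in> polys_in X"
    by (metis polys_in_single keys_zero empty_subsetI single_one)
  then show ?thesis
    unfolding poly_ring_def
    by (rule cring_class_ring_carrier) (auto intro: polys_in_add polys_in_mult polys_in_uminus)
qed

text \<open>Stated for a record ring because polynomials are evaluated both in \<open>B\<close> and
  in the tensor product. The set \<open>X\<close> bounds the variables: \<open>UNIV\<close> gives
  the computation rules, a smaller \<open>X\<close> the description of the algebra generated by its
  image.\<close>

locale poly_evaluation = cring R for R :: "('r, 'm) ring_scheme" (structure) +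
  fixes \<sigma> :: "'k::comm_ring_1 \<Rightarrow> 'r" and a :: "'x \<Rightarrow> 'r" and X :: "'x set"
  assumes scalar_hom: "\<sigma> \<in> ring_hom class_ring R"
    and point_closed: "a \<in> X \<rightarrow> carrier R"
begin

definition mon :: "('x \<Rightarrow>\<^sub>0 nat) \<Rightarrow> 'r" where
  "mon m = (\<Otimes>x\<in>Poly_Mapping.keys m. a x [^] Poly_Mapping.lookup m x)"

lemma scalar_simps:
  "\<sigma> c \<in> carrier R" "\<sigma> (c + d) = \<sigma> c \<oplus> \<sigma> d" "\<sigma> (c * d) = \<sigma> c \<otimes> \<sigma> d" "\<sigma> 1 = \<one>"
  using ring_hom_memE[OF scalar_hom] by auto

lemma scalar_zero: "\<sigma> 0 = \<zero>"
  using scalar_simps(2)[of 0 0] by (simp add: scalar_simps(1))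

lemma mon_superset:
  assumes "finite Y" "Y \<subseteq> X" "Poly_Mapping.keys m \<subseteq> Y"
  shows "mon m = (\<Otimes>x\<in>Y. a x [^] Poly_Mapping.lookup m x)"
  unfolding mon_def
  using assms point_closed
  by (intro add.finprod_mono_neutral_cong_left finprod_mono_neutral_cong_left)
    (auto simp: in_keys_iff Pi_iff)

lemma mon_closed: "Poly_Mapping.keys m \<subseteq> X \<Longrightarrow> mon m \<in> carrier R"
  unfolding mon_def using point_closed by (intro finprod_closed) auto

lemma mon_zero: "mon 0 = \<one>"
  by (simp add: mon_def)

lemma mon_add:
  assumes "Poly_Mapping.keys m \<subseteq> X" "Poly_Mapping.keys n \<subseteq> X"
  shows "mon (m + n) = mon m \<otimes> mon n"
proof -
  let ?Y = "Poly_Mapping.keys m \<union> Poly_Mapping.keys n"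
  have Y: "finite ?Y" "?Y \<subseteq> X"
    using assms by auto
  have closed: "a x \<in> carrier R" if "x \<in> ?Y" for x
    using Y that point_closed by auto
  have "mon (m + n) = (\<Otimes>x\<in>?Y. a x [^] Poly_Mapping.lookup (m + n) x)"
    using keys_add[of m n] Y by (intro mon_superset) auto
  also have "\<dots> = (\<Otimes>x\<in>?Y. a x [^] Poly_Mapping.lookup m x \<otimes> a x [^] Poly_Mapping.lookup n x)"
    by (intro finprod_cong) (auto simp: lookup_add nat_pow_mult closed simp_implies_def)
  also have "\<dots> = mon m \<otimes> mon n"
    using closed Y by (subst finprod_multf) (auto simp: mon_superset[of ?Y])
  finally show ?thesis .
qed

lemma poly_eval_mon: "poly_eval R \<sigma> a p =
    (\<Oplus>m\<in>Poly_Mapping.keys p. \<sigma> (Poly_Mapping.lookup p m) \<otimes> mon m)"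
  by (simp add: poly_eval_def mon_def)

lemma poly_eval_superset:
  assumes "finite M" "Poly_Mapping.keys p \<subseteq> M" "\<And>m. m \<in> M \<Longrightarrow> Poly_Mapping.keys m \<subseteq> X"
  shows "poly_eval R \<sigma> a p = (\<Oplus>m\<in>M. \<sigma> (Poly_Mapping.lookup p m) \<otimes> mon m)"
  unfolding poly_eval_mon
  using assms by (intro add.finprod_mono_neutral_cong_left)
    (auto simp: in_keys_iff scalar_zero mon_closed scalar_simps)

lemma poly_eval_closed: "p \<in> polys_in X \<Longrightarrow> poly_eval R \<sigma> a p \<in> carrier R"
  unfolding poly_eval_mon
  by (intro finsum_closed) (auto simp: scalar_simps polys_in_def Pi_iff intro!: m_closed mon_closed)

lemma poly_eval_zero: "poly_eval R \<sigma> a 0 = \<zero>"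
  by (simp add: poly_eval_mon)

lemma poly_eval_single:
  assumes "Poly_Mapping.keys m \<subseteq> X"
  shows "poly_eval R \<sigma> a (Poly_Mapping.single m c) = \<sigma> c \<otimes> mon m"
  using assms by (subst poly_eval_superset[of "{m}"]) (auto simp: scalar_simps mon_closed)

lemma poly_eval_add:
  assumes "p \<in> polys_in X" "q \<in> polys_in X"
  shows "poly_eval R \<sigma> a (p + q) = poly_eval R \<sigma> a p \<oplus> poly_eval R \<sigma> a q"
proof -
  let ?M = "Poly_Mapping.keys p \<union> Poly_Mapping.keys q"
  have M: "finite ?M" "\<And>m. m \<in> ?M \<Longrightarrow> Poly_Mapping.keys m \<subseteq> X"
    using assms by (auto simp: polys_in_def)
  have closed: "mon m \<in> carrier R" if "m \<in> ?M" for m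
    using M(2)[OF that] by (rule mon_closed)
  have "poly_eval R \<sigma> a (p + q) = (\<Oplus>m\<in>?M. \<sigma> (Poly_Mapping.lookup (p + q) m) \<otimes> mon m)"
    using M keys_add[of p q] by (intro poly_eval_superset) auto
  also have "\<dots> = (\<Oplus>m\<in>?M. \<sigma> (Poly_Mapping.lookup p m) \<otimes> mon m \<oplus> \<sigma> (Poly_Mapping.lookup q m) \<otimes> mon m)"
    using closed
    by (intro finsum_cong) (auto simp: lookup_add scalar_simps l_distr simp_implies_def)
  also have "\<dots> = poly_eval R \<sigma> a p \<oplus> poly_eval R \<sigma> a q"
    using closed M poly_eval_superset[of ?M p] poly_eval_superset[of ?M q]
    by (subst finsum_addf) (auto simp: scalar_simps Pi_iff)
  finally show ?thesis .
qed

lemma poly_eval_mult_single: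
  assumes "p \<in> polys_in X" "Poly_Mapping.keys m \<subseteq> X"
  shows "poly_eval R \<sigma> a (Poly_Mapping.single m c * p) =
    poly_eval R \<sigma> a (Poly_Mapping.single m c) \<otimes> poly_eval R \<sigma> a p"
proof -
  let ?s = "Poly_Mapping.single m c"
  have s: "?s \<in> polys_in X"
    using assms by (intro polys_in_single)
  have "p \<in> polys_in X \<and> poly_eval R \<sigma> a (?s * p) = poly_eval R \<sigma> a ?s \<otimes> poly_eval R \<sigma> a p"
  proof (induction p rule: poly_mapping_single_induct)
    case zero
    show ?case using s by (simp add: poly_eval_zero poly_eval_closed)
  next
    case (single k)
    then have k: "Poly_Mapping.keys k \<subseteq> X"
      using assms by (auto simp: polys_in_def)
    then have "Poly_Mapping.keys (m + k) \<subseteq> X"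
      using assms keys_add[of m k] by auto
    then show ?case
      using assms k by (simp add: mult_single poly_eval_single mon_add scalar_simps mon_closed m_ac
          polys_in_single)
  next
    case (add q r)
    then show ?case
      using s by (simp add: algebra_simps poly_eval_add polys_in_mult poly_eval_closed r_distr polys_in_add)
  qed
  then show ?thesis ..
qed

lemma poly_eval_mult:
  assumes "p \<in> polys_in X" "q \<in> polys_in X"
  shows "poly_eval R \<sigma> a (p * q) = poly_eval R \<sigma> a p \<otimes> poly_eval R \<sigma> a q"
proof -
  have "p \<in> polys_in X \<and> poly_eval R \<sigma> a (p * q) = poly_eval R \<sigma> a p \<otimes> poly_eval R \<sigma> a q"
  proof (induction p rule: poly_mapping_single_induct)
    case zero
    show ?case using assms by (simp add: poly_eval_zero poly_eval_closed)
  next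
    case (single k)
    then show ?case
      using assms by (auto simp: polys_in_def poly_eval_mult_single)
  next
    case (add r s)
    then show ?case
      using assms
      by (simp add: algebra_simps poly_eval_add polys_in_mult poly_eval_closed l_distr polys_in_add)
  qed
  then show ?thesis ..
qed

text \<open>Polynomial values form a subring containing the scalars and the points; conversely each
  term is a product of such elements. Membership in a generated algebra thereby becomes the
  existence of a polynomial whose terms can be inspected.\<close>

lemma generated_algebra_eq: "generated_algebra R \<sigma> (a ` X) = poly_eval R \<sigma> a ` polys_in X"
proof
  let ?E = "poly_eval R \<sigma> a"
  have scalar: "\<sigma> c \<in> ?E ` polys_in X" for c
  proof
    show "\<sigma> c = ?E (Poly_Mapping.single 0 c)"
      by (simp add: poly_eval_single mon_zero scalar_simps)
  qed (simp add: polys_in_single)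
  have var: "a x \<in> ?E ` polys_in X" if "x \<in> X" for x
  proof
    have "a x \<in> carrier R"
      using that point_closed by auto
    then show "a x = ?E (Poly_Mapping.single (Poly_Mapping.single x 1) 1)"
      using that by (auto simp: poly_eval_single mon_def scalar_simps)
  qed (use that in \<open>auto simp: polys_in_def\<close>)
  have uminus: "\<ominus> ?E p \<in> ?E ` polys_in X" if "p \<in> polys_in X" for p
  proof
    show "\<ominus> ?E p = ?E (- p)"
    proof (rule minus_equality)
      show "?E (- p) \<oplus> ?E p = \<zero>"
        using that poly_eval_add[of "- p" p] by (simp add: polys_in_uminus poly_eval_zero)
    qed (auto simp: that polys_in_uminus poly_eval_closed)
  qed (use that polys_in_uminus in auto)
  have "subring (?E ` polys_in X) R"
  proof (rule subringI)
    show "\<one> \<in> ?E ` polys_in X"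
      using scalar[of 1] by (simp add: scalar_simps)
    show "h1 \<oplus> h2 \<in> ?E ` polys_in X" if "h1 \<in> ?E ` polys_in X" "h2 \<in> ?E ` polys_in X" for h1 h2
    proof -
      from that obtain p q where pq: "h1 = ?E p" "p \<in> polys_in X" "h2 = ?E q" "q \<in> polys_in X"
        by blast
      then have "h1 \<oplus> h2 = ?E (p + q)"
        by (simp only: poly_eval_add)
      then show ?thesis using pq polys_in_add by blast
    qed
    show "h1 \<otimes> h2 \<in> ?E ` polys_in X" if "h1 \<in> ?E ` polys_in X" "h2 \<in> ?E ` polys_in X" for h1 h2
    proof -
      from that obtain p q where pq: "h1 = ?E p" "p \<in> polys_in X" "h2 = ?E q" "q \<in> polys_in X"
        by blast
      then have "h1 \<otimes> h2 = ?E (p * q)"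
        by (simp only: poly_eval_mult)
      then show ?thesis using pq polys_in_mult by blast
    qed
  qed (auto simp: poly_eval_closed uminus)
  then show "generated_algebra R \<sigma> (a ` X) \<subseteq> ?E ` polys_in X"
    unfolding generated_algebra_def
    by (intro generate_ring_min_subring1) (use scalar var point_closed in \<open>auto simp: scalar_simps\<close>)
  have gen: "subring (generated_algebra R \<sigma> (a ` X)) R"
    unfolding generated_algebra_def
    using point_closed by (intro generate_ring_is_subring) (auto simp: scalar_simps)
  have gen_scalar: "\<sigma> c \<in> generated_algebra R \<sigma> (a ` X)" for c
    unfolding generated_algebra_def by (rule generate_ring.incl) auto
  have gen_pow: "a x [^] (n::nat) \<in> generated_algebra R \<sigma> (a ` X)" if "x \<in> X" for x n
  proof (induction n)
    case 0
    then show ?case using subringE(3)[OF gen] by simp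
  next
    case (Suc n)
    have "a x \<in> generated_algebra R \<sigma> (a ` X)"
      unfolding generated_algebra_def by (rule generate_ring.incl) (use that in auto)
    then show ?case using Suc subringE(6)[OF gen] by simp
  qed
  have gen_mon: "mon m \<in> generated_algebra R \<sigma> (a ` X)" if "Poly_Mapping.keys m \<subseteq> X" for m
  proof -
    have "finite Y \<Longrightarrow> Y \<subseteq> X \<Longrightarrow>
        (\<Otimes>x\<in>Y. a x [^] Poly_Mapping.lookup m x) \<in> generated_algebra R \<sigma> (a ` X)" for Y
    proof (induction Y rule: finite_induct)
      case empty
      then show ?case using subringE(3)[OF gen] by simp
    next
      case (insert x Y)
      then show ?case
        using subringE(6)[OF gen] gen_pow point_closed by (subst finprod_insert) auto
    qed
    then show ?thesis
      unfolding mon_def using that by simp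
  qed
  show "?E ` polys_in X \<subseteq> generated_algebra R \<sigma> (a ` X)"
  proof clarify
    fix p :: "('x, 'k) mpoly"
    assume p: "p \<in> polys_in X"
    have "p \<in> polys_in X \<and> ?E p \<in> generated_algebra R \<sigma> (a ` X)"
    proof (induction p rule: poly_mapping_single_induct)
      case zero
      show ?case using subringE(2)[OF gen] by (simp add: poly_eval_zero)
    next
      case (single m)
      then have "Poly_Mapping.keys m \<subseteq> X"
        using p by (auto simp: polys_in_def)
      then show ?case
        using subringE(6)[OF gen] gen_mon gen_scalar by (simp add: poly_eval_single polys_in_single)
    next
      case (add q r)
      then show ?case
        using subringE(7)[OF gen] by (simp add: poly_eval_add polys_in_add)
    qed
    then show "?E p \<in> generated_algebra R \<sigma> (a ` X)" ..
  qed
qed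

end

lemma polys_in_UNIV [simp]: "p \<in> polys_in UNIV"
  by (simp add: polys_in_def)

text \<open>With \<open>Q\<close> a condition on value and degree this is the projection of a
  polynomial to a homogeneous part; with \<open>Q\<close> and its negation it separates the lowest
  terms from the rest.\<close>

definition restrict_keys :: "('a \<Rightarrow> bool) \<Rightarrow> ('a \<Rightarrow>\<^sub>0 'b) \<Rightarrow> ('a \<Rightarrow>\<^sub>0 'b::zero)" where
  "restrict_keys Q p = Poly_Mapping.mapp (\<lambda>k c. if Q k then c else 0) p"

lemma lookup_restrict_keys:
  "Poly_Mapping.lookup (restrict_keys Q p) k = (if Q k then Poly_Mapping.lookup p k else 0)"
  by (simp add: restrict_keys_def lookup_mapp when_def in_keys_iff)

lemma keys_restrict_keys: "Poly_Mapping.keys (restrict_keys Q p) = {k \<in> Poly_Mapping.keys p. Q k}"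
  by (auto simp: in_keys_iff lookup_restrict_keys split: if_splits)

lemma restrict_keys_zero [simp]: "restrict_keys Q 0 = 0"
  by (rule poly_mapping_eqI) (simp add: lookup_restrict_keys)

lemma restrict_keys_add:
  fixes p :: "'a \<Rightarrow>\<^sub>0 'b::monoid_add"
  shows "restrict_keys Q (p + q) = restrict_keys Q p + restrict_keys Q q"
  by (rule poly_mapping_eqI) (simp add: lookup_restrict_keys lookup_add)

lemma restrict_keys_single:
  "restrict_keys Q (Poly_Mapping.single k c) = (if Q k then Poly_Mapping.single k c else 0)"
  by (rule poly_mapping_eqI) (auto simp: lookup_restrict_keys lookup_single when_def)

lemma restrict_keys_split:
  fixes p :: "'a \<Rightarrow>\<^sub>0 'b::monoid_add"
  shows "restrict_keys Q p + restrict_keys (\<lambda>k. \<not> Q k) p = p"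
  by (rule poly_mapping_eqI) (simp add: lookup_restrict_keys lookup_add)

lemma restrict_keys_id: "(\<And>k. k \<in> Poly_Mapping.keys p \<Longrightarrow> Q k) \<Longrightarrow> restrict_keys Q p = p"
  by (rule poly_mapping_eqI) (auto simp: lookup_restrict_keys in_keys_iff)

lemma restrict_keys_none: "(\<And>k. k \<in> Poly_Mapping.keys p \<Longrightarrow> \<not> Q k) \<Longrightarrow> restrict_keys Q p = 0"
  by (rule poly_mapping_eqI) (auto simp: lookup_restrict_keys in_keys_iff)

lemma restrict_keys_polys_in: "p \<in> polys_in X \<Longrightarrow> restrict_keys Q p \<in> polys_in X"
  by (auto simp: polys_in_def keys_restrict_keys)

section \<open>Tensor products\<close>

text \<open>The homomorphism induced by \<open>f\<close> on the free abelian group. Tensors are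
  cosets in that group, so a map on tensors is first defined here and then shown to respect the
  relations.\<close>

definition linear_extension :: "('x \<Rightarrow> 'z::comm_ring_1) \<Rightarrow> ('x \<Rightarrow>\<^sub>0 int) \<Rightarrow> 'z" where
  "linear_extension f p = (\<Sum>x\<in>Poly_Mapping.keys p. of_int (Poly_Mapping.lookup p x) * f x)"

lemma linear_extension_superset:
  assumes "finite X" "Poly_Mapping.keys p \<subseteq> X"
  shows "linear_extension f p = (\<Sum>x\<in>X. of_int (Poly_Mapping.lookup p x) * f x)"
  unfolding linear_extension_def
  using assms by (intro sum.mono_neutral_left) (auto simp: in_keys_iff)

lemma linear_extension_add:
  "linear_extension f (p + q) = linear_extension f p + linear_extension f q"
  using keys_add[of p q]
  by (simp add: linear_extension_superset[of "Poly_Mapping.keys p \<union> Poly_Mapping.keys q"]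
      lookup_add distrib_right sum.distrib)

lemma linear_extension_zero [simp]: "linear_extension f 0 = 0"
  by (simp add: linear_extension_def)

lemma linear_extension_diff:
  "linear_extension f (p - q) = linear_extension f p - linear_extension f q"
  using linear_extension_add[of f "p - q" q] by (simp add: algebra_simps)

lemma linear_extension_single: "linear_extension f (Poly_Mapping.single x c) = of_int c * f x"
  by (subst linear_extension_superset[of "{x}"]) auto

locale algebra_pair = M: cring M + N: cring N
  for M :: "('m, 'a) ring_scheme" and N :: "('n, 'c) ring_scheme" +
  fixes \<iota>M :: "'k \<Rightarrow> 'm" and \<iota>N :: "'k \<Rightarrow> 'n"
  assumes \<iota>M_closed: "\<iota>M c \<in> carrier M" and \<iota>N_closed: "\<iota>N c \<in> carrier N"
begin

abbreviation "P \<equiv> free_pair_ring M N"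
abbreviation "I \<equiv> tensor_ideal M \<iota>M N \<iota>N"
abbreviation "T \<equiv> tensor_algebra M \<iota>M N \<iota>N"
abbreviation "tens \<equiv> tensor M \<iota>M N \<iota>N"

lemma free_pair_simps [simp]:
  "carrier P = {p. Poly_Mapping.keys p \<subseteq> carrier M \<times> carrier N}"
  "\<one>\<^bsub>P\<^esub> = pair_gen \<one>\<^bsub>M\<^esub> \<one>\<^bsub>N\<^esub>" "\<zero>\<^bsub>P\<^esub> = 0" "p \<oplus>\<^bsub>P\<^esub> q = p + q"
  by (auto simp: free_pair_ring_def)

lemma free_pair_mult_superset:
  assumes "finite X" "Poly_Mapping.keys p \<subseteq> X" "finite Y" "Poly_Mapping.keys q \<subseteq> Y"
  shows "p \<otimes>\<^bsub>P\<^esub> q = (\<Sum>x\<in>X. \<Sum>y\<in>Y.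
    Poly_Mapping.single (fst x \<otimes>\<^bsub>M\<^esub> fst y, snd x \<otimes>\<^bsub>N\<^esub> snd y)
      (Poly_Mapping.lookup p x * Poly_Mapping.lookup q y))"
proof -
  have "(\<Sum>y\<in>Poly_Mapping.keys q. Poly_Mapping.single (fst x \<otimes>\<^bsub>M\<^esub> fst y, snd x \<otimes>\<^bsub>N\<^esub> snd y)
      (Poly_Mapping.lookup p x * Poly_Mapping.lookup q y)) =
    (\<Sum>y\<in>Y. Poly_Mapping.single (fst x \<otimes>\<^bsub>M\<^esub> fst y, snd x \<otimes>\<^bsub>N\<^esub> snd y)
      (Poly_Mapping.lookup p x * Poly_Mapping.lookup q y))" for x
    using assms by (intro sum.mono_neutral_left) (auto simp: in_keys_iff)
  then show ?thesis
    using assms unfolding free_pair_ring_def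
    by (simp, intro sum.mono_neutral_left) (auto simp: in_keys_iff)
qed

lemma free_pair_mult_add_left: "(p + q) \<otimes>\<^bsub>P\<^esub> r = p \<otimes>\<^bsub>P\<^esub> r + q \<otimes>\<^bsub>P\<^esub> r"
  using keys_add[of p q]
  by (simp add: free_pair_mult_superset[of "Poly_Mapping.keys p \<union> Poly_Mapping.keys q" _ "Poly_Mapping.keys r"]
      lookup_add distrib_right single_add sum.distrib)

lemma free_pair_mult_add_right: "r \<otimes>\<^bsub>P\<^esub> (p + q) = r \<otimes>\<^bsub>P\<^esub> p + r \<otimes>\<^bsub>P\<^esub> q"
  using keys_add[of p q]
  by (simp add: free_pair_mult_superset[of "Poly_Mapping.keys r" _ "Poly_Mapping.keys p \<union> Poly_Mapping.keys q"]
      lookup_add distrib_left single_add sum.distrib)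

lemma free_pair_mult_zero [simp]: "0 \<otimes>\<^bsub>P\<^esub> p = 0" "p \<otimes>\<^bsub>P\<^esub> 0 = 0"
  by (simp_all add: free_pair_ring_def)

lemma free_pair_mult_diff_right: "r \<otimes>\<^bsub>P\<^esub> (p - q) = r \<otimes>\<^bsub>P\<^esub> p - r \<otimes>\<^bsub>P\<^esub> q"
  using free_pair_mult_add_right[of r "p - q" q] by (simp add: algebra_simps)

lemma free_pair_mult_single:
  "Poly_Mapping.single x a \<otimes>\<^bsub>P\<^esub> Poly_Mapping.single y b =
    Poly_Mapping.single (fst x \<otimes>\<^bsub>M\<^esub> fst y, snd x \<otimes>\<^bsub>N\<^esub> snd y) (a * b)"
  by (subst free_pair_mult_superset[of "{x}" _ "{y}"]) auto

lemma free_pair_mult_closed: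
  assumes "p \<in> carrier P" "q \<in> carrier P"
  shows "p \<otimes>\<^bsub>P\<^esub> q \<in> carrier P"
proof -
  have "Poly_Mapping.keys (p \<otimes>\<^bsub>P\<^esub> q) \<subseteq> (\<Union>x\<in>Poly_Mapping.keys p. \<Union>y\<in>Poly_Mapping.keys q.
      {(fst x \<otimes>\<^bsub>M\<^esub> fst y, snd x \<otimes>\<^bsub>N\<^esub> snd y)})"
    unfolding free_pair_ring_def
    by (simp, intro order.trans[OF keys_sum] UN_mono order.refl) auto
  also have "\<dots> \<subseteq> carrier M \<times> carrier N"
    using assms by fastforce
  finally show ?thesis by simp
qed

lemma free_pair_induct [consumes 1, case_names zero single add]:
  assumes p: "p \<in> carrier P"
    and "Q 0"
    and "\<And>m n c. m \<in> carrier M \<Longrightarrow> n \<in> carrier N \<Longrightarrow> Q (Poly_Mapping.single (m, n) c)"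
    and "\<And>q r. q \<in> carrier P \<Longrightarrow> r \<in> carrier P \<Longrightarrow> Q q \<Longrightarrow> Q r \<Longrightarrow> Q (q + r)"
  shows "Q p"
proof -
  have "p \<in> carrier P \<and> Q p"
  proof (induction p rule: poly_mapping_single_induct)
    case zero
    show ?case using assms by simp
  next
    case (single k)
    then show ?case using p assms(3)[of "fst k" "snd k"] by auto
  next
    case (add q r)
    then show ?case using keys_add[of q r] assms(4) by auto
  qed
  then show ?thesis ..
qed

text \<open>Both sides are additive in each argument, so three nested inductions reduce the claim to
  pairs, where it holds in each factor.\<close>

lemma free_pair_assoc:
  assumes "p \<in> carrier P" "q \<in> carrier P" "r \<in> carrier P"
  shows "p \<otimes>\<^bsub>P\<^esub> q \<otimes>\<^bsub>P\<^esub> r = p \<otimes>\<^bsub>P\<^esub> (q \<otimes>\<^bsub>P\<^esub> r)"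
  using assms(1)
proof (induction p rule: free_pair_induct)
  case (single m n c)
  show ?case using assms(2)
  proof (induction q rule: free_pair_induct)
    case (single m' n' c')
    show ?case using assms(3)
      by (induction r rule: free_pair_induct)
        (auto simp: free_pair_mult_single free_pair_mult_add_right single.hyps
          \<open>m \<in> carrier M\<close> \<open>n \<in> carrier N\<close> \<open>m' \<in> carrier M\<close> \<open>n' \<in> carrier N\<close> M.m_assoc N.m_assoc mult.assoc)
  qed (auto simp: free_pair_mult_add_right free_pair_mult_add_left)
qed (auto simp: free_pair_mult_add_left)

lemma free_pair_comm:
  assumes "p \<in> carrier P" "q \<in> carrier P"
  shows "p \<otimes>\<^bsub>P\<^esub> q = q \<otimes>\<^bsub>P\<^esub> p"
  using assms(1)
proof (induction p rule: free_pair_induct)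
  case (single m n c)
  show ?case using assms(2) single
    by (induction q rule: free_pair_induct)
      (auto simp: free_pair_mult_single free_pair_mult_add_right free_pair_mult_add_left
        M.m_comm N.m_comm mult.commute)
qed (auto simp: free_pair_mult_add_left free_pair_mult_add_right)

lemma free_pair_one:
  assumes "p \<in> carrier P"
  shows "\<one>\<^bsub>P\<^esub> \<otimes>\<^bsub>P\<^esub> p = p"
  using assms
  by (induction p rule: free_pair_induct) (auto simp: free_pair_mult_single free_pair_mult_add_right)

lemma cring_free_pair: "cring P"
proof (rule cringI)
  show "abelian_group P"
  proof (rule abelian_groupI)
    fix x assume "x \<in> carrier P"
    then show "\<exists>y\<in>carrier P. y \<oplus>\<^bsub>P\<^esub> x = \<zero>\<^bsub>P\<^esub>"
      by (intro bexI[of _ "- x"]) auto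
  next
    fix x y assume "x \<in> carrier P" "y \<in> carrier P"
    then show "x \<oplus>\<^bsub>P\<^esub> y \<in> carrier P"
      using keys_add[of x y] by auto
  qed (auto simp: add.assoc add.commute)
  show "comm_monoid P"
  proof (rule comm_monoidI)
    show "\<one>\<^bsub>P\<^esub> \<in> carrier P" by simp
  qed (rule free_pair_mult_closed free_pair_assoc free_pair_one free_pair_comm; assumption)+
qed (simp add: free_pair_mult_add_left)

sublocale P: cring P by (rule cring_free_pair)

lemma a_inv_free_pair: "p \<in> carrier P \<Longrightarrow> \<ominus>\<^bsub>P\<^esub> p = - p"
  by (rule P.minus_equality) auto

lemma tensor_relations_closed: "tensor_relations M \<iota>M N \<iota>N \<subseteq> carrier P"
proof -
  have "pair_gen m n \<in> carrier P" if "m \<in> carrier M" "n \<in> carrier N" for m n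
    using that by simp
  moreover have "p - q \<in> carrier P" if "p \<in> carrier P" "q \<in> carrier P" for p q
    using that keys_diff[of p q] by auto
  ultimately show ?thesis
    unfolding tensor_relations_def
    by (auto simp del: free_pair_simps simp: \<iota>M_closed \<iota>N_closed)
qed

sublocale I: ideal I P
  unfolding tensor_ideal_def by (rule P.genideal_ideal[OF tensor_relations_closed])

sublocale T: cring T
  unfolding tensor_algebra_def by (rule I.quotient_is_cring[OF cring_free_pair])

lemma proj_hom: "(+>\<^bsub>P\<^esub>) I \<in> ring_hom P T"
  unfolding tensor_algebra_def by (rule I.rcos_ring_hom)

lemma proj_eqI:
  assumes "p \<in> carrier P" "q \<in> carrier P" "p - q \<in> I"
  shows "I +>\<^bsub>P\<^esub> p = I +>\<^bsub>P\<^esub> q"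
proof -
  have "p \<ominus>\<^bsub>P\<^esub> q = p - q"
    using assms by (simp add: a_minus_def a_inv_free_pair)
  then show ?thesis
    using P.quotient_eq_iff_same_a_r_cos[OF I.ideal_axioms assms(1,2)] assms(3) by simp
qed

lemma proj_self: "p \<in> carrier P \<Longrightarrow> p \<in> I +>\<^bsub>P\<^esub> p"
  by (rule I.a_rcos_self)

lemma proj_diff:
  assumes "t \<in> carrier T" "p \<in> t" "q \<in> t"
  shows "p - q \<in> I" "p \<in> carrier P"
proof -
  obtain r where r: "r \<in> carrier P" "t = I +>\<^bsub>P\<^esub> r"
    using assms by (auto simp: tensor_algebra_def FactRing_def A_RCOSETS_def' simp del: free_pair_simps)
  then obtain i j where ij: "i \<in> I" "p = i + r" "j \<in> I" "q = j + r"
    using assms by (auto simp: a_r_coset_def')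
  show "p - q \<in> I"
    using I.a_closed[OF ij(1) I.a_inv_closed[OF ij(3)]] a_inv_free_pair[OF I.Icarr[OF ij(3)]] ij
    by simp
  show "p \<in> carrier P"
    using ij(2) P.a_closed[OF I.Icarr[OF ij(1)] r(1)] by simp
qed

lemma tens_closed: "m \<in> carrier M \<Longrightarrow> n \<in> carrier N \<Longrightarrow> tens m n \<in> carrier T"
  unfolding tensor_def using ring_hom_closed[OF proj_hom] by simp

lemma tens_self: "m \<in> carrier M \<Longrightarrow> n \<in> carrier N \<Longrightarrow> pair_gen m n \<in> tens m n"
  unfolding tensor_def by (rule proj_self) simp

lemma tens_one: "\<one>\<^bsub>T\<^esub> = tens \<one>\<^bsub>M\<^esub> \<one>\<^bsub>N\<^esub>"
  unfolding tensor_def using ring_hom_one[OF proj_hom] by simp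

lemma tens_mult:
  assumes "m \<in> carrier M" "m' \<in> carrier M" "n \<in> carrier N" "n' \<in> carrier N"
  shows "tens m n \<otimes>\<^bsub>T\<^esub> tens m' n' = tens (m \<otimes>\<^bsub>M\<^esub> m') (n \<otimes>\<^bsub>N\<^esub> n')"
  unfolding tensor_def using assms
  by (subst ring_hom_mult[OF proj_hom, symmetric]) (auto simp: free_pair_mult_single)

lemma tens_add_left:
  assumes "m \<in> carrier M" "m' \<in> carrier M" "n \<in> carrier N"
  shows "tens (m \<oplus>\<^bsub>M\<^esub> m') n = tens m n \<oplus>\<^bsub>T\<^esub> tens m' n"
proof -
  have "pair_gen (m \<oplus>\<^bsub>M\<^esub> m') n - pair_gen m n - pair_gen m' n \<in> tensor_relations M \<iota>M N \<iota>N"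
    using assms unfolding tensor_relations_def by blast
  then have "pair_gen (m \<oplus>\<^bsub>M\<^esub> m') n - (pair_gen m n + pair_gen m' n) \<in> I"
    using P.genideal_self[OF tensor_relations_closed] unfolding tensor_ideal_def
    by (auto simp: diff_diff_eq)
  moreover have "pair_gen m n + pair_gen m' n \<in> carrier P"
    using assms P.a_closed[of "pair_gen m n" "pair_gen m' n"] by simp
  moreover have "pair_gen (m \<oplus>\<^bsub>M\<^esub> m') n \<in> carrier P"
    using assms by simp
  ultimately have "tens (m \<oplus>\<^bsub>M\<^esub> m') n = I +>\<^bsub>P\<^esub> (pair_gen m n \<oplus>\<^bsub>P\<^esub> pair_gen m' n)"
    unfolding tensor_def by (simp only: free_pair_simps proj_eqI)
  also have "\<dots> = tens m n \<oplus>\<^bsub>T\<^esub> tens m' n"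
    unfolding tensor_def using assms by (intro ring_hom_add[OF proj_hom]) auto
  finally show ?thesis .
qed

text \<open>The elements all of whose multiples are mapped to \<open>Z\<close> form an ideal containing the relations.\<close>

lemma linear_extension_tensor_ideal:
  fixes f :: "'m \<times> 'n \<Rightarrow> 'z::comm_ring_1"
  assumes Z: "0 \<in> Z" "\<And>x y. x \<in> Z \<Longrightarrow> y \<in> Z \<Longrightarrow> x + y \<in> Z" "\<And>x. x \<in> Z \<Longrightarrow> - x \<in> Z"
    and left: "\<And>m m' n. m \<in> carrier M \<Longrightarrow> m' \<in> carrier M \<Longrightarrow> n \<in> carrier N \<Longrightarrow>
      f (m \<oplus>\<^bsub>M\<^esub> m', n) - f (m, n) - f (m', n) \<in> Z"
    and right: "\<And>m n n'. m \<in> carrier M \<Longrightarrow> n \<in> carrier N \<Longrightarrow> n' \<in> carrier N \<Longrightarrow>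
      f (m, n \<oplus>\<^bsub>N\<^esub> n') - f (m, n) - f (m, n') \<in> Z"
    and scalar: "\<And>c m n. m \<in> carrier M \<Longrightarrow> n \<in> carrier N \<Longrightarrow>
      f (\<iota>M c \<otimes>\<^bsub>M\<^esub> m, n) - f (m, \<iota>N c \<otimes>\<^bsub>N\<^esub> n) \<in> Z"
    and p: "p \<in> I"
  shows "linear_extension f p \<in> Z"
proof -
  let ?L = "linear_extension f"
  \<comment> \<open>The preimage of \<open>Z\<close> under a group homomorphism is only a subgroup.
    Demanding membership of all multiples cuts out the largest ideal inside it; the multiplier 1
    recovers \<open>p\<close> at the end.\<close>
  define J where "J = {p \<in> carrier P. \<forall>q\<in>carrier P. ?L (q \<otimes>\<^bsub>P\<^esub> p) \<in> Z}"
  have multiple: "of_int k * z \<in> Z" if "z \<in> Z" for k z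
  proof (induction k rule: int_induct[where k = 0])
    case (step1 i)
    then show ?case using Z(2)[OF _ that] by (simp add: distrib_right)
  next
    case (step2 i)
    then show ?case using Z(2)[OF _ Z(3)[OF that]] by (simp add: left_diff_distrib)
  qed (simp add: Z)
  have J_P: "x \<in> carrier P" if "x \<in> J" for x
    using that by (simp add: J_def)
  have "ideal J P"
  proof (rule idealI)
    show "ring P" by (rule P.ring_axioms)
    show "subgroup J (add_monoid P)"
    proof (rule P.add.subgroupI)
      show "J \<noteq> {}"
        using Z(1) by (auto simp: J_def intro!: exI[of _ 0])
      show "\<ominus>\<^bsub>P\<^esub> a \<in> J" if "a \<in> J" for a
      proof -
        have "?L (q \<otimes>\<^bsub>P\<^esub> - a) = - ?L (q \<otimes>\<^bsub>P\<^esub> a)" for q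
          using free_pair_mult_diff_right[of q 0 a] linear_extension_diff[of f 0] by simp
        then show ?thesis
          using that Z(3) by (auto simp: J_def a_inv_free_pair)
      qed
      show "a \<oplus>\<^bsub>P\<^esub> b \<in> J" if "a \<in> J" "b \<in> J" for a b
        using that Z(2) P.a_closed[of a b]
        by (auto simp: J_def free_pair_mult_add_right linear_extension_add)
    qed (auto simp: J_def)
    show l: "x \<otimes>\<^bsub>P\<^esub> a \<in> J" if "a \<in> J" "x \<in> carrier P" for a x
    proof -
      have "?L (q \<otimes>\<^bsub>P\<^esub> (x \<otimes>\<^bsub>P\<^esub> a)) \<in> Z" if "q \<in> carrier P" for q
      proof -
        have "q \<otimes>\<^bsub>P\<^esub> (x \<otimes>\<^bsub>P\<^esub> a) = (q \<otimes>\<^bsub>P\<^esub> x) \<otimes>\<^bsub>P\<^esub> a"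
          using that J_P \<open>a \<in> J\<close> \<open>x \<in> carrier P\<close> by (intro P.m_assoc[symmetric])
        then show ?thesis
          using \<open>a \<in> J\<close> P.m_closed[OF that \<open>x \<in> carrier P\<close>] unfolding J_def by simp
      qed
      then show ?thesis
        using P.m_closed[OF \<open>x \<in> carrier P\<close> J_P[OF \<open>a \<in> J\<close>]] unfolding J_def by simp
    qed
    show "a \<otimes>\<^bsub>P\<^esub> x \<in> J" if "a \<in> J" "x \<in> carrier P" for a x
      using l[OF that] P.m_comm[OF J_P[OF that(1)] that(2)] by simp
  qed
  moreover have "tensor_relations M \<iota>M N \<iota>N \<subseteq> J"
  proof
    fix r assume r: "r \<in> tensor_relations M \<iota>M N \<iota>N"
    have "?L (q \<otimes>\<^bsub>P\<^esub> r) \<in> Z" if "q \<in> carrier P" for q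
      using that
    proof (induction q rule: free_pair_induct)
      case zero
      show ?case by (simp add: Z)
    next
      case (single m0 n0 c)
      \<comment> \<open>Multiplying a relation by a single pair yields an integer multiple of a
        relation of the same kind, to which the matching hypothesis on \<open>f\<close>
        applies.\<close>
      consider m m' n where "m \<in> carrier M" "m' \<in> carrier M" "n \<in> carrier N"
          "r = pair_gen (m \<oplus>\<^bsub>M\<^esub> m') n - pair_gen m n - pair_gen m' n"
        | m n n' where "m \<in> carrier M" "n \<in> carrier N" "n' \<in> carrier N"
          "r = pair_gen m (n \<oplus>\<^bsub>N\<^esub> n') - pair_gen m n - pair_gen m n'"
        | k m n where "m \<in> carrier M" "n \<in> carrier N"
          "r = pair_gen (\<iota>M k \<otimes>\<^bsub>M\<^esub> m) n - pair_gen m (\<iota>N k \<otimes>\<^bsub>N\<^esub> n)"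
        using r unfolding tensor_relations_def
        by (elim UnE CollectE exE conjE) (rule that; assumption)+
      then show ?case
      proof cases
        case 1
        have "?L (Poly_Mapping.single (m0, n0) c \<otimes>\<^bsub>P\<^esub> r) = of_int c *
          (f (m0 \<otimes>\<^bsub>M\<^esub> m \<oplus>\<^bsub>M\<^esub> m0 \<otimes>\<^bsub>M\<^esub> m', n0 \<otimes>\<^bsub>N\<^esub> n) - f (m0 \<otimes>\<^bsub>M\<^esub> m, n0 \<otimes>\<^bsub>N\<^esub> n) - f (m0 \<otimes>\<^bsub>M\<^esub> m', n0 \<otimes>\<^bsub>N\<^esub> n))"
          using 1 single
          by (simp add: free_pair_mult_diff_right linear_extension_diff free_pair_mult_single
              linear_extension_single M.r_distr right_diff_distrib)
        then show ?thesis
          using multiple left 1 single by simp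
      next
        case 2
        have "?L (Poly_Mapping.single (m0, n0) c \<otimes>\<^bsub>P\<^esub> r) = of_int c *
          (f (m0 \<otimes>\<^bsub>M\<^esub> m, n0 \<otimes>\<^bsub>N\<^esub> n \<oplus>\<^bsub>N\<^esub> n0 \<otimes>\<^bsub>N\<^esub> n') - f (m0 \<otimes>\<^bsub>M\<^esub> m, n0 \<otimes>\<^bsub>N\<^esub> n) - f (m0 \<otimes>\<^bsub>M\<^esub> m, n0 \<otimes>\<^bsub>N\<^esub> n'))"
          using 2 single
          by (simp add: free_pair_mult_diff_right linear_extension_diff free_pair_mult_single
              linear_extension_single N.r_distr right_diff_distrib)
        then show ?thesis
          using multiple right 2 single by simp
      next
        case 3
        have "?L (Poly_Mapping.single (m0, n0) c \<otimes>\<^bsub>P\<^esub> r) = of_int c *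
          (f (\<iota>M k \<otimes>\<^bsub>M\<^esub> (m0 \<otimes>\<^bsub>M\<^esub> m), n0 \<otimes>\<^bsub>N\<^esub> n) - f (m0 \<otimes>\<^bsub>M\<^esub> m, \<iota>N k \<otimes>\<^bsub>N\<^esub> (n0 \<otimes>\<^bsub>N\<^esub> n)))"
          using 3 single
          by (simp add: free_pair_mult_diff_right linear_extension_diff free_pair_mult_single
              linear_extension_single M.m_lcomm N.m_lcomm \<iota>M_closed \<iota>N_closed right_diff_distrib)
        then show ?thesis
          using multiple scalar 3 single by simp
      qed
    next
      case (add q s)
      then show ?case
        by (simp add: free_pair_mult_add_left linear_extension_add Z)
    qed
    then show "r \<in> J"
      using r tensor_relations_closed by (auto simp: J_def)
  qed
  ultimately have "I \<subseteq> J"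
    unfolding tensor_ideal_def by (rule P.genideal_minimal)
  then have pJ: "p \<in> J" using p by blast
  then have "?L (\<one>\<^bsub>P\<^esub> \<otimes>\<^bsub>P\<^esub> p) \<in> Z"
    using P.one_closed unfolding J_def by blast
  then show ?thesis
    using pJ J_P by (simp only: P.l_one)
qed

end

section \<open>The associated graded algebra and its tensor product with the group ring\<close>

lemma lookup_single_zero_mult:
  fixes p :: "'x::comm_monoid_add \<Rightarrow>\<^sub>0 'y::comm_ring_1"
  shows "Poly_Mapping.lookup (Poly_Mapping.single 0 c * p) k = c * Poly_Mapping.lookup p k"
  by (simp flip: mult_map_scale_conv_mult add: Poly_Mapping.map.rep_eq when_def)

lemma F_ge_iff: "f \<in> F_ge v \<gamma> \<longleftrightarrow> (f \<noteq> 0 \<longrightarrow> \<gamma> \<le> v f)"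
  by (auto simp: F_ge_def)

lemma F_gt_iff: "f \<in> F_gt v \<gamma> \<longleftrightarrow> (f \<noteq> 0 \<longrightarrow> \<gamma> < v f)"
  by (auto simp: F_gt_def)

lemma F_zero [simp]: "0 \<in> F_ge v \<gamma>" "0 \<in> F_gt v \<gamma>"
  by (auto simp: F_ge_iff F_gt_iff)

lemma F_gt_subset_F_ge: "f \<in> F_gt v \<gamma> \<Longrightarrow> f \<in> F_ge v \<gamma>"
  by (auto simp: F_ge_iff F_gt_iff)

context valued_graded_algebra
begin

section \<open>Values and the filtration of \<open>B\<close>\<close>

lemma scalar_simps [simp]:
  "\<iota> 1 = 1" "\<iota> 0 = 0" "\<iota> (c + d) = \<iota> c + \<iota> d" "\<iota> (c * d) = \<iota> c * \<iota> d" "\<iota> (- c) = - \<iota> c"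
proof -
  show 1: "\<iota> 1 = 1" "\<iota> (c * d) = \<iota> c * \<iota> d" for c d
    using ring_hom_memE[OF B_algebra] by auto
  show add: "\<iota> (c + d) = \<iota> c + \<iota> d" for c d
    using ring_hom_memE(3)[OF B_algebra, of c d] by simp
  show zero: "\<iota> 0 = 0"
    using add[of 0 0] by (metis add.right_neutral add_left_cancel)
  show "\<iota> (- c) = - \<iota> c"
    using add[of "- c" c] zero by (simp add: eq_neg_iff_add_eq_0)
qed

lemma scalar_eq_0_iff [simp]: "\<iota> c = 0 \<longleftrightarrow> c = 0"
proof
  assume "\<iota> c = 0"
  then have "\<iota> (c * inverse c) = 0"
    by simp
  then show "c = 0"
    by (metis right_inverse scalar_simps(1) zero_neq_one)
qed simp

lemma v_mult: "f \<noteq> 0 \<Longrightarrow> g \<noteq> 0 \<Longrightarrow> v (f * g) = v f + v g"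
  using valuation by (simp add: valuation_over_def)

lemma v_scalar_mult: "c \<noteq> 0 \<Longrightarrow> f \<noteq> 0 \<Longrightarrow> v (\<iota> c * f) = v f"
  using valuation unfolding valuation_over_def by blast

lemma v_one [simp]: "v 1 = 0"
  using v_mult[of 1 1] by simp

lemma v_scalar: "c \<noteq> 0 \<Longrightarrow> v (\<iota> c) = 0"
  using v_scalar_mult[of c 1] by simp

lemma v_uminus [simp]: "f \<noteq> 0 \<Longrightarrow> v (- f) = v f"
  using v_scalar_mult[of "- 1" f] by simp

lemma v_power: "f \<noteq> 0 \<Longrightarrow> v (f ^ n) = (\<Sum>_<n. v f)"
  by (induction n) (auto simp: v_mult add.commute)

lemma F_ge_add: "f \<in> F_ge v \<gamma> \<Longrightarrow> g \<in> F_ge v \<gamma> \<Longrightarrow> f + g \<in> F_ge v \<gamma>"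
proof -
  have "f \<noteq> 0 \<Longrightarrow> g \<noteq> 0 \<Longrightarrow> f + g \<noteq> 0 \<Longrightarrow> min (v f) (v g) \<le> v (f + g)"
    using valuation by (simp add: valuation_over_def)
  then show "f \<in> F_ge v \<gamma> \<Longrightarrow> g \<in> F_ge v \<gamma> \<Longrightarrow> f + g \<in> F_ge v \<gamma>"
    unfolding F_ge_iff min_def by (cases "f = 0"; cases "g = 0"; force split: if_splits)
qed

lemma F_gt_add: "f \<in> F_gt v \<gamma> \<Longrightarrow> g \<in> F_gt v \<gamma> \<Longrightarrow> f + g \<in> F_gt v \<gamma>"
proof -
  have "f \<noteq> 0 \<Longrightarrow> g \<noteq> 0 \<Longrightarrow> f + g \<noteq> 0 \<Longrightarrow> min (v f) (v g) \<le> v (f + g)"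
    using valuation by (simp add: valuation_over_def)
  then show "f \<in> F_gt v \<gamma> \<Longrightarrow> g \<in> F_gt v \<gamma> \<Longrightarrow> f + g \<in> F_gt v \<gamma>"
    unfolding F_gt_iff min_def by (cases "f = 0"; cases "g = 0"; force split: if_splits)
qed

lemma F_uminus: "- f \<in> F_ge v \<gamma> \<longleftrightarrow> f \<in> F_ge v \<gamma>" "- f \<in> F_gt v \<gamma> \<longleftrightarrow> f \<in> F_gt v \<gamma>"
  by (auto simp: F_ge_iff F_gt_iff)

lemma F_gt_diff: "f \<in> F_gt v \<gamma> \<Longrightarrow> g \<in> F_gt v \<gamma> \<Longrightarrow> f - g \<in> F_gt v \<gamma>"
  using F_gt_add[of f \<gamma> "- g"] by (simp add: F_uminus)

lemma F_gt_diff_commute: "f - g \<in> F_gt v \<gamma> \<longleftrightarrow> g - f \<in> F_gt v \<gamma>"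
  using F_uminus(2)[of "f - g" \<gamma>] by simp

lemma F_gt_diff_trans: "f - g \<in> F_gt v \<gamma> \<Longrightarrow> g - h \<in> F_gt v \<gamma> \<Longrightarrow> f - h \<in> F_gt v \<gamma>"
  using F_gt_add[of "f - g" \<gamma> "g - h"] by simp

lemma F_ge_mult: "f \<in> F_ge v \<gamma> \<Longrightarrow> g \<in> F_ge v \<gamma>' \<Longrightarrow> f * g \<in> F_ge v (\<gamma> + \<gamma>')"
  by (auto simp: F_ge_iff v_mult intro: add_mono)

lemma F_gt_mult: "f \<in> F_ge v \<gamma> \<Longrightarrow> g \<in> F_gt v \<gamma>' \<Longrightarrow> f * g \<in> F_gt v (\<gamma> + \<gamma>')"
  by (auto simp: F_ge_iff F_gt_iff v_mult intro: add_le_less_mono)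

lemma F_scalar_mult: "f \<in> F_ge v \<gamma> \<Longrightarrow> \<iota> c * f \<in> F_ge v \<gamma>" "f \<in> F_gt v \<gamma> \<Longrightarrow> \<iota> c * f \<in> F_gt v \<gamma>"
  by (auto simp: F_ge_iff F_gt_iff v_scalar_mult)

lemma F_ge_scalar: "\<iota> c \<in> F_ge v 0"
  by (auto simp: F_ge_iff v_scalar)

text \<open>A perturbation of larger value is invisible: if \<open>g\<close> had larger value than
  \<open>f\<close>, then so would \<open>f = g - (g - f)\<close>.\<close>

lemma v_eqI:
  assumes "f \<noteq> 0" "g - f \<in> F_gt v (v f)"
  shows "g \<noteq> 0" "v g = v f"
proof -
  show g: "g \<noteq> 0"
    using assms by (auto simp: F_gt_iff)
  have "f + (g - f) \<in> F_ge v (v f)"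
    using F_gt_subset_F_ge[OF assms(2)] by (rule F_ge_add[rotated]) (simp add: F_ge_iff)
  then have "v f \<le> v g"
    using g by (simp add: F_ge_iff)
  moreover have False if "v f < v g"
  proof -
    have "g - (g - f) \<in> F_gt v (v f)"
      using assms(2) that by (intro F_gt_diff[OF _ assms(2)]) (auto simp: F_gt_iff)
    then show False
      using assms by (auto simp: F_gt_iff)
  qed
  ultimately show "v g = v f"
    by fastforce
qed

section \<open>The associated graded algebra\<close>

lemma carrier_filtration_ring: "carrier (filtration_ring v) = {x. \<forall>\<gamma>. Poly_Mapping.lookup x \<gamma> \<in> F_ge v \<gamma>}"
  by (simp add: filtration_ring_def)

lemma filtration_ring_simps [simp]:
  "\<one>\<^bsub>filtration_ring v\<^esub> = 1" "\<zero>\<^bsub>filtration_ring v\<^esub> = 0"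
  "x \<oplus>\<^bsub>filtration_ring v\<^esub> y = x + y" "x \<otimes>\<^bsub>filtration_ring v\<^esub> y = x * y"
  by (auto simp: filtration_ring_def)

lemma single_in_filtration_ring: "f \<in> F_ge v \<gamma> \<Longrightarrow> Poly_Mapping.single \<gamma> f \<in> carrier (filtration_ring v)"
  by (auto simp: carrier_filtration_ring lookup_single when_def)

text \<open>Both factors are sums of elements concentrated in one degree, where the claim reduces to
  additivity of values.\<close>

lemma filtration_mult:
  assumes "x \<in> carrier (filtration_ring v)"
  shows "y \<in> carrier (filtration_ring v) \<Longrightarrow> x * y \<in> carrier (filtration_ring v)"
    and "y \<in> filtration_ideal v \<Longrightarrow> x * y \<in> filtration_ideal v"
proof -
  assume y: "y \<in> carrier (filtration_ring v)"
  show "x * y \<in> carrier (filtration_ring v)"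
  proof (induction x rule: poly_mapping_single_induct)
    case x: (single k)
    show ?case
    proof (induction y rule: poly_mapping_single_induct)
      case (single l)
      show ?case
        using assms y single_in_filtration_ring F_ge_mult
        by (auto simp: mult_single carrier_filtration_ring)
    qed (auto simp: carrier_filtration_ring algebra_simps lookup_add F_ge_add)
  qed (auto simp: carrier_filtration_ring algebra_simps lookup_add F_ge_add)
next
  assume y: "y \<in> filtration_ideal v"
  show "x * y \<in> filtration_ideal v"
  proof (induction x rule: poly_mapping_single_induct)
    case x: (single k)
    show ?case
    proof (induction y rule: poly_mapping_single_induct)
      case (single l)
      show ?case
        using assms y F_gt_mult
        by (auto simp: mult_single carrier_filtration_ring filtration_ideal_def lookup_single when_def)
    qed (auto simp: filtration_ideal_def algebra_simps lookup_add F_gt_add)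
  qed (auto simp: filtration_ideal_def algebra_simps lookup_add F_gt_add)
qed

lemma cring_filtration_ring: "cring (filtration_ring v)"
  unfolding filtration_ring_def
proof (rule cring_class_ring_carrier)
  show "x * y \<in> {x. \<forall>\<gamma>. Poly_Mapping.lookup x \<gamma> \<in> F_ge v \<gamma>}"
    if "x \<in> {x. \<forall>\<gamma>. Poly_Mapping.lookup x \<gamma> \<in> F_ge v \<gamma>}"
      "y \<in> {x. \<forall>\<gamma>. Poly_Mapping.lookup x \<gamma> \<in> F_ge v \<gamma>}" for x y
    using that filtration_mult(1) unfolding carrier_filtration_ring by blast
qed (auto simp: lookup_one when_def F_ge_iff[of 1] lookup_add F_ge_add F_uminus)

sublocale FR: cring "filtration_ring v"
  by (rule cring_filtration_ring)

lemma a_inv_filtration_ring: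
  assumes "x \<in> carrier (filtration_ring v)"
  shows "\<ominus>\<^bsub>filtration_ring v\<^esub> x = - x"
  by (rule FR.minus_equality) (use assms in \<open>auto simp: carrier_filtration_ring F_uminus\<close>)

lemma filtration_ideal_closed: "x \<in> filtration_ideal v \<Longrightarrow> x \<in> carrier (filtration_ring v)"
  by (auto simp: filtration_ideal_def carrier_filtration_ring F_gt_subset_F_ge)

sublocale FI: ideal "filtration_ideal v" "filtration_ring v"
proof (rule idealI)
  show "ring (filtration_ring v)" by (rule FR.ring_axioms)
  show "subgroup (filtration_ideal v) (add_monoid (filtration_ring v))"
  proof (rule FR.add.subgroupI)
    show "filtration_ideal v \<noteq> {}"
      by (auto simp: filtration_ideal_def intro!: exI[of _ 0])
    show "\<ominus>\<^bsub>filtration_ring v\<^esub> x \<in> filtration_ideal v" if "x \<in> filtration_ideal v" for x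
      using that by (simp add: a_inv_filtration_ring filtration_ideal_closed)
        (simp add: filtration_ideal_def F_uminus)
  qed (use filtration_ideal_closed in \<open>auto simp: filtration_ideal_def lookup_add F_gt_add\<close>)
  fix a x
  assume "a \<in> filtration_ideal v" "x \<in> carrier (filtration_ring v)"
  then have "x * a \<in> filtration_ideal v"
    by (intro filtration_mult(2))
  then show "x \<otimes>\<^bsub>filtration_ring v\<^esub> a \<in> filtration_ideal v"
      "a \<otimes>\<^bsub>filtration_ring v\<^esub> x \<in> filtration_ideal v"
    by (simp_all add: mult.commute)
qed

sublocale gr: cring "gr v"
  unfolding gr_def by (rule FI.quotient_is_cring[OF cring_filtration_ring])

lemma gr_proj_hom: "(+>\<^bsub>filtration_ring v\<^esub>) (filtration_ideal v) \<in> ring_hom (filtration_ring v) (gr v)"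
  unfolding gr_def by (rule FI.rcos_ring_hom)

lemma gr_class_closed: "f \<in> F_ge v \<gamma> \<Longrightarrow> gr_class v \<gamma> f \<in> carrier (gr v)"
  unfolding gr_class_def by (intro ring_hom_closed[OF gr_proj_hom] single_in_filtration_ring)

lemma gr_class_self: "f \<in> F_ge v \<gamma> \<Longrightarrow> Poly_Mapping.single \<gamma> f \<in> gr_class v \<gamma> f"
  unfolding gr_class_def by (intro FI.a_rcos_self single_in_filtration_ring)

lemma gr_class_add:
  "f \<in> F_ge v \<gamma> \<Longrightarrow> g \<in> F_ge v \<gamma> \<Longrightarrow> gr_class v \<gamma> (f + g) = gr_class v \<gamma> f \<oplus>\<^bsub>gr v\<^esub> gr_class v \<gamma> g"
  unfolding gr_class_def
  by (subst ring_hom_add[OF gr_proj_hom, symmetric]) (auto simp: single_in_filtration_ring single_add)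

lemma gr_class_mult:
  "f \<in> F_ge v \<gamma> \<Longrightarrow> g \<in> F_ge v \<gamma>' \<Longrightarrow>
    gr_class v (\<gamma> + \<gamma>') (f * g) = gr_class v \<gamma> f \<otimes>\<^bsub>gr v\<^esub> gr_class v \<gamma>' g"
  unfolding gr_class_def
  by (subst ring_hom_mult[OF gr_proj_hom, symmetric]) (auto simp: single_in_filtration_ring mult_single)

lemma gr_class_one: "gr_class v 0 1 = \<one>\<^bsub>gr v\<^esub>"
  unfolding gr_class_def using ring_hom_one[OF gr_proj_hom] by simp

lemma gr_class_eqI:
  assumes "f \<in> F_ge v \<gamma>" "g \<in> F_ge v \<gamma>" "f - g \<in> F_gt v \<gamma>"
  shows "gr_class v \<gamma> f = gr_class v \<gamma> g"
proof -
  have "Poly_Mapping.single \<gamma> f \<ominus>\<^bsub>filtration_ring v\<^esub> Poly_Mapping.single \<gamma> g \<in> filtration_ideal v"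
    using assms
    by (simp add: a_minus_def a_inv_filtration_ring single_in_filtration_ring)
      (auto simp: filtration_ideal_def lookup_minus lookup_single when_def)
  then show ?thesis
    unfolding gr_class_def
    using FR.quotient_eq_iff_same_a_r_cos[OF FI.ideal_axioms] assms single_in_filtration_ring by simp
qed

lemma gr_coset:
  assumes "x \<in> carrier (gr v)"
  obtains p where "p \<in> carrier (filtration_ring v)" "p \<in> x"
    "x = filtration_ideal v +>\<^bsub>filtration_ring v\<^esub> p"
proof -
  obtain p where "p \<in> carrier (filtration_ring v)" "x = filtration_ideal v +>\<^bsub>filtration_ring v\<^esub> p"
    using assms by (auto simp: gr_def FactRing_def A_RCOSETS_def')
  then show thesis
    using that FI.a_rcos_self by blast
qed

text \<open>Choosing a representative makes the component an element of \<open>B\<close> that is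
  determined only modulo \<open>F_gt v \<gamma>\<close>. Its additivity and linearity are therefore
  stated as congruences.\<close>

definition gr_component :: "'g \<Rightarrow> ('g \<Rightarrow>\<^sub>0 'b) set \<Rightarrow> 'b" where
  "gr_component \<gamma> x = Poly_Mapping.lookup (SOME p. p \<in> x) \<gamma>"

lemma gr_component_diff:
  assumes "x \<in> carrier (gr v)" "p \<in> x"
  shows "gr_component \<gamma> x - Poly_Mapping.lookup p \<gamma> \<in> F_gt v \<gamma>"
proof -
  obtain r where r: "x = filtration_ideal v +>\<^bsub>filtration_ring v\<^esub> r"
    using gr_coset[OF assms(1)] by metis
  have "(SOME p. p \<in> x) \<in> x"
    using assms(2) by (rule someI)
  then obtain i j where "i \<in> filtration_ideal v" "j \<in> filtration_ideal v"
      "(SOME p. p \<in> x) = i + r" "p = j + r"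
    using assms r by (auto simp: a_r_coset_def')
  then show ?thesis
    by (auto simp: gr_component_def lookup_add filtration_ideal_def F_gt_diff)
qed

lemma gr_component_class:
  "f \<in> F_ge v \<gamma>' \<Longrightarrow> gr_component \<gamma> (gr_class v \<gamma>' f) - (f when \<gamma>' = \<gamma>) \<in> F_gt v \<gamma>"
  using gr_component_diff[OF gr_class_closed gr_class_self, of f \<gamma>' \<gamma>] by (simp add: lookup_single)

lemma gr_component_add:
  assumes "x \<in> carrier (gr v)" "y \<in> carrier (gr v)"
  shows "gr_component \<gamma> (x \<oplus>\<^bsub>gr v\<^esub> y) - gr_component \<gamma> x - gr_component \<gamma> y \<in> F_gt v \<gamma>"
proof -
  obtain p where p: "p \<in> carrier (filtration_ring v)" "p \<in> x"
      "x = filtration_ideal v +>\<^bsub>filtration_ring v\<^esub> p"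
    using gr_coset[OF assms(1)] by metis
  obtain q where q: "q \<in> carrier (filtration_ring v)" "q \<in> y"
      "y = filtration_ideal v +>\<^bsub>filtration_ring v\<^esub> q"
    using gr_coset[OF assms(2)] by metis
  have "x \<oplus>\<^bsub>gr v\<^esub> y = filtration_ideal v +>\<^bsub>filtration_ring v\<^esub> (p + q)"
    using ring_hom_add[OF gr_proj_hom p(1) q(1)] p q by simp
  then have "p + q \<in> x \<oplus>\<^bsub>gr v\<^esub> y"
    using FI.a_rcos_self[OF FR.a_closed[OF p(1) q(1)]] by simp
  then have "gr_component \<gamma> (x \<oplus>\<^bsub>gr v\<^esub> y) - Poly_Mapping.lookup (p + q) \<gamma> \<in> F_gt v \<gamma>"
    using assms by (intro gr_component_diff) auto
  then have "(gr_component \<gamma> (x \<oplus>\<^bsub>gr v\<^esub> y) - Poly_Mapping.lookup (p + q) \<gamma>)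
      - (gr_component \<gamma> x - Poly_Mapping.lookup p \<gamma>) - (gr_component \<gamma> y - Poly_Mapping.lookup q \<gamma>)
      \<in> F_gt v \<gamma>"
    by (rule F_gt_diff[OF F_gt_diff[OF _ gr_component_diff[OF assms(1) p(2)]]
          gr_component_diff[OF assms(2) q(2)]])
  then show ?thesis
    by (simp add: lookup_add algebra_simps)
qed

lemma gr_scalar_closed: "gr_scalar \<iota> v c \<in> carrier (gr v)"
  unfolding gr_scalar_def by (intro gr_class_closed F_ge_scalar)

lemma gr_component_scalar:
  assumes "x \<in> carrier (gr v)"
  shows "gr_component \<gamma> (gr_scalar \<iota> v c \<otimes>\<^bsub>gr v\<^esub> x) - \<iota> c * gr_component \<gamma> x \<in> F_gt v \<gamma>"
proof -
  obtain p where p: "p \<in> carrier (filtration_ring v)" "p \<in> x"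
      "x = filtration_ideal v +>\<^bsub>filtration_ring v\<^esub> p"
    using gr_coset[OF assms] by metis
  let ?c = "Poly_Mapping.single 0 (\<iota> c) :: 'g \<Rightarrow>\<^sub>0 'b"
  have c: "?c \<in> carrier (filtration_ring v)"
    by (intro single_in_filtration_ring F_ge_scalar)
  have "gr_scalar \<iota> v c \<otimes>\<^bsub>gr v\<^esub> x = filtration_ideal v +>\<^bsub>filtration_ring v\<^esub> (?c * p)"
    using ring_hom_mult[OF gr_proj_hom c p(1)] p by (simp add: gr_scalar_def gr_class_def)
  then have "?c * p \<in> gr_scalar \<iota> v c \<otimes>\<^bsub>gr v\<^esub> x"
    using FI.a_rcos_self[OF FR.m_closed[OF c p(1)]] by simp
  then have "gr_component \<gamma> (gr_scalar \<iota> v c \<otimes>\<^bsub>gr v\<^esub> x) - Poly_Mapping.lookup (?c * p) \<gamma> \<in> F_gt v \<gamma>"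
    using assms gr_scalar_closed by (intro gr_component_diff) auto
  moreover have "Poly_Mapping.lookup (?c * p) \<gamma> - \<iota> c * gr_component \<gamma> x \<in> F_gt v \<gamma>"
    using F_scalar_mult(2)[OF gr_component_diff[OF assms p(2)], of c]
    by (simp add: lookup_single_zero_mult right_diff_distrib F_gt_diff_commute)
  ultimately show ?thesis
    by (rule F_gt_diff_trans)
qed

section \<open>The tensor product with the group ring\<close>

sublocale AP: algebra_pair "gr v" "group_ring :: ('d \<Rightarrow>\<^sub>0 'k) ring" "gr_scalar \<iota> v" group_ring_scalar
  by (intro algebra_pair.intro algebra_pair_axioms.intro gr.cring_axioms gr_scalar_closed)
    (auto simp: group_ring_def cring_class_ring)

abbreviation "T \<equiv> gr_tensor \<iota> v :: ('k, 'b, 'g, 'd) grD ring"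
abbreviation "scal \<equiv> gr_tensor_scalar \<iota> v :: 'k \<Rightarrow> ('k, 'b, 'g, 'd) grD"

sublocale T: cring T
  unfolding gr_tensor_def by (rule AP.T.cring_axioms)

text \<open>Fixing the bidegree makes the class additive in \<open>f\<close> and zero on elements of
  larger value, unlike \<open>in_vD\<close>, whose bidegree moves with its argument.\<close>

definition bihom :: "'g \<Rightarrow> 'd \<Rightarrow> 'b \<Rightarrow> ('k, 'b, 'g, 'd) grD" where
  "bihom \<gamma> \<delta> f = tensor (gr v) (gr_scalar \<iota> v) group_ring group_ring_scalar
    (gr_class v \<gamma> f) (Poly_Mapping.single \<delta> 1)"

lemma group_ring_simps [simp]:
  "carrier (group_ring :: ('d \<Rightarrow>\<^sub>0 'k) ring) = UNIV" "\<one>\<^bsub>group_ring :: ('d \<Rightarrow>\<^sub>0 'k) ring\<^esub> = 1"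
  "(x :: 'd \<Rightarrow>\<^sub>0 'k) \<otimes>\<^bsub>group_ring\<^esub> y = x * y" "(x :: 'd \<Rightarrow>\<^sub>0 'k) \<oplus>\<^bsub>group_ring\<^esub> y = x + y"
  by (auto simp: group_ring_def)

lemma bihom_closed: "f \<in> F_ge v \<gamma> \<Longrightarrow> bihom \<gamma> \<delta> f \<in> carrier T"
  unfolding bihom_def gr_tensor_def by (intro AP.tens_closed gr_class_closed) auto

lemma bihom_add:
  "f \<in> F_ge v \<gamma> \<Longrightarrow> g \<in> F_ge v \<gamma> \<Longrightarrow> bihom \<gamma> \<delta> (f + g) = bihom \<gamma> \<delta> f \<oplus>\<^bsub>T\<^esub> bihom \<gamma> \<delta> g"
  unfolding bihom_def gr_tensor_def by (simp add: gr_class_add AP.tens_add_left gr_class_closed)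

lemma bihom_mult:
  "f \<in> F_ge v \<gamma> \<Longrightarrow> g \<in> F_ge v \<gamma>' \<Longrightarrow>
    bihom (\<gamma> + \<gamma>') (\<delta> + \<delta>') (f * g) = bihom \<gamma> \<delta> f \<otimes>\<^bsub>T\<^esub> bihom \<gamma>' \<delta>' g"
  unfolding bihom_def gr_tensor_def by (simp add: gr_class_mult AP.tens_mult gr_class_closed mult_single)

lemma bihom_one: "bihom 0 0 1 = \<one>\<^bsub>T\<^esub>"
  unfolding bihom_def gr_tensor_def by (simp add: AP.tens_one gr_class_one)

lemma bihom_eqI:
  "f \<in> F_ge v \<gamma> \<Longrightarrow> g \<in> F_ge v \<gamma> \<Longrightarrow> f - g \<in> F_gt v \<gamma> \<Longrightarrow> bihom \<gamma> \<delta> f = bihom \<gamma> \<delta> g"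
  unfolding bihom_def using gr_class_eqI[of f \<gamma> g] by simp

lemma bihom_eq_zero:
  assumes "f \<in> F_gt v \<gamma>"
  shows "bihom \<gamma> \<delta> f = \<zero>\<^bsub>T\<^esub>"
proof -
  have "bihom \<gamma> \<delta> 0 \<oplus>\<^bsub>T\<^esub> bihom \<gamma> \<delta> 0 = bihom \<gamma> \<delta> 0"
    using bihom_add[of 0 \<gamma> 0] by simp
  then have "bihom \<gamma> \<delta> 0 = \<zero>\<^bsub>T\<^esub>"
    using bihom_closed[of 0 \<gamma> \<delta>] by (simp add: T.add.l_cancel_one)
  moreover have "bihom \<gamma> \<delta> f = bihom \<gamma> \<delta> 0"
    using assms by (intro bihom_eqI) (auto simp: F_gt_subset_F_ge)
  ultimately show ?thesis by simp
qed

lemma scalar_bihom: "scal c = bihom 0 0 (\<iota> c)"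
  unfolding gr_tensor_scalar_def bihom_def gr_scalar_def by simp

lemma scalar_ring_hom: "scal \<in> ring_hom class_ring T"
  using bihom_mult[OF F_ge_scalar F_ge_scalar, of 0 0]
  by (intro ring_hom_memI) (auto simp: scalar_bihom bihom_closed bihom_add F_ge_scalar bihom_one)

lemma scalar_mult_bihom:
  "f \<in> F_ge v \<gamma> \<Longrightarrow> scal c \<otimes>\<^bsub>T\<^esub> bihom \<gamma> \<delta> f = bihom \<gamma> \<delta> (\<iota> c * f)"
  using bihom_mult[OF F_ge_scalar[of c], of f \<gamma> 0 \<delta>] by (simp add: scalar_bihom)

lemma in_vD_bihom: "in_vD \<iota> v grad f = bihom (v f) (deg grad f) f"
  by (simp add: in_vD_def bihom_def in_v_def)

text \<open>\<open>t\<close> has the class of \<open>b\<close> as its component of degree \<open>(\<gamma>, \<delta>)\<close>.\<close>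

definition has_component :: "('k, 'b, 'g, 'd) grD \<Rightarrow> 'g \<Rightarrow> 'd \<Rightarrow> 'b \<Rightarrow> bool" where
  "has_component t \<gamma> \<delta> b \<longleftrightarrow> (\<exists>p\<in>t. linear_extension
    (\<lambda>(m, q). \<iota> (Poly_Mapping.lookup q \<delta>) * gr_component \<gamma> m) p - b \<in> F_gt v \<gamma>)"

text \<open>The functional \<open>?f\<close> is bilinear modulo \<open>F_gt v \<gamma>\<close>,
  hence sends the ideal of tensor relations there, and two representatives of a tensor differ by an
  element of that ideal. This is the way back from equations between tensors to congruences in
  \<open>B\<close>.\<close>

lemma has_component_unique:
  assumes "t \<in> carrier T" "has_component t \<gamma> \<delta> b" "has_component t \<gamma> \<delta> b'"
  shows "b - b' \<in> F_gt v \<gamma>"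
proof -
  let ?f = "\<lambda>(m, q). \<iota> (Poly_Mapping.lookup (q :: 'd \<Rightarrow>\<^sub>0 'k) \<delta>) * gr_component \<gamma> m"
  obtain p p' where p: "p \<in> t" "p' \<in> t" "linear_extension ?f p - b \<in> F_gt v \<gamma>"
      "linear_extension ?f p' - b' \<in> F_gt v \<gamma>"
    using assms unfolding has_component_def by blast
  have "linear_extension ?f (p - p') \<in> F_gt v \<gamma>"
  proof (rule AP.linear_extension_tensor_ideal)
    show "p - p' \<in> tensor_ideal (gr v) (gr_scalar \<iota> v) group_ring group_ring_scalar"
      using AP.proj_diff(1) assms(1) p(1,2) unfolding gr_tensor_def by blast
    fix m m' and n n' :: "'d \<Rightarrow>\<^sub>0 'k" and c
    assume m: "m \<in> carrier (gr v)"
    show "?f (gr_scalar \<iota> v c \<otimes>\<^bsub>gr v\<^esub> m, n) - ?f (m, group_ring_scalar c \<otimes>\<^bsub>group_ring\<^esub> n) \<in> F_gt v \<gamma>"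
    proof -
      have "?f (gr_scalar \<iota> v c \<otimes>\<^bsub>gr v\<^esub> m, n) - ?f (m, group_ring_scalar c \<otimes>\<^bsub>group_ring\<^esub> n) =
        \<iota> (Poly_Mapping.lookup n \<delta>) * (gr_component \<gamma> (gr_scalar \<iota> v c \<otimes>\<^bsub>gr v\<^esub> m) - \<iota> c * gr_component \<gamma> m)"
        by (simp add: group_ring_scalar_def lookup_single_zero_mult) (simp add: algebra_simps)
      then show ?thesis
        using F_scalar_mult(2)[OF gr_component_scalar[OF m, of \<gamma> c]] by simp
    qed
    show "?f (m, n \<oplus>\<^bsub>group_ring\<^esub> n') - ?f (m, n) - ?f (m, n') \<in> F_gt v \<gamma>"
      by (simp add: lookup_add algebra_simps)
    assume m': "m' \<in> carrier (gr v)"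
    show "?f (m \<oplus>\<^bsub>gr v\<^esub> m', n) - ?f (m, n) - ?f (m', n) \<in> F_gt v \<gamma>"
      using F_scalar_mult(2)[OF gr_component_add[OF m m', of \<gamma>], of "Poly_Mapping.lookup n \<delta>"]
      by (simp add: algebra_simps)
  qed (auto simp: F_gt_add F_uminus)
  \<comment> \<open>Once the last summand is expanded, the values of the functional cancel and
    \<open>b - b'\<close> remains.\<close>
  then have "(linear_extension ?f p' - b') - (linear_extension ?f p - b)
      + linear_extension ?f (p - p') \<in> F_gt v \<gamma>"
    using p(3,4) F_gt_add F_gt_diff by blast
  then show ?thesis
    by (simp add: linear_extension_diff)
qed

lemma has_component_add:
  assumes "t \<in> carrier T" "t' \<in> carrier T" "has_component t \<gamma> \<delta> b" "has_component t' \<gamma> \<delta> b'"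
  shows "has_component (t \<oplus>\<^bsub>T\<^esub> t') \<gamma> \<delta> (b + b')"
proof -
  let ?f = "\<lambda>(m, q). \<iota> (Poly_Mapping.lookup (q :: 'd \<Rightarrow>\<^sub>0 'k) \<delta>) * gr_component \<gamma> m"
  obtain p p' where p: "p \<in> t" "p' \<in> t'" "linear_extension ?f p - b \<in> F_gt v \<gamma>"
      "linear_extension ?f p' - b' \<in> F_gt v \<gamma>"
    using assms unfolding has_component_def by blast
  have "p + p' \<in> t \<oplus>\<^bsub>T\<^esub> t'"
    using p unfolding gr_tensor_def tensor_algebra_def FactRing_def
    by (auto simp: set_add_def' )
  moreover have "linear_extension ?f (p + p') - (b + b') \<in> F_gt v \<gamma>"
    using F_gt_add[OF p(3,4)] by (simp add: linear_extension_add algebra_simps)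
  ultimately show ?thesis
    unfolding has_component_def by blast
qed

lemma has_component_bihom:
  assumes "f \<in> F_ge v \<gamma>'"
  shows "has_component (bihom \<gamma>' \<delta>' f) \<gamma> \<delta> (f when \<gamma>' = \<gamma> \<and> \<delta>' = \<delta>)"
proof -
  let ?f = "\<lambda>(m, q). \<iota> (Poly_Mapping.lookup (q :: 'd \<Rightarrow>\<^sub>0 'k) \<delta>) * gr_component \<gamma> m"
  have "linear_extension ?f (pair_gen (gr_class v \<gamma>' f) (Poly_Mapping.single \<delta>' 1))
      - (f when \<gamma>' = \<gamma> \<and> \<delta>' = \<delta>) \<in> F_gt v \<gamma>"
    using gr_component_class[OF assms, of \<gamma>]
    by (auto simp: linear_extension_single lookup_single when_def)
  moreover have "pair_gen (gr_class v \<gamma>' f) (Poly_Mapping.single \<delta>' 1) \<in> bihom \<gamma>' \<delta>' f"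
    unfolding bihom_def by (intro AP.tens_self gr_class_closed assms) auto
  ultimately show ?thesis
    unfolding has_component_def by blast
qed

lemma has_component_zero: "has_component \<zero>\<^bsub>T\<^esub> \<gamma> \<delta> 0"
  using has_component_bihom[of 0 \<gamma> \<delta> \<gamma> \<delta>] bihom_eq_zero[of 0 \<gamma> \<delta>] by simp

section \<open>Homogeneous elements and initial forms\<close>

lemma A_closed: "0 \<in> A" "1 \<in> A" "x \<in> A \<Longrightarrow> y \<in> A \<Longrightarrow> x + y \<in> A" "x \<in> A \<Longrightarrow> y \<in> A \<Longrightarrow> x * y \<in> A"
  using subringE[OF A_subring] by auto

lemma grad_uminus: "x \<in> grad \<delta> \<Longrightarrow> - x \<in> grad \<delta>"
  using grad_scale[of x \<delta> "- 1"] by simp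

lemma grad_diff: "x \<in> grad \<delta> \<Longrightarrow> y \<in> grad \<delta> \<Longrightarrow> x - y \<in> grad \<delta>"
  using grad_add[OF _ grad_uminus, of x \<delta> y] by simp

text \<open>The uniqueness assumption of the locale concerns finitely supported families;
  \<open>pm\<close> turns a family on \<open>D\<close> into one by extending it by zero.\<close>

lemma grad_sum_unique:
  assumes "finite D" "\<And>\<delta>. \<delta> \<in> D \<Longrightarrow> a \<delta> \<in> grad \<delta>" "\<And>\<delta>. \<delta> \<in> D \<Longrightarrow> b \<delta> \<in> grad \<delta>"
    and "sum a D = sum b D" "\<delta> \<in> D"
  shows "a \<delta> = b \<delta>"
proof -
  define pm where "pm c = (\<Sum>\<delta>\<in>D. Poly_Mapping.single \<delta> (c \<delta>))" for c :: "'d \<Rightarrow> 'b"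
  have pm: "Poly_Mapping.lookup (pm c) \<epsilon> = (if \<epsilon> \<in> D then c \<epsilon> else 0)" for c \<epsilon>
    using assms(1) by (simp add: pm_def lookup_sum lookup_single when_def)
  have sum_pm: "(\<Sum>\<delta>\<in>Poly_Mapping.keys (pm c). Poly_Mapping.lookup (pm c) \<delta>) = sum c D" for c
    using assms(1) by (intro sum.mono_neutral_cong_left) (auto simp: pm in_keys_iff split: if_splits)
  have "a \<epsilon> \<in> A" if "\<epsilon> \<in> D" for \<epsilon>
    using assms(2)[OF that] grad_subset by blast
  note a_A = this
  have "finite S \<Longrightarrow> S \<subseteq> D \<Longrightarrow> sum a S \<in> A" for S
    by (induction S rule: finite_induct) (auto intro: A_closed a_A)
  then have "sum a D \<in> A"
    using assms(1) by blast
  then have "pm a = pm b"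
    using grad_direct_sum[of "sum a D"] assms(2-4) sum_pm pm grad_zero by (metis (no_types, lifting))
  then show ?thesis
    using pm[of a \<delta>] pm[of b \<delta>] assms(5) by simp
qed

text \<open>The family \<open>a\<close> is compared with the one that has the whole sum in degree
  \<delta>. Inserting \<delta> into the index set covers the case that it is missing from
  \<open>D\<close>, where the sum must vanish.\<close>

lemma grad_sum_component:
  assumes "finite D" "\<And>\<delta>. \<delta> \<in> D \<Longrightarrow> a \<delta> \<in> grad \<delta>" "sum a D \<in> grad \<delta>"
  shows "sum a D = (if \<delta> \<in> D then a \<delta> else 0)"
proof -
  have "(if \<delta> \<in> D then a \<delta> else 0) = (if \<delta> = \<delta> then sum a D else 0)"
  proof (rule grad_sum_unique[where D = "insert \<delta> D" and a = "\<lambda>\<epsilon>. if \<epsilon> \<in> D then a \<epsilon> else 0"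
        and b = "\<lambda>\<epsilon>. if \<epsilon> = \<delta> then sum a D else 0"])
    show "(\<Sum>\<epsilon>\<in>insert \<delta> D. if \<epsilon> \<in> D then a \<epsilon> else 0) = (\<Sum>\<epsilon>\<in>insert \<delta> D. if \<epsilon> = \<delta> then sum a D else 0)"
      using assms(1) by (simp add: sum.insert_if sum.delta)
  qed (use assms grad_zero in auto)
  then show ?thesis by simp
qed

lemma grad_unique:
  assumes "f \<noteq> 0" "f \<in> grad \<delta>" "f \<in> grad \<epsilon>"
  shows "\<delta> = \<epsilon>"
  using grad_sum_component[of "{\<delta>}" "\<lambda>_. f" \<epsilon>] assms by (auto split: if_splits)

lemma deg_eq: "f \<noteq> 0 \<Longrightarrow> f \<in> grad \<delta> \<Longrightarrow> deg grad f = \<delta>"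
  unfolding deg_def using grad_unique by blast

lemma in_grad_deg: "f \<in> homogeneous grad \<Longrightarrow> f \<noteq> 0 \<Longrightarrow> f \<in> grad (deg grad f)"
  using deg_eq by (auto simp: homogeneous_def)

lemma grad_homogeneous: "f \<in> grad \<delta> \<Longrightarrow> f \<in> homogeneous grad"
  by (auto simp: homogeneous_def)

lemma homogeneous_subset: "homogeneous grad \<subseteq> A"
  using grad_subset by (auto simp: homogeneous_def)

text \<open>Multiply the decomposition of 1 by one of its non-zero components \<open>?x\<close>, of
  degree \<epsilon>. Comparing parts of degree \<epsilon> shows that \<open>?x\<close> equals
  \<open>?x\<close> times the component of 1 in degree 0, and cancelling in the domain
  \<open>B\<close> makes that component 1.\<close>

lemma one_in_grad: "1 \<in> grad 0"
proof -
  obtain c :: "'d \<Rightarrow>\<^sub>0 'b" where c: "\<And>\<delta>. Poly_Mapping.lookup c \<delta> \<in> grad \<delta>"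
      "1 = (\<Sum>\<delta>\<in>Poly_Mapping.keys c. Poly_Mapping.lookup c \<delta>)"
    using grad_direct_sum[OF A_closed(2)] by blast
  obtain \<epsilon> where \<epsilon>: "\<epsilon> \<in> Poly_Mapping.keys c"
    using c(2) by (metis sum.neutral zero_neq_one all_not_in_conv)
  let ?x = "Poly_Mapping.lookup c \<epsilon>" and ?D = "(+) \<epsilon> ` Poly_Mapping.keys c"
  let ?a = "\<lambda>\<eta>. ?x * Poly_Mapping.lookup c (\<eta> - \<epsilon>)"
  have "sum ?a ?D = ?x"
    using c(2) by (subst sum.reindex) (auto simp: sum_distrib_left[symmetric])
  moreover have "?a \<eta> \<in> grad \<eta>" for \<eta>
    using grad_mult[OF c(1)[of \<epsilon>] c(1)[of "\<eta> - \<epsilon>"]] by simp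
  ultimately have "?x = (if \<epsilon> \<in> ?D then ?a \<epsilon> else 0)"
    using grad_sum_component[of ?D ?a \<epsilon>] c(1)[of \<epsilon>] by simp
  then have "Poly_Mapping.lookup c 0 = 1"
    using \<epsilon> by (auto simp: in_keys_iff split: if_splits)
  then show ?thesis
    using c(1)[of 0] by simp
qed

lemma grad_power: "f \<in> grad \<delta> \<Longrightarrow> f ^ n \<in> grad (\<Sum>_<n. \<delta>)"
  by (induction n) (auto simp: one_in_grad grad_mult add.commute[of _ \<delta>])

lemma scalar_in_grad: "\<iota> c \<in> grad 0"
  using grad_scale[OF one_in_grad, of c] by simp

section \<open>Initial forms of monomials and polynomials\<close>

abbreviation "hom0 \<equiv> homogeneous grad - {0}"
abbreviation "wt \<equiv> monomial_degree v"
abbreviation "dg \<equiv> monomial_degree (deg grad)"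

sublocale B: poly_evaluation class_ring \<iota> "\<lambda>g. g" UNIV
  by (intro poly_evaluation.intro poly_evaluation_axioms.intro cring_class_ring B_algebra) auto

lemma in_vD_closed: "in_vD \<iota> v grad f \<in> carrier T"
  by (simp add: in_vD_bihom bihom_closed F_ge_iff)

lemma poly_evaluation_in: "poly_evaluation T scal (in_vD \<iota> v grad) X"
  by (intro poly_evaluation.intro poly_evaluation_axioms.intro T.cring_axioms scalar_ring_hom)
    (auto simp: in_vD_closed)

sublocale E: poly_evaluation T scal "in_vD \<iota> v grad" UNIV
  by (rule poly_evaluation_in)

lemma B_mon: "B.mon m = (\<Prod>x\<in>Poly_Mapping.keys m. x ^ Poly_Mapping.lookup m x)"
  by (simp add: B.mon_def finprod_class_ring)

lemma subst_simps [simp]: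
  "subst \<iota> 0 = 0" "subst \<iota> (p + q) = subst \<iota> p + subst \<iota> q" "subst \<iota> (p * q) = subst \<iota> p * subst \<iota> q"
  "subst \<iota> (Poly_Mapping.single m c) = \<iota> c * B.mon m"
  using B.poly_eval_zero B.poly_eval_add[of p q] B.poly_eval_mult[of p q] B.poly_eval_single[of m c]
  by simp_all

lemma subst_uminus [simp]: "subst \<iota> (- p) = - subst \<iota> p"
  using subst_simps(2)[of "- p" p] by (simp add: eq_neg_iff_add_eq_0)

lemma subst_diff [simp]: "subst \<iota> (p - q) = subst \<iota> p - subst \<iota> q"
  using subst_simps(2)[of p "- q"] by simp

lemma mon_single [simp]: "B.mon (Poly_Mapping.single x n) = x ^ n"
  by (simp add: B_mon)

text \<open>Products of non-zero elements do not vanish in a domain, so value, degree and initial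
  form are all multiplicative. The facts share one induction because they lean on each other:
  nonvanishing gives the value, and the value gives the bidegree of the initial form.\<close>

lemma mon_hom0:
  assumes "Poly_Mapping.keys m \<subseteq> hom0"
  shows "B.mon m \<noteq> 0" "v (B.mon m) = wt m" "B.mon m \<in> grad (dg m)"
    "E.mon m = bihom (wt m) (dg m) (B.mon m)"
proof -
  let ?n = "Poly_Mapping.lookup m"
  have pow: "in_vD \<iota> v grad x [^]\<^bsub>T\<^esub> k = bihom (\<Sum>_<k. v x) (\<Sum>_<k. deg grad x) (x ^ k)"
    if "x \<noteq> 0" for x and k :: nat
  proof (induction k)
    case 0
    show ?case by (simp add: bihom_one)
  next
    case (Suc k)
    then show ?case
      using bihom_mult[of "x ^ k" "\<Sum>_<k. v x" x "v x" "\<Sum>_<k. deg grad x" "deg grad x"] that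
      by (simp add: in_vD_bihom F_ge_iff v_power mult.commute)
  qed
  have "finite X \<Longrightarrow> X \<subseteq> hom0 \<Longrightarrow> (\<Prod>x\<in>X. x ^ ?n x) \<noteq> 0 \<and>
      v (\<Prod>x\<in>X. x ^ ?n x) = (\<Sum>x\<in>X. \<Sum>_<?n x. v x) \<and>
      (\<Prod>x\<in>X. x ^ ?n x) \<in> grad (\<Sum>x\<in>X. \<Sum>_<?n x. deg grad x) \<and>
      (\<Otimes>\<^bsub>T\<^esub>x\<in>X. in_vD \<iota> v grad x [^]\<^bsub>T\<^esub> ?n x) =
        bihom (\<Sum>x\<in>X. \<Sum>_<?n x. v x) (\<Sum>x\<in>X. \<Sum>_<?n x. deg grad x) (\<Prod>x\<in>X. x ^ ?n x)" for X
  proof (induction X rule: finite_induct)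
    case empty
    show ?case by (simp add: bihom_one one_in_grad)
  next
    case (insert y X)
    let ?p = "\<Prod>x\<in>X. x ^ ?n x"
    have IH: "?p \<noteq> 0" "v ?p = (\<Sum>x\<in>X. \<Sum>_<?n x. v x)" "?p \<in> grad (\<Sum>x\<in>X. \<Sum>_<?n x. deg grad x)"
      "(\<Otimes>\<^bsub>T\<^esub>x\<in>X. in_vD \<iota> v grad x [^]\<^bsub>T\<^esub> ?n x) =
        bihom (\<Sum>x\<in>X. \<Sum>_<?n x. v x) (\<Sum>x\<in>X. \<Sum>_<?n x. deg grad x) ?p"
      using insert by auto
    have y: "y \<noteq> 0" "y \<in> grad (deg grad y)"
      using insert in_grad_deg by auto
    have "bihom ((\<Sum>_<?n y. v y) + (\<Sum>x\<in>X. \<Sum>_<?n x. v x))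
        ((\<Sum>_<?n y. deg grad y) + (\<Sum>x\<in>X. \<Sum>_<?n x. deg grad x)) (y ^ ?n y * ?p) =
      bihom (\<Sum>_<?n y. v y) (\<Sum>_<?n y. deg grad y) (y ^ ?n y) \<otimes>\<^bsub>T\<^esub>
        bihom (\<Sum>x\<in>X. \<Sum>_<?n x. v x) (\<Sum>x\<in>X. \<Sum>_<?n x. deg grad x) ?p"
      using y IH by (intro bihom_mult) (auto simp: F_ge_iff v_power)
    moreover have "(\<Otimes>\<^bsub>T\<^esub>x\<in>insert y X. in_vD \<iota> v grad x [^]\<^bsub>T\<^esub> ?n x) =
        in_vD \<iota> v grad y [^]\<^bsub>T\<^esub> ?n y \<otimes>\<^bsub>T\<^esub> (\<Otimes>\<^bsub>T\<^esub>x\<in>X. in_vD \<iota> v grad x [^]\<^bsub>T\<^esub> ?n x)"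
      using insert by (intro T.finprod_insert) (auto simp: in_vD_closed)
    ultimately show ?case
      using insert(1,2) IH y pow[OF y(1)] grad_mult[OF grad_power[OF y(2)] IH(3)]
      by (simp add: v_mult v_power)
  qed
  from this[OF finite_keys assms]
  show "B.mon m \<noteq> 0" "v (B.mon m) = wt m" "B.mon m \<in> grad (dg m)"
    "E.mon m = bihom (wt m) (dg m) (B.mon m)"
    unfolding B_mon E.mon_def monomial_degree_def by simp_all
qed

text \<open>Read off from the product of the two monomials in \<open>B\<close>, whose value and
  degree are unique, instead of from the double sums.\<close>

lemma monomial_degree_add:
  assumes "Poly_Mapping.keys m \<subseteq> hom0" "Poly_Mapping.keys n \<subseteq> hom0"
  shows "wt (m + n) = wt m + wt n" "dg (m + n) = dg m + dg n"
proof -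
  have mn: "Poly_Mapping.keys (m + n) \<subseteq> hom0"
    using assms keys_add[of m n] by blast
  have mon: "B.mon (m + n) = B.mon m * B.mon n"
    using B.mon_add[of m n] by simp
  show "wt (m + n) = wt m + wt n"
    using mon_hom0[OF assms(1)] mon_hom0[OF assms(2)] mon_hom0(2)[OF mn] mon by (simp add: v_mult)
  show "dg (m + n) = dg m + dg n"
    using grad_unique[OF mon_hom0(1,3)[OF mn]] grad_mult mon_hom0(3) assms mon by metis
qed

lemma term_hom0:
  assumes "Poly_Mapping.keys m \<subseteq> hom0"
  shows "\<iota> c * B.mon m \<in> F_ge v (wt m)" "\<iota> c * B.mon m \<in> grad (dg m)"
    "c \<noteq> 0 \<Longrightarrow> v (\<iota> c * B.mon m) = wt m" "c \<noteq> 0 \<Longrightarrow> deg grad (\<iota> c * B.mon m) = dg m"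
    "subst_in \<iota> v grad (Poly_Mapping.single m c) = bihom (wt m) (dg m) (\<iota> c * B.mon m)"
proof -
  note m = mon_hom0[OF assms]
  have ge: "B.mon m \<in> F_ge v (wt m)"
    using m by (simp add: F_ge_iff)
  then show "\<iota> c * B.mon m \<in> F_ge v (wt m)"
    by (rule F_scalar_mult)
  show gr: "\<iota> c * B.mon m \<in> grad (dg m)"
    using m by (intro grad_scale)
  show "c \<noteq> 0 \<Longrightarrow> v (\<iota> c * B.mon m) = wt m"
    using m by (simp add: v_scalar_mult)
  show "c \<noteq> 0 \<Longrightarrow> deg grad (\<iota> c * B.mon m) = dg m"
    using m gr by (simp add: deg_eq)
  show "subst_in \<iota> v grad (Poly_Mapping.single m c) = bihom (wt m) (dg m) (\<iota> c * B.mon m)"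
    using m ge by (simp add: E.poly_eval_single scalar_mult_bihom)
qed

lemma polys_in_keys: "p \<in> polys_in X \<Longrightarrow> m \<in> Poly_Mapping.keys p \<Longrightarrow> Poly_Mapping.keys m \<subseteq> X"
  by (simp add: polys_in_def)

lemma subst_in_F_ge:
  assumes "p \<in> polys_in hom0" "\<And>m. m \<in> Poly_Mapping.keys p \<Longrightarrow> \<gamma> \<le> wt m"
  shows "subst \<iota> p \<in> F_ge v \<gamma>"
proof (induction p rule: poly_mapping_single_induct)
  case (single m)
  then show ?case
    using term_hom0(1)[OF polys_in_keys[OF assms(1) single], of "Poly_Mapping.lookup p m"] assms(2)[OF single]
    by (auto simp: F_ge_iff)
qed (auto simp: F_ge_add)

lemma subst_in_F_gt:
  assumes "p \<in> polys_in hom0" "\<And>m. m \<in> Poly_Mapping.keys p \<Longrightarrow> \<gamma> < wt m"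
  shows "subst \<iota> p \<in> F_gt v \<gamma>"
proof (induction p rule: poly_mapping_single_induct)
  case (single m)
  then show ?case
    using term_hom0(1)[OF polys_in_keys[OF assms(1) single], of "Poly_Mapping.lookup p m"] assms(2)[OF single]
    by (auto simp: F_ge_iff F_gt_iff)
qed (auto simp: F_gt_add)

lemma subst_in_grad:
  assumes "p \<in> polys_in hom0" "\<And>m. m \<in> Poly_Mapping.keys p \<Longrightarrow> dg m = \<delta>"
  shows "subst \<iota> p \<in> grad \<delta>"
proof (induction p rule: poly_mapping_single_induct)
  case (single m)
  then show ?case
    using term_hom0(2)[OF polys_in_keys[OF assms(1) single], of "Poly_Mapping.lookup p m"] assms(2)[OF single]
    by auto
qed (auto simp: grad_add grad_zero)

lemma subst_in_bihomogeneous: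
  assumes "p \<in> polys_in hom0" "\<And>m. m \<in> Poly_Mapping.keys p \<Longrightarrow> wt m = \<gamma> \<and> dg m = \<delta>"
  shows "subst_in \<iota> v grad p = bihom \<gamma> \<delta> (subst \<iota> p)"
proof -
  have "subst \<iota> p \<in> F_ge v \<gamma> \<and> subst_in \<iota> v grad p = bihom \<gamma> \<delta> (subst \<iota> p)"
  proof (induction p rule: poly_mapping_single_induct)
    case zero
    show ?case by (simp add: E.poly_eval_zero bihom_eq_zero)
  next
    case (single m)
    then show ?case
      using term_hom0(1,5)[OF polys_in_keys[OF assms(1) single], of "Poly_Mapping.lookup p m"] assms(2)[OF single]
      by auto
  next
    case (add q r)
    then show ?case by (simp add: E.poly_eval_add bihom_add F_ge_add)
  qed
  then show ?thesis ..
qed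

text \<open>Components are additive and a term contributes only in its own bidegree. The general
  form fits the polynomials chosen in subduction, which may contain terms of larger value besides
  the leading ones.\<close>

lemma has_component_subst_in:
  assumes "p \<in> polys_in hom0"
  shows "has_component (subst_in \<iota> v grad p) \<gamma> \<delta> (subst \<iota> (restrict_keys (\<lambda>m. wt m = \<gamma> \<and> dg m = \<delta>) p))"
proof (induction p rule: poly_mapping_single_induct)
  case zero
  show ?case by (simp add: E.poly_eval_zero has_component_zero)
next
  case (single m)
  then show ?case
    using term_hom0(1,5)[OF polys_in_keys[OF assms(1) single], of "Poly_Mapping.lookup p m"]
      has_component_bihom[OF term_hom0(1)[OF polys_in_keys[OF assms(1) single], of "Poly_Mapping.lookup p m"], of "dg m" \<gamma> \<delta>]
    by (auto simp: restrict_keys_single when_def split: if_splits)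
next
  case (add q r)
  then show ?case
    by (simp add: E.poly_eval_add restrict_keys_add has_component_add E.poly_eval_closed)
qed

lemma has_component_in:
  assumes "f \<in> grad \<delta>" "f \<noteq> 0"
  shows "has_component (in_vD \<iota> v grad f) (v f) \<delta> f"
  using has_component_bihom[of f "v f" \<delta> "v f" \<delta>] assms by (simp add: in_vD_bihom deg_eq F_ge_iff)

text \<open>The bihomogeneous elements of the kernel of \<beta> are thus those whose terms cancel to
  leading order in \<open>B\<close>. One direction reads off a component, the other uses that
  \<open>bihom\<close> vanishes on \<open>F_gt\<close>.\<close>

lemma subst_in_eq_zero_iff:
  assumes "p \<in> polys_in hom0" "\<And>m. m \<in> Poly_Mapping.keys p \<Longrightarrow> wt m = \<gamma> \<and> dg m = \<delta>"
  shows "subst_in \<iota> v grad p = \<zero>\<^bsub>T\<^esub> \<longleftrightarrow> subst \<iota> p \<in> F_gt v \<gamma>"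
proof
  assume "subst_in \<iota> v grad p = \<zero>\<^bsub>T\<^esub>"
  then have "has_component \<zero>\<^bsub>T\<^esub> \<gamma> \<delta> (subst \<iota> p)"
    using has_component_subst_in[OF assms(1), of \<gamma> \<delta>] assms(2) by (simp add: restrict_keys_id)
  then have "subst \<iota> p - 0 \<in> F_gt v \<gamma>"
    using has_component_zero by (rule has_component_unique[rotated]) simp
  then show "subst \<iota> p \<in> F_gt v \<gamma>" by simp
next
  assume "subst \<iota> p \<in> F_gt v \<gamma>"
  then show "subst_in \<iota> v grad p = \<zero>\<^bsub>T\<^esub>"
    using subst_in_bihomogeneous[OF assms] by (simp add: bihom_eq_zero)
qed

text \<open>The terms of \<open>h\<close> of value \<open>v r\<close> have the same component in
  this bidegree as \<open>r\<close>, so subtracting them cancels \<open>r\<close> modulo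
  \<open>F_gt v (v r)\<close>; the remaining terms already lie there.\<close>

lemma subduction_step_increases:
  assumes "r \<in> grad \<delta>" "r \<noteq> 0" "h \<in> polys_in hom0" "subst_in \<iota> v grad h = in_vD \<iota> v grad r"
    and "\<And>m. m \<in> Poly_Mapping.keys h \<Longrightarrow> v r \<le> wt m \<and> dg m = \<delta>"
  shows "r - subst \<iota> h \<in> F_gt v (v r)" "subst \<iota> h \<in> grad \<delta>"
proof -
  let ?Q = "\<lambda>m. wt m = v r \<and> dg m = \<delta>"
  have "has_component (in_vD \<iota> v grad r) (v r) \<delta> (subst \<iota> (restrict_keys ?Q h))"
    using has_component_subst_in[OF assms(3), of "v r" \<delta>] assms(4) by simp
  then have 1: "r - subst \<iota> (restrict_keys ?Q h) \<in> F_gt v (v r)"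
    using has_component_in[OF assms(1,2)] has_component_unique in_vD_closed by blast
  have 2: "subst \<iota> (restrict_keys (\<lambda>m. \<not> ?Q m) h) \<in> F_gt v (v r)"
    using assms(3,5) by (intro subst_in_F_gt restrict_keys_polys_in) (force simp: keys_restrict_keys)+
  have "subst \<iota> h = subst \<iota> (restrict_keys ?Q h) + subst \<iota> (restrict_keys (\<lambda>m. \<not> ?Q m) h)"
    using restrict_keys_split[of ?Q h] subst_simps(2) by metis
  then show "r - subst \<iota> h \<in> F_gt v (v r)"
    using F_gt_diff[OF 1 2] by (simp add: algebra_simps)
  show "subst \<iota> h \<in> grad \<delta>"
    using assms(3,5) by (intro subst_in_grad) auto
qed

lemma in_vD_algebra_eq:
  assumes "G \<subseteq> hom0"
  shows "in_vD_algebra \<iota> v grad G = subst_in \<iota> v grad ` polys_in G"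
    "in_vD_algebra \<iota> v grad G = generated_algebra T scal (in_vD \<iota> v grad ` G)"
proof -
  have "{f \<in> G. f \<noteq> 0 \<and> f \<in> homogeneous grad} = G"
    using assms by auto
  then show "in_vD_algebra \<iota> v grad G = generated_algebra T scal (in_vD \<iota> v grad ` G)"
    by (simp add: in_vD_algebra_def)
  then show "in_vD_algebra \<iota> v grad G = subst_in \<iota> v grad ` polys_in G"
    using poly_evaluation.generated_algebra_eq[OF poly_evaluation_in, of G] by simp
qed

lemma in_vD_algebra_mono:
  assumes "G \<subseteq> G'" "G' \<subseteq> hom0"
  shows "in_vD_algebra \<iota> v grad G \<subseteq> in_vD_algebra \<iota> v grad G'"
  using assms polys_in_mono[OF assms(1)] by (auto simp: in_vD_algebra_eq)

text \<open>Dropping the terms of value above \<open>v f\<close> leaves a bihomogeneous polynomial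
  that is still congruent to \<open>f\<close>, and evaluating it at the initial forms gives the
  initial form of \<open>f\<close>.\<close>

lemma in_vD_in_algebraI:
  assumes "G \<subseteq> hom0" "p \<in> polys_in G" "f \<in> grad \<delta>" "f \<noteq> 0" "subst \<iota> p - f \<in> F_gt v (v f)"
    and "\<And>m. m \<in> Poly_Mapping.keys p \<Longrightarrow> v f \<le> wt m \<and> dg m = \<delta>"
  shows "in_vD \<iota> v grad f \<in> in_vD_algebra \<iota> v grad G"
proof -
  let ?Q = "\<lambda>m. wt m = v f" let ?q = "restrict_keys ?Q p"
  have p: "p \<in> polys_in hom0"
    using assms(1,2) polys_in_mono by blast
  have q: "?q \<in> polys_in hom0"
    by (intro restrict_keys_polys_in p)
  have 2: "subst \<iota> (restrict_keys (\<lambda>m. \<not> ?Q m) p) \<in> F_gt v (v f)"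
    using assms(6) by (intro subst_in_F_gt restrict_keys_polys_in p) (force simp: keys_restrict_keys)+
  have "subst \<iota> p = subst \<iota> ?q + subst \<iota> (restrict_keys (\<lambda>m. \<not> ?Q m) p)"
    using restrict_keys_split[of ?Q p] subst_simps(2) by metis
  then have diff: "subst \<iota> ?q - f \<in> F_gt v (v f)"
    using F_gt_diff[OF assms(5) 2] by (simp add: algebra_simps)
  have "subst_in \<iota> v grad ?q = bihom (v f) \<delta> (subst \<iota> ?q)"
    using assms(6) by (intro subst_in_bihomogeneous q) (auto simp: keys_restrict_keys)
  also have "\<dots> = bihom (v f) \<delta> f"
    using assms(6) diff
    by (intro bihom_eqI subst_in_F_ge q) (auto simp: keys_restrict_keys F_ge_iff)
  also have "\<dots> = in_vD \<iota> v grad f"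
    using assms(3,4) by (simp add: in_vD_bihom deg_eq)
  finally show ?thesis
    unfolding in_vD_algebra_eq(1)[OF assms(1)]
    using restrict_keys_polys_in[OF assms(2), of ?Q] by (metis image_eqI)
qed

text \<open>The component of the initial form in bidegree (\<open>v f\<close>, \<delta>) is
  \<open>f\<close> itself and hence not negligible, so some term of the representing polynomial has
  this bidegree. With \<open>G\<close> a finite Khovanskii basis, the values of all homogeneous
  elements become values of monomials in finitely many variables.\<close>

lemma monomial_of_in_vD_algebra:
  assumes "G \<subseteq> hom0" "f \<in> grad \<delta>" "f \<noteq> 0" "in_vD \<iota> v grad f \<in> in_vD_algebra \<iota> v grad G"
  obtains m where "Poly_Mapping.keys m \<subseteq> G" "wt m = v f" "dg m = \<delta>"
proof -
  obtain p where p: "p \<in> polys_in G" "in_vD \<iota> v grad f = subst_in \<iota> v grad p"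
    using assms in_vD_algebra_eq(1) by blast
  then have "p \<in> polys_in hom0"
    using assms(1) polys_in_mono by blast
  then have "has_component (in_vD \<iota> v grad f) (v f) \<delta>
      (subst \<iota> (restrict_keys (\<lambda>m. wt m = v f \<and> dg m = \<delta>) p))"
    unfolding p(2) by (rule has_component_subst_in)
  from has_component_unique[OF in_vD_closed has_component_in[OF assms(2,3)] this]
  have "restrict_keys (\<lambda>m. wt m = v f \<and> dg m = \<delta>) p \<noteq> 0"
    using assms(3) by (auto simp: F_gt_iff)
  then have "\<exists>m\<in>Poly_Mapping.keys p. wt m = v f \<and> dg m = \<delta>"
    using restrict_keys_none[of p "\<lambda>m. wt m = v f \<and> dg m = \<delta>"] by blast
  then show thesis
    using that polys_in_keys[OF p(1)] by blast
qed

text \<open>Sorting the terms by degree decomposes \<open>subst \<iota> p\<close> into homogeneous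
  parts, and directness of the sum leaves only the part of degree \<delta>.\<close>

lemma homogeneous_representation:
  assumes "p \<in> polys_in hom0" "subst \<iota> p \<in> grad \<delta>"
  shows "subst \<iota> (restrict_keys (\<lambda>m. dg m = \<delta>) p) = subst \<iota> p"
proof -
  let ?D = "dg ` Poly_Mapping.keys p"
  let ?a = "\<lambda>\<epsilon>. subst \<iota> (restrict_keys (\<lambda>m. dg m = \<epsilon>) p)"
  have "finite M \<Longrightarrow> sum (\<lambda>\<epsilon>. restrict_keys (\<lambda>m. dg m = \<epsilon>) p) M = restrict_keys (\<lambda>m. dg m \<in> M) p" for M
    by (rule poly_mapping_eqI) (simp add: lookup_sum lookup_restrict_keys)
  from this[of ?D] have "sum (\<lambda>\<epsilon>. restrict_keys (\<lambda>m. dg m = \<epsilon>) p) ?D = p"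
    by (simp add: restrict_keys_id)
  moreover have "finite M \<Longrightarrow> subst \<iota> (sum (\<lambda>\<epsilon>. restrict_keys (\<lambda>m. dg m = \<epsilon>) p) M) = sum ?a M" for M
    by (induction M rule: finite_induct) simp_all
  ultimately have sum: "sum ?a ?D = subst \<iota> p"
    by (metis finite_imageI finite_keys)
  moreover have "?a \<epsilon> \<in> grad \<epsilon>" for \<epsilon>
    using assms(1) by (intro subst_in_grad restrict_keys_polys_in) (auto simp: keys_restrict_keys)
  ultimately have "subst \<iota> p = (if \<delta> \<in> ?D then ?a \<delta> else 0)"
    using grad_sum_component[of ?D ?a \<delta>] assms(2) by simp
  moreover have "?a \<delta> = 0" if "\<delta> \<notin> ?D"
  proof -
    have "restrict_keys (\<lambda>m. dg m = \<delta>) p = 0"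
      using that by (intro restrict_keys_none) auto
    then show ?thesis by simp
  qed
  ultimately show ?thesis
    by (auto split: if_splits)
qed

end

section \<open>Values in degree zero\<close>

lemma nat_incseq_subseq:
  fixes s :: "nat \<Rightarrow> nat"
  shows "\<exists>\<phi> :: nat \<Rightarrow> nat. strict_mono \<phi> \<and> mono (\<lambda>n. s (\<phi> n))"
proof -
  obtain f where f: "strict_mono f" "monoseq (\<lambda>n. s (f n))"
    using seq_monosub[of s] by (auto simp: o_def)
  from f(2) consider "incseq (\<lambda>n. s (f n))" | "decseq (\<lambda>n. s (f n))"
    by (auto simp: monoseq_iff)
  then show ?thesis
  proof cases
    case 1
    then show ?thesis using f(1) by (intro exI[of _ f]) auto
  next
    case 2
    \<comment> \<open>A decreasing sequence of naturals is constant from the place where its minimum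
      is attained.\<close>
    define N where "N = arg_min (\<lambda>n. s (f n)) (\<lambda>_. True)"
    have N: "s (f N) \<le> s (f n)" for n
      unfolding N_def by (rule arg_min_nat_le) simp
    have "s (f (N + n)) = s (f N)" for n
      using N[of "N + n"] decseqD[OF 2, of N "N + n"] by simp
    then have "mono (\<lambda>n. s (f (N + n)))"
      by (simp add: mono_def)
    moreover have "strict_mono (\<lambda>n. f (N + n))"
      using f(1) by (simp add: strict_mono_def)
    ultimately show ?thesis by blast
  qed
qed

text \<open>Pass to a subsequence that is nondecreasing in one coordinate after another. Its first
  two members are comparable, since coordinates outside \<open>X\<close> are zero.\<close>

lemma dickson:
  fixes m :: "nat \<Rightarrow> 'x \<Rightarrow>\<^sub>0 nat"
  assumes "finite X" "\<And>i. Poly_Mapping.keys (m i) \<subseteq> X"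
  shows "\<exists>i j. i < j \<and> (\<forall>x. Poly_Mapping.lookup (m i) x \<le> Poly_Mapping.lookup (m j) x)"
proof -
  have "\<exists>\<phi> :: nat \<Rightarrow> nat. strict_mono \<phi> \<and> (\<forall>x\<in>X. mono (\<lambda>i. Poly_Mapping.lookup (m (\<phi> i)) x))"
    using assms(1)
  proof (induction X)
    case empty
    show ?case by (rule exI[of _ id]) (simp add: strict_mono_def)
  next
    case (insert x X)
    then obtain \<phi> :: "nat \<Rightarrow> nat" where \<phi>: "strict_mono \<phi>" "\<forall>x\<in>X. mono (\<lambda>i. Poly_Mapping.lookup (m (\<phi> i)) x)"
      by blast
    obtain \<psi> :: "nat \<Rightarrow> nat" where \<psi>: "strict_mono \<psi>" "mono (\<lambda>i. Poly_Mapping.lookup (m (\<phi> (\<psi> i))) x)"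
      using nat_incseq_subseq[of "\<lambda>i. Poly_Mapping.lookup (m (\<phi> i)) x"] by blast
    have "strict_mono (\<lambda>i. \<phi> (\<psi> i))"
      using \<phi>(1) \<psi>(1) by (simp add: strict_mono_def)
    moreover have "mono (\<lambda>i. Poly_Mapping.lookup (m (\<phi> (\<psi> i))) y)" if "y \<in> X" for y
      using \<phi>(2) that strict_mono_mono[OF \<psi>(1)] by (auto simp: mono_def)
    ultimately show ?case using \<psi>(2) by (intro exI[of _ "\<lambda>i. \<phi> (\<psi> i)"]) auto
  qed
  then obtain \<phi> :: "nat \<Rightarrow> nat" where \<phi>: "strict_mono \<phi>" "\<forall>x\<in>X. mono (\<lambda>i. Poly_Mapping.lookup (m (\<phi> i)) x)"
    by blast
  have "Poly_Mapping.lookup (m (\<phi> 0)) x \<le> Poly_Mapping.lookup (m (\<phi> 1)) x" for x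
  proof (cases "x \<in> X")
    case True
    then show ?thesis using \<phi>(2) by (auto simp: mono_def)
  next
    case False
    then have "x \<notin> Poly_Mapping.keys (m (\<phi> 0))" using assms(2) by blast
    then show ?thesis by (simp add: in_keys_iff)
  qed
  moreover have "\<phi> 0 < \<phi> 1"
    using \<phi>(1) by (simp add: strict_mono_def)
  ultimately show ?thesis by blast
qed

context valued_graded_algebra
begin

text \<open>The example of nontermination lives in \<open>K[x]\<close>. It is described by
  polynomials in one variable because the proof that the remainder 0 is never reached counts degrees
  of compositions.\<close>

definition eval_at :: "'b \<Rightarrow> 'k poly \<Rightarrow> 'b" where
  "eval_at x p = poly (map_poly \<iota> p) x"

lemma eval_at_pCons [simp]: "eval_at x (pCons a p) = \<iota> a + x * eval_at x p"
  by (simp add: eval_at_def map_poly_pCons)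

lemma eval_at_0 [simp]: "eval_at x 0 = 0"
  by (simp add: eval_at_def)

lemma eval_at_add [simp]: "eval_at x (p + q) = eval_at x p + eval_at x q"
  by (induction p q rule: poly_induct2) (simp_all add: algebra_simps)

lemma eval_at_smult [simp]: "eval_at x (smult c p) = \<iota> c * eval_at x p"
  by (induction p) (simp_all add: algebra_simps)

lemma eval_at_diff [simp]: "eval_at x (p - q) = eval_at x p - eval_at x q"
  using eval_at_add[of x "p - q" q] by (simp add: algebra_simps)

lemma eval_at_mult [simp]: "eval_at x (p * q) = eval_at x p * eval_at x q"
  by (induction p) (simp_all add: algebra_simps)

lemma eval_at_grad_zero: "x \<in> grad 0 \<Longrightarrow> eval_at x p \<in> grad 0"
  using grad_mult[of x 0 _ 0] by (induction p) (auto simp: grad_zero intro: grad_add scalar_in_grad)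

lemma eval_at_F_ge:
  assumes "x \<in> F_ge v 0"
  shows "eval_at x p \<in> F_ge v 0"
proof (induction p)
  case (pCons a p)
  then have "x * eval_at x p \<in> F_ge v 0"
    using F_ge_mult[OF assms] by fastforce
  then show ?case
    by (simp add: F_ge_add F_ge_scalar)
qed simp

text \<open>Leading means of lowest order: when \<open>v x > 0\<close>, the smallest power of
  \<open>x\<close> has the smallest value and dominates the rest, so that \<open>eval_at x p\<close>
  is non-zero.\<close>

lemma eval_at_leading:
  assumes "p \<noteq> 0"
  obtains c k q where "c \<noteq> 0" "eval_at x p = \<iota> c * x ^ k + x ^ k * (x * eval_at x q)"
proof -
  have "\<exists>c k q. c \<noteq> 0 \<and> eval_at x p = \<iota> c * x ^ k + x ^ k * (x * eval_at x q)"
    using assms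
  proof (induction p)
    case (pCons a p)
    show ?case
    proof (cases "a = 0")
      case True
      then obtain c k q where "c \<noteq> 0" "eval_at x p = \<iota> c * x ^ k + x ^ k * (x * eval_at x q)"
        using pCons by auto
      then have "eval_at x (pCons a p) = \<iota> c * x ^ Suc k + x ^ Suc k * (x * eval_at x q)"
        using True by (simp add: algebra_simps)
      then show ?thesis using \<open>c \<noteq> 0\<close> by blast
    next
      case False
      have "eval_at x (pCons a p) = \<iota> a * x ^ 0 + x ^ 0 * (x * eval_at x p)" by simp
      then show ?thesis using False by blast
    qed
  qed simp
  then show thesis using that by blast
qed

text \<open>Makes the powers of \<open>x\<close> and of \<open>x + x * x = x * (1 + x)\<close> agree
  up to terms of larger value when \<open>v x > 0\<close>.\<close>

lemma power_one_add: "\<exists>p. (1 + x) ^ k = 1 + x * eval_at x p"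
proof (induction k)
  case 0
  show ?case by (rule exI[of _ 0]) simp
next
  case (Suc k)
  then obtain p where "(1 + x) ^ k = 1 + x * eval_at x p" by blast
  then have "(1 + x) ^ Suc k = 1 + x * eval_at x (1 + p + [:0, 1:] * p)"
    by (simp add: algebra_simps one_pCons)
  then show ?case by blast
qed

lemma monomial_degree_single: "monomial_degree w (Poly_Mapping.single x n) = (\<Sum>_<n. w x)"
  by (cases "n = 0") (simp_all add: monomial_degree_def)

text \<open>The lowest term of \<open>p\<close> determines the initial form of
  \<open>eval_at x p\<close>, and \<open>x\<close> and \<open>x + x * x\<close> have the same
  initial form. So zero is the only remainder in \<open>K[x]\<close> at which the loop could
  stop.\<close>

lemma eval_at_continues:
  assumes x: "x \<in> grad 0" "x \<noteq> 0" "v x > 0" and "p \<noteq> 0"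
  shows "subduction_continues \<iota> v grad {x + x * x} (eval_at x p)"
    and "{x + x * x} \<subseteq> hom0"
proof -
  let ?y = "x + x * x"
  have x_gt: "x \<in> F_gt v 0" and x_ge: "x \<in> F_ge v 0"
    using x by (auto simp: F_gt_iff F_ge_iff)
  have xE: "x * eval_at x q \<in> F_gt v 0" for q
    using F_gt_mult[OF eval_at_F_ge[OF x_ge] x_gt] by (simp add: mult.commute)
  have xk: "x ^ k * (x * eval_at x q) \<in> F_gt v (v (x ^ k))" for k q
    using F_gt_mult[OF _ xE, of "x ^ k" "v (x ^ k)"] x by (simp add: F_ge_iff)
  have "?y \<noteq> 0" "v ?y = v x"
    using v_eqI[of x ?y] F_gt_mult[of x "v x" x 0] x_gt x(2) by (auto simp: F_ge_iff)
  have y_grad: "?y \<in> grad 0"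
    using grad_mult[OF x(1) x(1)] x(1) by (auto intro: grad_add)
  then show G: "{?y} \<subseteq> hom0"
    using \<open>?y \<noteq> 0\<close> by (auto simp: homogeneous_def)
  obtain c k q where ckq: "c \<noteq> 0" "eval_at x p = \<iota> c * x ^ k + x ^ k * (x * eval_at x q)"
    using eval_at_leading[OF \<open>p \<noteq> 0\<close>] .
  have lead: "\<iota> c * x ^ k \<noteq> 0" "v (\<iota> c * x ^ k) = v (x ^ k)"
    using ckq x by (simp_all add: v_scalar_mult)
  have f: "eval_at x p \<noteq> 0" "v (eval_at x p) = v (x ^ k)"
    using v_eqI[OF lead(1), of "eval_at x p"] ckq(2) xk lead(2) by auto
  obtain w where w: "(1 + x) ^ k = 1 + x * eval_at x w"
    using power_one_add by blast
  have yk: "?y ^ k = x ^ k + x ^ k * (x * eval_at x w)"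
  proof -
    have "?y ^ k = (x * (1 + x)) ^ k" by (simp add: algebra_simps)
    also have "\<dots> = x ^ k * (1 + x * eval_at x w)" by (simp only: power_mult_distrib w)
    finally show ?thesis by (simp add: distrib_left)
  qed
  have "in_vD \<iota> v grad (eval_at x p) \<in> in_vD_algebra \<iota> v grad {?y}"
  proof (rule in_vD_in_algebraI[OF G _ eval_at_grad_zero[OF x(1)] f(1)])
    \<comment> \<open>The witness is a single term with the lowest coefficient and exponent of
      \<open>p\<close>, in the variable indexed by \<open>?y\<close>.\<close>
    let ?h = "Poly_Mapping.single (Poly_Mapping.single ?y k) c"
    show "?h \<in> polys_in {?y}"
      by (intro polys_in_single) auto
    have "subst \<iota> ?h - eval_at x p = \<iota> c * (x ^ k * (x * eval_at x w)) - x ^ k * (x * eval_at x q)"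
      by (simp add: yk ckq(2) algebra_simps)
    also have "\<dots> \<in> F_gt v (v (x ^ k))"
      by (intro F_gt_diff F_scalar_mult xk)
    finally show "subst \<iota> ?h - eval_at x p \<in> F_gt v (v (eval_at x p))"
      by (simp add: f(2))
    show "v (eval_at x p) \<le> wt m \<and> dg m = 0" if "m \<in> Poly_Mapping.keys ?h" for m
      using that \<open>v ?y = v x\<close> deg_eq[OF \<open>?y \<noteq> 0\<close> y_grad] x(2)
      by (auto simp: f(2) monomial_degree_single v_power split: if_splits)
  qed
  then show "subduction_continues \<iota> v grad {?y} (eval_at x p)"
    using f(1) by (simp add: subduction_continues_def)
qed

text \<open>Applied to \<open>x + x * x\<close>: whatever polynomial the rule chooses, what is
  subtracted is a composition with \<open>Y\<close>.\<close>

lemma subst_singleton_eval_at: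
  assumes "h \<in> polys_in {eval_at x Y}"
  shows "\<exists>q. subst \<iota> h = eval_at x (pcompose q Y)"
proof (induction h rule: poly_mapping_single_induct)
  case zero
  show ?case by (intro exI[of _ 0]) simp
next
  case (single m)
  have pow: "\<exists>q. eval_at x Y ^ n = eval_at x (pcompose q Y)" for n
  proof (induction n)
    case 0
    show ?case by (intro exI[of _ 1]) (simp add: pcompose_1 one_pCons)
  next
    case (Suc n)
    then obtain q where "eval_at x Y ^ n = eval_at x (pcompose q Y)" by blast
    then have "eval_at x Y ^ Suc n = eval_at x (pcompose (pCons 0 q) Y)"
      by (simp add: pcompose_pCons)
    then show ?case by blast
  qed
  have "B.mon m = eval_at x Y ^ Poly_Mapping.lookup m (eval_at x Y)"
  proof (cases "Poly_Mapping.keys m = {}")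
    case True
    then show ?thesis by (simp add: B_mon in_keys_iff)
  next
    case False
    then have "Poly_Mapping.keys m = {eval_at x Y}"
      using polys_in_keys[OF assms single] by blast
    then show ?thesis by (simp add: B_mon)
  qed
  then obtain q where "B.mon m = eval_at x (pcompose q Y)"
    using pow by metis
  then have "subst \<iota> (Poly_Mapping.single m (Poly_Mapping.lookup h m)) =
      eval_at x (pcompose (smult (Poly_Mapping.lookup h m) q) Y)"
    by (simp add: pcompose_smult)
  then show ?case by blast
next
  case (add q r)
  then obtain q' r' where "subst \<iota> q = eval_at x (pcompose q' Y)" "subst \<iota> r = eval_at x (pcompose r' Y)"
    by blast
  then have "subst \<iota> (q + r) = eval_at x (pcompose (q' + r') Y)"
    by (simp add: pcompose_add)
  then show ?case by blast
qed

lemma subduction_ruleD: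
  assumes "subduction_rule \<iota> v grad \<rho>" "G \<subseteq> hom0" "r \<in> homogeneous grad"
    "subduction_continues \<iota> v grad G r" "\<rho> G (G', h, r) = (F, h')"
  shows "F \<subseteq> G" "h' \<in> polys_in F" "subst_in \<iota> v grad h' = in_vD \<iota> v grad r"
    "\<And>t. t \<in> Supp h' \<Longrightarrow> v r \<le> v (subst \<iota> t) \<and> deg grad (subst \<iota> t) = deg grad r"
proof -
  have "finite F \<and> F \<subseteq> G \<and> h' \<in> polys_in F \<and> subst_in \<iota> v grad h' = in_vD \<iota> v grad r \<and>
      (\<forall>t\<in>Supp h'. v (subst \<iota> t) \<ge> v r \<and> deg grad (subst \<iota> t) = deg grad r)"
    using assms(1)[unfolded subduction_rule_def, rule_format, OF assms(2-5)] .
  then show "F \<subseteq> G" "h' \<in> polys_in F" "subst_in \<iota> v grad h' = in_vD \<iota> v grad r"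
    "\<And>t. t \<in> Supp h' \<Longrightarrow> v r \<le> v (subst \<iota> t) \<and> deg grad (subst \<iota> t) = deg grad r"
    by blast+
qed

text \<open>If \<open>v x > 0\<close>, then the subduction of \<open>x\<close> by \<open>{x + x\<^sup>2}\<close> does not terminate: the remainders
  stay in \<open>x + K[x + x\<^sup>2]\<close>, which does not contain \<open>0\<close>, and the initial form of a polynomial in \<open>x\<close>
  is a multiple of a power of the initial form of \<open>x + x\<^sup>2\<close>.\<close>

lemma v_degree_zero_nonpos:
  assumes "subduction_rule \<iota> v grad \<rho>" "subduction_terminates \<iota> v grad \<rho>" "x \<in> grad 0" "x \<noteq> 0"
  shows "v x \<le> 0"
proof (rule ccontr)
  assume "\<not> v x \<le> 0"
  then have x: "x \<in> grad 0" "x \<noteq> 0" "v x > 0"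
    using assms by auto
  let ?y = "x + x * x" and ?Y = "[:0, 1, 1:] :: 'k poly"
  have y: "eval_at x ?Y = ?y"
    by (simp add: algebra_simps)
  \<comment> \<open>A composition with a quadratic polynomial has even degree, whereas the variable
    has degree 1.\<close>
  have nonzero: "[:0, 1:] - pcompose q ?Y \<noteq> 0" for q
  proof
    assume "[:0, 1:] - pcompose q ?Y = 0"
    then have "degree (pcompose q ?Y) = degree ([:0, 1:] :: 'k poly)"
      by simp
    then show False
      by (simp add: degree_pcompose) presburger
  qed
  have y_hom0: "{?y} \<subseteq> hom0"
    using eval_at_continues(2)[OF x, of 1] by simp
  let ?P = "\<lambda>(G' :: 'b set, h :: ('b, 'k) mpoly, r). \<exists>q. r = eval_at x ([:0, 1:] - pcompose q ?Y)"
  obtain s where s: "subduction \<iota> v grad \<rho> {?y} x = Some s"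
    using assms(2) y_hom0 grad_homogeneous[OF x(1)] unfolding subduction_terminates_def by blast
  have "?P s"
  proof (rule while_option_rule[OF _ s[unfolded subduction_def], where P = ?P])
    show "?P ({}, 0, x)"
      by (auto intro!: exI[of _ 0])
    fix t
    assume P: "?P t" and b: "case t of (G', h, r) \<Rightarrow> subduction_continues \<iota> v grad {?y} r"
    obtain G' h r where t: "t = (G', h, r)" by (cases t)
    obtain F h' where Fh: "\<rho> {?y} (G', h, r) = (F, h')" by fastforce
    obtain q where q: "r = eval_at x ([:0, 1:] - pcompose q ?Y)"
      using P t by auto
    then have "r \<in> homogeneous grad"
      using eval_at_grad_zero[OF x(1)] grad_homogeneous by blast
    then have "F \<subseteq> {?y}" "h' \<in> polys_in F"
      using subduction_ruleD[OF assms(1) y_hom0 _ _ Fh] b t by simp_all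
    then have "h' \<in> polys_in {eval_at x ?Y}"
      unfolding y using polys_in_mono[of F "{?y}"] by blast
    then obtain q' where "subst \<iota> h' = eval_at x (pcompose q' ?Y)"
      using subst_singleton_eval_at by blast
    then have "r - subst \<iota> h' = eval_at x ([:0, 1:] - pcompose (q + q') ?Y)"
      by (simp add: q pcompose_add)
    then show "?P (subduction_step \<iota> \<rho> {?y} t)"
      unfolding subduction_step_def t using Fh by auto
  qed
  moreover have "\<not> (case s of (G', h, r) \<Rightarrow> subduction_continues \<iota> v grad {?y} r)"
    using while_option_stop[OF s[unfolded subduction_def]] .
  ultimately show False
    using eval_at_continues(1)[OF x nonzero] by (cases s) auto
qed

lemma no_ascending_monomials:
  assumes nonpos: "\<And>x. x \<in> grad 0 \<Longrightarrow> x \<noteq> 0 \<Longrightarrow> v x \<le> 0"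
    and H: "finite H" "H \<subseteq> hom0"
    and m: "\<And>i :: nat. Poly_Mapping.keys (m i) \<subseteq> H" "\<And>i. dg (m i) = \<delta>"
    and asc: "\<And>i j. i < j \<Longrightarrow> wt (m i) < wt (m j)"
  shows False
proof -
  obtain i j :: nat where ij: "i < j" "\<And>x. Poly_Mapping.lookup (m i) x \<le> Poly_Mapping.lookup (m j) x"
    using dickson[of H m, OF H(1) m(1)] by blast
  \<comment> \<open>Subtraction of exponents is truncated; the divisibility from Dickson's lemma
    makes it exact.\<close>
  define q where "q = m j - m i"
  have mj: "m j = m i + q"
    unfolding q_def using ij(2) by (intro poly_mapping_eqI) (simp add: lookup_add lookup_minus)
  have "Poly_Mapping.keys q \<subseteq> Poly_Mapping.keys (m j)"
    unfolding q_def by (auto simp: in_keys_iff lookup_minus)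
  then have q: "Poly_Mapping.keys q \<subseteq> hom0" "Poly_Mapping.keys (m i) \<subseteq> hom0"
    using m(1) H(2) by blast+
  have "dg q = 0" "wt (m j) = wt (m i) + wt q"
    using monomial_degree_add[OF q(2,1)] mj m(2)[of i] m(2)[of j] by simp_all
  then have "v (B.mon q) \<le> 0" "0 < wt q"
    using nonpos[of "B.mon q"] mon_hom0[OF q(1)] asc[OF ij(1)] by simp_all
  then show False
    using mon_hom0(2)[OF q(1)] by simp
qed

section \<open>Subduction\<close>

text \<open>The value of the remainder rises in each round, and the chosen terms have value at least
  \<open>v r\<close>, so a lower bound \<gamma> for the input holds for all terms collected. Stating
  the bound through \<open>F_ge\<close> also covers a zero input or remainder.\<close>

lemma subduction_representation:
  assumes rule: "subduction_rule \<iota> v grad \<rho>" and G: "G \<subseteq> hom0"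
    and f: "f \<in> grad \<delta>" "f \<in> F_ge v \<gamma>"
    and res: "subduction \<iota> v grad \<rho> G f = Some (G', h, r)"
  shows "\<exists>p\<in>polys_in G. f = subst \<iota> p + r \<and> (\<forall>m\<in>Poly_Mapping.keys p. dg m = \<delta> \<and> \<gamma> \<le> wt m)"
    and "r \<in> grad \<delta>" "r \<in> F_ge v \<gamma>" "r \<noteq> 0 \<Longrightarrow> in_vD \<iota> v grad r \<notin> in_vD_algebra \<iota> v grad G"
proof -
  let ?P = "\<lambda>(G' :: 'b set, h :: ('b, 'k) mpoly, r). r \<in> grad \<delta> \<and> r \<in> F_ge v \<gamma> \<and>
    (\<exists>p\<in>polys_in G. f = subst \<iota> p + r \<and> (\<forall>m\<in>Poly_Mapping.keys p. dg m = \<delta> \<and> \<gamma> \<le> wt m))"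
  have "?P (G', h, r)"
  proof (rule while_option_rule[OF _ res[unfolded subduction_def], where P = ?P])
    show "?P ({}, 0, f)"
      using f by (auto intro!: bexI[of _ 0])
    fix s
    assume P: "?P s" and b: "case s of (G', h, r) \<Rightarrow> subduction_continues \<iota> v grad G r"
    obtain G' h r where s: "s = (G', h, r)" by (cases s)
    obtain F h' where Fh: "\<rho> G (G', h, r) = (F, h')" by fastforce
    obtain p where p: "p \<in> polys_in G" "f = subst \<iota> p + r"
        "\<And>m. m \<in> Poly_Mapping.keys p \<Longrightarrow> dg m = \<delta> \<and> \<gamma> \<le> wt m"
      and r: "r \<in> grad \<delta>" "r \<in> F_ge v \<gamma>"
      using P s by auto
    have r0: "r \<noteq> 0"
      using b s by (auto simp: subduction_continues_def)
    have step: "F \<subseteq> G" "h' \<in> polys_in F" "subst_in \<iota> v grad h' = in_vD \<iota> v grad r"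
      "\<And>t. t \<in> Supp h' \<Longrightarrow> v r \<le> v (subst \<iota> t) \<and> deg grad (subst \<iota> t) = deg grad r"
      using subduction_ruleD[OF rule G grad_homogeneous[OF r(1)] _ Fh] b s by simp_all
    have h'_G: "h' \<in> polys_in G" and h'_hom0: "h' \<in> polys_in hom0"
      using step(2) polys_in_mono[OF step(1)] polys_in_mono[OF G] by blast+
    \<comment> \<open>The rule bounds values of substituted terms; their coefficients being
      non-zero, these are the weights and degrees of the monomials.\<close>
    have terms: "v r \<le> wt m \<and> dg m = \<delta>" if "m \<in> Poly_Mapping.keys h'" for m
    proof -
      have "Poly_Mapping.single m (Poly_Mapping.lookup h' m) \<in> Supp h'"
        using that by (auto simp: Supp_def)
      from step(4)[OF this] show ?thesis
        using term_hom0(3,4)[OF polys_in_keys[OF h'_hom0 that], of "Poly_Mapping.lookup h' m"]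
          that deg_eq[OF r0 r(1)] by (simp add: in_keys_iff)
    qed
    note inc = subduction_step_increases[OF r(1) r0 h'_hom0 step(3) terms]
    have "\<gamma> \<le> v r"
      using r(2) r0 by (simp add: F_ge_iff)
    then have "r - subst \<iota> h' \<in> F_ge v \<gamma>"
      using inc(1) by (auto simp: F_ge_iff F_gt_iff)
    moreover have "\<forall>m\<in>Poly_Mapping.keys (p + h'). dg m = \<delta> \<and> \<gamma> \<le> wt m"
      using keys_add[of p h'] p(3) terms \<open>\<gamma> \<le> v r\<close> by fastforce
    moreover have "p + h' \<in> polys_in G" "f = subst \<iota> (p + h') + (r - subst \<iota> h')"
      using p h'_G by (auto intro: polys_in_add)
    ultimately have "?P (G' \<union> F, h + h', r - subst \<iota> h')"
      using grad_diff[OF r(1) inc(2)] unfolding case_prod_conv by blast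
    moreover have "subduction_step \<iota> \<rho> G s = (G' \<union> F, h + h', r - subst \<iota> h')"
      by (simp add: subduction_step_def s Fh)
    ultimately show "?P (subduction_step \<iota> \<rho> G s)"
      by (simp only:)
  qed
  then show "\<exists>p\<in>polys_in G. f = subst \<iota> p + r \<and> (\<forall>m\<in>Poly_Mapping.keys p. dg m = \<delta> \<and> \<gamma> \<le> wt m)"
    and "r \<in> grad \<delta>" "r \<in> F_ge v \<gamma>"
    by auto
  show "r \<noteq> 0 \<Longrightarrow> in_vD \<iota> v grad r \<notin> in_vD_algebra \<iota> v grad G"
    using while_option_stop[OF res[unfolded subduction_def]] by (simp add: subduction_continues_def)
qed

text \<open>A relation among initial forms loses its leading part when the elements themselves are
  substituted. This strict gain over the common weight \<gamma> is what makes the rewriting in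
  \<open>represented_push\<close> increase values.\<close>

lemma kernel_rule_props:
  assumes "kernel_rule \<iota> v grad \<kappa>" "finite G" "G \<subseteq> hom0" "h \<in> \<kappa> G"
  obtains \<gamma> \<delta> where "h \<in> polys_in G" "\<And>m. m \<in> Poly_Mapping.keys h \<Longrightarrow> wt m = \<gamma> \<and> dg m = \<delta>"
    "subst \<iota> h \<in> F_gt v \<gamma>" "subst \<iota> h \<in> grad \<delta>"
proof -
  interpret PR: cring "poly_ring G :: ('b, 'k) mpoly ring"
    by (rule cring_poly_ring)
  have \<kappa>: "\<kappa> G \<subseteq> polys_in G" "homogeneous_poly v h" "homogeneous_poly (deg grad) h"
      "Idl\<^bsub>poly_ring G\<^esub> (\<kappa> G) = beta_kernel \<iota> v grad G"
    using assms unfolding kernel_rule_def by auto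
  obtain \<gamma> \<delta> where hom: "\<And>m. m \<in> Poly_Mapping.keys h \<Longrightarrow> wt m = \<gamma> \<and> dg m = \<delta>"
    using \<kappa>(2,3) unfolding homogeneous_poly_def by blast
  have h: "h \<in> polys_in G" "h \<in> polys_in hom0"
    using \<kappa>(1) assms(4) polys_in_mono[OF assms(3)] by blast+
  have "h \<in> beta_kernel \<iota> v grad G"
    using PR.genideal_self[of "\<kappa> G"] \<kappa>(1,4) assms(4) by (auto simp: poly_ring_def)
  then have "subst_in \<iota> v grad h = \<zero>\<^bsub>T\<^esub>"
    by (simp add: beta_kernel_def a_kernel_def')
  then have "subst \<iota> h \<in> F_gt v \<gamma>"
    using subst_in_eq_zero_iff[OF h(2) hom] by simp
  moreover have "subst \<iota> h \<in> grad \<delta>"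
    using h(2) hom by (intro subst_in_grad) auto
  ultimately show thesis
    using that h(1) hom by blast
qed

text \<open>Each generator of the kernel leaves at most one remainder. The last claim is the failed
  loop condition: a surviving remainder has a new initial form, so none survives once all initial
  forms are generated.\<close>

lemma new_remainders_props:
  assumes "subduction_rule \<iota> v grad \<rho>" "kernel_rule \<iota> v grad \<kappa>" "finite G" "G \<subseteq> hom0"
  shows "finite (new_remainders \<iota> v grad \<rho> \<kappa> G)" "new_remainders \<iota> v grad \<rho> \<kappa> G \<subseteq> hom0"
    "r \<in> new_remainders \<iota> v grad \<rho> \<kappa> G \<Longrightarrow> in_vD \<iota> v grad r \<notin> in_vD_algebra \<iota> v grad G"
proof -
  have "new_remainders \<iota> v grad \<rho> \<kappa> G \<subseteq>
      (\<lambda>h. snd (snd (the (subduction \<iota> v grad \<rho> G (subst \<iota> h))))) ` \<kappa> G"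
    by (force simp: new_remainders_def)
  moreover have "finite (\<kappa> G)"
    using assms unfolding kernel_rule_def by auto
  ultimately show "finite (new_remainders \<iota> v grad \<rho> \<kappa> G)"
    by (blast intro: finite_subset)
  have *: "r \<in> hom0 \<and> in_vD \<iota> v grad r \<notin> in_vD_algebra \<iota> v grad G"
    if r: "r \<in> new_remainders \<iota> v grad \<rho> \<kappa> G" for r
  proof -
    obtain h G' h' where h: "h \<in> \<kappa> G" "r \<noteq> 0" "subduction \<iota> v grad \<rho> G (subst \<iota> h) = Some (G', h', r)"
      using r by (auto simp: new_remainders_def)
    obtain \<gamma> \<delta> where "subst \<iota> h \<in> F_gt v \<gamma>" "subst \<iota> h \<in> grad \<delta>"
      using kernel_rule_props[OF assms(2-4) h(1)] by metis
    then show ?thesis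
      using subduction_representation(2,4)[OF assms(1,4) _ F_gt_subset_F_ge h(3)] h(2) grad_homogeneous
      by blast
  qed
  then show "new_remainders \<iota> v grad \<rho> \<kappa> G \<subseteq> hom0"
    "r \<in> new_remainders \<iota> v grad \<rho> \<kappa> G \<Longrightarrow> in_vD \<iota> v grad r \<notin> in_vD_algebra \<iota> v grad G"
    by blast+
qed

text \<open>The bound is imposed on every term of a representation, which for homogeneous
  \<open>G\<close> is stronger than asking that the element itself lie in
  \<open>F_gt v \<gamma>\<close>. Closing this gap is the purpose of
  \<open>represented_push\<close>.\<close>

definition represented :: "'b set \<Rightarrow> 'g \<Rightarrow> 'd \<Rightarrow> 'b set" where
  "represented G \<gamma> \<delta> = subst \<iota> ` {p \<in> polys_in G. \<forall>m\<in>Poly_Mapping.keys p. dg m = \<delta> \<and> \<gamma> < wt m}"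

lemma represented_zero: "0 \<in> represented G \<gamma> \<delta>"
  unfolding represented_def by (auto intro!: image_eqI[of _ _ 0])

lemma represented_add:
  assumes "b \<in> represented G \<gamma> \<delta>" "b' \<in> represented G \<gamma> \<delta>"
  shows "b + b' \<in> represented G \<gamma> \<delta>"
proof -
  obtain p p' where p: "b = subst \<iota> p" "p \<in> polys_in G" "\<forall>m\<in>Poly_Mapping.keys p. dg m = \<delta> \<and> \<gamma> < wt m"
    "b' = subst \<iota> p'" "p' \<in> polys_in G" "\<forall>m\<in>Poly_Mapping.keys p'. dg m = \<delta> \<and> \<gamma> < wt m"
    using assms unfolding represented_def by blast
  then have "p + p' \<in> {p \<in> polys_in G. \<forall>m\<in>Poly_Mapping.keys p. dg m = \<delta> \<and> \<gamma> < wt m}"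
    using keys_add[of p p'] polys_in_add by blast
  moreover have "b + b' = subst \<iota> (p + p')"
    using p by simp
  ultimately show ?thesis
    unfolding represented_def by blast
qed

lemma represented_mult:
  assumes "b \<in> represented G \<gamma> \<delta>" "Poly_Mapping.keys m \<subseteq> G" "G \<subseteq> hom0"
  shows "\<iota> c * B.mon m * b \<in> represented G (wt m + \<gamma>) (dg m + \<delta>)"
proof -
  obtain p where p: "b = subst \<iota> p" "p \<in> polys_in G" "\<forall>k\<in>Poly_Mapping.keys p. dg k = \<delta> \<and> \<gamma> < wt k"
    using assms(1) unfolding represented_def by blast
  let ?s = "Poly_Mapping.single m c"
  have "?s * p \<in> polys_in G"
    using assms(2) p(2) by (intro polys_in_mult polys_in_single)
  moreover have "dg n = dg m + \<delta> \<and> wt m + \<gamma> < wt n" if "n \<in> Poly_Mapping.keys (?s * p)" for n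
  proof -
    have "n \<in> {a + b |a b. a \<in> Poly_Mapping.keys ?s \<and> b \<in> Poly_Mapping.keys p}"
      using that keys_mult[of ?s p] by blast
    then obtain k where "k \<in> Poly_Mapping.keys p" "n = m + k"
      by (auto split: if_splits)
    moreover have "Poly_Mapping.keys k \<subseteq> hom0" "Poly_Mapping.keys m \<subseteq> hom0"
      using polys_in_keys[OF p(2)] calculation assms(2,3) by blast+
    ultimately show ?thesis
      using p(3) by (simp add: monomial_degree_add)
  qed
  moreover have "\<iota> c * B.mon m * b = subst \<iota> (?s * p)"
    using p(1) by simp
  ultimately show ?thesis
    unfolding represented_def by blast
qed

lemma restrict_keys_mult_single:
  assumes "p \<in> polys_in hom0" "Poly_Mapping.keys m \<subseteq> hom0"
  shows "restrict_keys (\<lambda>k. wt k = \<gamma> \<and> dg k = \<delta>) (Poly_Mapping.single m c * p) =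
    Poly_Mapping.single m c * restrict_keys (\<lambda>k. wt k = \<gamma> - wt m \<and> dg k = \<delta> - dg m) p"
proof (induction p rule: poly_mapping_single_induct)
  case (single k)
  have "wt (m + k) = wt m + wt k" "dg (m + k) = dg m + dg k"
    using monomial_degree_add[OF assms(2) polys_in_keys[OF assms(1) single]] .
  then show ?case
    by (auto simp: mult_single restrict_keys_single algebra_simps)
qed (simp_all add: distrib_left restrict_keys_add)

text \<open>The cancelling part lies in the kernel of \<open>\<beta>\<close>, and each chosen generator of the kernel
  evaluates to an element represented by its subduction.\<close>

lemma represented_push:
  assumes rule: "subduction_rule \<iota> v grad \<rho>" and terminates: "subduction_terminates \<iota> v grad \<rho>"
    and ker: "kernel_rule \<iota> v grad \<kappa>" and G: "finite G" "G \<subseteq> hom0"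
    and p: "p \<in> polys_in G" "\<And>m. m \<in> Poly_Mapping.keys p \<Longrightarrow> dg m = \<delta> \<and> \<gamma> \<le> wt m"
      "subst \<iota> p \<in> F_gt v \<gamma>"
  shows "subst \<iota> p \<in> represented (G \<union> new_remainders \<iota> v grad \<rho> \<kappa> G) \<gamma> \<delta>"
proof -
  interpret PR: cring "poly_ring G :: ('b, 'k) mpoly ring"
    by (rule cring_poly_ring)
  define G' where "G' = G \<union> new_remainders \<iota> v grad \<rho> \<kappa> G"
  have G': "G \<subseteq> G'" "G' \<subseteq> hom0"
    using G new_remainders_props(2)[OF rule ker G] by (auto simp: G'_def)
  let ?c = "\<lambda>\<gamma> \<delta>. restrict_keys (\<lambda>m. wt m = \<gamma> \<and> dg m = \<delta>)"
  \<comment> \<open>Elements of the ideal generated by \<open>\<kappa> G\<close> may be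
    inhomogeneous, so the property is imposed on each bihomogeneous part; in this form it survives
    multiplication by arbitrary polynomials. Each part of weight \<gamma> must be rewritable over
    \<open>G'\<close> with terms of weight above \<gamma>.\<close>
  define X where "X = {q \<in> polys_in G. \<forall>\<gamma> \<delta>. subst \<iota> (?c \<gamma> \<delta> q) \<in> represented G' \<gamma> \<delta>}"
  have uminus: "\<ominus>\<^bsub>poly_ring G\<^esub> q = - q" if "q \<in> polys_in G" for q :: "('b, 'k) mpoly"
    by (rule PR.minus_equality) (use that in \<open>auto simp: poly_ring_def polys_in_uminus\<close>)
  have mult: "q * x \<in> X" if "q \<in> polys_in G" "x \<in> X" for q x
  proof (induction q rule: poly_mapping_single_induct)
    case zero
    show ?case by (simp add: X_def represented_zero)
  next
    case (single m)
    let ?s = "Poly_Mapping.single m (Poly_Mapping.lookup q m)"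
    have m: "Poly_Mapping.keys m \<subseteq> G" "Poly_Mapping.keys m \<subseteq> G'" "Poly_Mapping.keys m \<subseteq> hom0"
      using polys_in_keys[OF that(1) single] G G' by blast+
    have x: "x \<in> polys_in G" "x \<in> polys_in hom0"
      using that(2) polys_in_mono[OF G(2)] by (auto simp: X_def)
    have "subst \<iota> (?c \<gamma> \<delta> (?s * x)) \<in> represented G' \<gamma> \<delta>" for \<gamma> \<delta>
    proof -
      have "subst \<iota> (?c (\<gamma> - wt m) (\<delta> - dg m) x) \<in> represented G' (\<gamma> - wt m) (\<delta> - dg m)"
        using that(2) by (simp add: X_def)
      from represented_mult[OF this m(2) G'(2), of "Poly_Mapping.lookup q m"] show ?thesis
        by (simp add: restrict_keys_mult_single[OF x(2) m(3)])
    qed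
    then show ?case
      using m(1) x(1) by (simp add: X_def polys_in_mult polys_in_single)
  next
    case (add q r)
    then show ?case
      by (simp add: X_def distrib_right restrict_keys_add represented_add polys_in_add)
  qed
  have "ideal X (poly_ring G)"
  proof (rule idealI)
    show "ring (poly_ring G :: ('b, 'k) mpoly ring)" by (rule PR.ring_axioms)
    show "subgroup X (add_monoid (poly_ring G))"
    proof (rule PR.add.subgroupI)
      show "X \<noteq> {}"
        using represented_zero by (auto simp: X_def intro!: exI[of _ 0])
      show "\<ominus>\<^bsub>poly_ring G\<^esub> q \<in> X" if "q \<in> X" for q
      proof -
        have "Poly_Mapping.single 0 (- 1) * q \<in> X"
          using that by (intro mult polys_in_single) auto
        moreover have "Poly_Mapping.single 0 (- 1) * q = - q"
          by (rule poly_mapping_eqI) (simp add: lookup_single_zero_mult)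
        ultimately show ?thesis
          using that by (simp add: uminus X_def)
      qed
    qed (auto simp: X_def poly_ring_def restrict_keys_add represented_add polys_in_add)
    fix a x :: "('b, 'k) mpoly"
    assume "a \<in> X" "x \<in> carrier (poly_ring G)"
    then have "x * a \<in> X"
      by (intro mult) (simp_all add: poly_ring_def)
    then show "x \<otimes>\<^bsub>poly_ring G\<^esub> a \<in> X" "a \<otimes>\<^bsub>poly_ring G\<^esub> x \<in> X"
      by (simp_all add: poly_ring_def mult.commute)
  qed
  moreover have "\<kappa> G \<subseteq> X"
  proof
    fix h assume h: "h \<in> \<kappa> G"
    obtain \<gamma>' \<delta>' where h': "h \<in> polys_in G" "\<And>m. m \<in> Poly_Mapping.keys h \<Longrightarrow> wt m = \<gamma>' \<and> dg m = \<delta>'"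
      "subst \<iota> h \<in> F_gt v \<gamma>'" "subst \<iota> h \<in> grad \<delta>'"
      using kernel_rule_props[OF ker G h] by blast
    \<comment> \<open>If \<open>subst \<iota> h\<close> is non-zero, its value exceeds \<gamma>',
      and subduction writes it with terms of at least that value plus a remainder.\<close>
    have rep: "subst \<iota> h \<in> represented G' \<gamma>' \<delta>'"
    proof (cases "subst \<iota> h = 0")
      case True
      then show ?thesis by (simp add: represented_zero)
    next
      case False
      let ?f = "subst \<iota> h"
      have \<gamma>': "\<gamma>' < v ?f" and ge: "?f \<in> F_ge v (v ?f)"
        using h'(3) False by (auto simp: F_gt_iff F_ge_iff)
      obtain F h'' r where res: "subduction \<iota> v grad \<rho> G ?f = Some (F, h'', r)"
        using terminates G(2) grad_homogeneous[OF h'(4)] unfolding subduction_terminates_def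
        by (metis not_Some_eq prod_cases3)
      note sub = subduction_representation[OF rule G(2) h'(4) ge res]
      obtain q where q: "q \<in> polys_in G" "?f = subst \<iota> q + r"
          "\<forall>m\<in>Poly_Mapping.keys q. dg m = \<delta>' \<and> v ?f \<le> wt m"
        using sub(1) by blast
      then have "subst \<iota> q \<in> represented G' \<gamma>' \<delta>'"
        using \<gamma>' polys_in_mono[OF G'(1)] unfolding represented_def by fastforce
      moreover have "r \<in> represented G' \<gamma>' \<delta>'"
      proof (cases "r = 0")
        case True
        then show ?thesis by (simp add: represented_zero)
      next
        case False
        \<comment> \<open>A non-zero remainder belongs to \<open>G'\<close>, so it is represented by
          its own variable.\<close>
        let ?s = "Poly_Mapping.single (Poly_Mapping.single r 1) (1 :: 'k)"
        have "r \<in> G'"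
          using False h res by (auto simp: G'_def new_remainders_def)
        moreover have "dg (Poly_Mapping.single r 1) = \<delta>'" "\<gamma>' < wt (Poly_Mapping.single r 1)"
          using deg_eq[OF False sub(2)] sub(3) False \<gamma>' by (auto simp: monomial_degree_single F_ge_iff)
        ultimately have "?s \<in> {p \<in> polys_in G'. \<forall>m\<in>Poly_Mapping.keys p. dg m = \<delta>' \<and> \<gamma>' < wt m}"
          by (auto simp: polys_in_def)
        moreover have "r = subst \<iota> ?s"
          by simp
        ultimately show ?thesis
          unfolding represented_def by blast
      qed
      ultimately show ?thesis
        using q(2) represented_add by simp
    qed
    have "subst \<iota> (?c \<gamma> \<delta> h) \<in> represented G' \<gamma> \<delta>" for \<gamma> \<delta>
    proof (cases "\<gamma> = \<gamma>' \<and> \<delta> = \<delta>'")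
      case True
      then have "?c \<gamma> \<delta> h = h"
        using h'(2) by (intro restrict_keys_id) auto
      then show ?thesis using rep True by simp
    next
      case False
      then have "?c \<gamma> \<delta> h = 0"
        using h'(2) by (intro restrict_keys_none) auto
      then show ?thesis by (simp add: represented_zero)
    qed
    then show "h \<in> X"
      using h'(1) by (simp add: X_def)
  qed
  ultimately have "Idl\<^bsub>poly_ring G\<^esub> (\<kappa> G) \<subseteq> X"
    by (rule PR.genideal_minimal)
  then have kernel_X: "beta_kernel \<iota> v grad G \<subseteq> X"
    using ker G unfolding kernel_rule_def by auto
  \<comment> \<open>The part of weight exactly \<gamma>, possibly zero, is rewritten by means of the
    kernel; the other terms already satisfy the strict bound.\<close>
  let ?Q = "\<lambda>m. wt m = \<gamma>"
  let ?q = "restrict_keys ?Q p" and ?r = "restrict_keys (\<lambda>m. \<not> ?Q m) p"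
  have split: "subst \<iota> p = subst \<iota> ?q + subst \<iota> ?r"
    using restrict_keys_split[of ?Q p] subst_simps(2) by metis
  have q: "?q \<in> polys_in G" "?q \<in> polys_in hom0" and r: "?r \<in> polys_in G'" "?r \<in> polys_in hom0"
    using restrict_keys_polys_in[OF p(1)] polys_in_mono[OF G'(1)] polys_in_mono[OF G(2)] by blast+
  have q_keys: "wt m = \<gamma> \<and> dg m = \<delta>" if "m \<in> Poly_Mapping.keys ?q" for m
    using that p(2) by (auto simp: keys_restrict_keys)
  have r_keys: "dg m = \<delta> \<and> \<gamma> < wt m" if "m \<in> Poly_Mapping.keys ?r" for m
    using that p(2) by (force simp: keys_restrict_keys)
  have "subst \<iota> ?r \<in> F_gt v \<gamma>"
    using r(2) r_keys by (intro subst_in_F_gt) auto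
  then have "subst \<iota> ?q \<in> F_gt v \<gamma>"
    using F_gt_diff[OF p(3)] split by fastforce
  then have "?q \<in> beta_kernel \<iota> v grad G"
    using subst_in_eq_zero_iff[OF q(2) q_keys] q(1)
    by (simp add: beta_kernel_def a_kernel_def' poly_ring_def)
  then have "subst \<iota> (?c \<gamma> \<delta> ?q) \<in> represented G' \<gamma> \<delta>"
    using kernel_X by (auto simp: X_def)
  moreover have "?c \<gamma> \<delta> ?q = ?q"
    using q_keys by (rule restrict_keys_id)
  ultimately have "subst \<iota> ?q \<in> represented G' \<gamma> \<delta>"
    by (simp only:)
  moreover have "subst \<iota> ?r \<in> represented G' \<gamma> \<delta>"
    unfolding represented_def using r(1) r_keys by blast
  ultimately show ?thesis
    using split represented_add by (simp add: G'_def)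
qed

section \<open>The Khovanskii basis algorithm\<close>

lemma generated_algebra_subst: "generated_algebra class_ring \<iota> X = subst \<iota> ` polys_in X"
proof -
  have "poly_evaluation class_ring \<iota> (\<lambda>g. g) X"
    by (intro poly_evaluation.intro poly_evaluation_axioms.intro cring_class_ring B_algebra) auto
  from poly_evaluation.generated_algebra_eq[OF this] show ?thesis
    by simp
qed

text \<open>The chain condition enters as the assumption \<open>acc\<close> because it has two
  sources: a constant finite set, and a growing sequence compared with a finite Khovanskii basis. An
  initial form that is never generated would give representations of \<open>f\<close> over the
  successive \<open>G i\<close> with strictly increasing lowest weight.\<close>

lemma initial_form_eventually_generated:
  assumes rules: "subduction_rule \<iota> v grad \<rho>" "subduction_terminates \<iota> v grad \<rho>" "kernel_rule \<iota> v grad \<kappa>"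
    and G: "\<And>i. finite (G i)" "\<And>i. G i \<subseteq> hom0"
      "\<And>i. G (Suc i) = G i \<union> new_remainders \<iota> v grad \<rho> \<kappa> (G i)"
      "generated_algebra class_ring \<iota> (G 0) = A"
    and f: "f \<in> grad \<delta>" "f \<noteq> 0"
    and acc: "\<And>m. (\<And>i. Poly_Mapping.keys (m i) \<subseteq> G i) \<Longrightarrow> (\<And>i. dg (m i) = \<delta>) \<Longrightarrow>
      (\<And>i j. i < j \<Longrightarrow> wt (m i) < wt (m j)) \<Longrightarrow> False"
  shows "\<exists>i. in_vD \<iota> v grad f \<in> in_vD_algebra \<iota> v grad (G i)"
proof (rule ccontr)
  assume "\<not> ?thesis"
  then have bad: "in_vD \<iota> v grad f \<notin> in_vD_algebra \<iota> v grad (G i)" for i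
    by blast
  let ?P = "\<lambda>i p. p \<in> polys_in (G i) \<and> subst \<iota> p = f \<and> (\<forall>m\<in>Poly_Mapping.keys p. dg m = \<delta>)"
  let ?w = "\<lambda>p :: ('b, 'k) mpoly. Min (wt ` Poly_Mapping.keys p)"
  have nonempty: "Poly_Mapping.keys p \<noteq> {}" if "?P i p" for i p
  proof
    assume "Poly_Mapping.keys p = {}"
    then have "p = 0"
      by (intro poly_mapping_eqI) (simp add: in_keys_iff set_eq_iff)
    then show False
      using that f(2) by auto
  qed
  have "f \<in> A"
    using f(1) grad_subset by blast
  then obtain p0 where p0: "p0 \<in> polys_in (G 0)" "f = subst \<iota> p0"
    using G(4) generated_algebra_subst by blast
  have "p0 \<in> polys_in hom0"
    using p0(1) polys_in_mono[OF G(2)[of 0]] by blast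
  then have start: "?P 0 (restrict_keys (\<lambda>m. dg m = \<delta>) p0)"
    using p0 f(1) homogeneous_representation[of p0 \<delta>]
    by (auto simp: keys_restrict_keys restrict_keys_polys_in)
  have step: "\<exists>q. ?P (Suc i) q \<and> ?w p < ?w q" if p: "?P i p" for i p
  proof -
    have ge: "?w p \<le> wt m" if "m \<in> Poly_Mapping.keys p" for m
      using that by (intro Min_le) auto
    have "p \<in> polys_in hom0"
      using p polys_in_mono[OF G(2)[of i]] by blast
    then have f_ge: "f \<in> F_ge v (?w p)"
      using p ge subst_in_F_ge[of p "?w p"] by blast
    \<comment> \<open>Without cancellation the lowest terms of \<open>p\<close> would already
      exhibit the initial form of \<open>f\<close> in the algebra of \<open>G i\<close>.\<close>
    have "v f \<noteq> ?w p"
    proof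
      assume eq: "v f = ?w p"
      have "in_vD \<iota> v grad f \<in> in_vD_algebra \<iota> v grad (G i)"
        using p ge by (intro in_vD_in_algebraI[OF G(2) _ f, of p]) (auto simp: eq)
      then show False using bad by blast
    qed
    then have "subst \<iota> p \<in> F_gt v (?w p)"
      using f_ge p f(2) by (auto simp: F_ge_iff F_gt_iff)
    moreover have "dg m = \<delta> \<and> ?w p \<le> wt m" if "m \<in> Poly_Mapping.keys p" for m
      using ge[OF that] p that by blast
    ultimately have "f \<in> represented (G (Suc i)) (?w p) \<delta>"
      using represented_push[OF rules G(1,2), of p i \<delta> "?w p"] p by (simp add: G(3))
    then obtain q where q: "q \<in> polys_in (G (Suc i))" "f = subst \<iota> q"
        "\<forall>m\<in>Poly_Mapping.keys q. dg m = \<delta> \<and> ?w p < wt m"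
      unfolding represented_def by blast
    then have "?P (Suc i) q" by simp
    moreover have "?w p < ?w q"
      using q(3) nonempty[OF calculation] by simp
    ultimately show ?thesis by blast
  qed
  have "\<exists>p. \<forall>i. ?P i (p i) \<and> ?w (p i) < ?w (p (Suc i))"
  proof (rule dependent_nat_choice[of ?P "\<lambda>_ p q. ?w p < ?w q"])
    show "\<exists>p. ?P 0 p"
      using start by (rule exI)
    show "\<exists>q. ?P (Suc i) q \<and> ?w p < ?w q" if "?P i p" for p i
      using that by (rule step)
  qed
  then obtain p where p: "\<And>i. ?P i (p i)" "\<And>i. ?w (p i) < ?w (p (Suc i))"
    by (elim exE) metis
  \<comment> \<open>Monomials attaining the lowest weights turn the ascent of minima into an
    ascending sequence of monomials.\<close>
  have "\<exists>m\<in>Poly_Mapping.keys (p i). wt m = ?w (p i)" for i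
  proof -
    have "?w (p i) \<in> wt ` Poly_Mapping.keys (p i)"
      using nonempty[OF p(1)] by (intro Min_in) auto
    then show ?thesis by force
  qed
  then obtain m where m: "\<And>i. m i \<in> Poly_Mapping.keys (p i)" "\<And>i. wt (m i) = ?w (p i)"
    by metis
  show False
  proof (rule acc)
    show "Poly_Mapping.keys (m i) \<subseteq> G i" for i
      using p(1)[of i] m(1)[of i] polys_in_keys by blast
    show "dg (m i) = \<delta>" for i
      using p(1)[of i] m(1)[of i] by blast
    show "wt (m i) < wt (m j)" if "i < j" for i j
      using lift_Suc_mono_less[of "\<lambda>i. wt (m i)", OF _ that] p(2) m(2) by simp
  qed
qed

lemma in_vD_algebra_A: "in_vD_algebra \<iota> v grad A = in_vD_algebra \<iota> v grad hom0"
proof -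
  have "{f \<in> A. f \<noteq> 0 \<and> f \<in> homogeneous grad} = {f \<in> hom0. f \<noteq> 0 \<and> f \<in> homogeneous grad}"
    using homogeneous_subset by auto
  then show ?thesis
    by (simp add: in_vD_algebra_def)
qed

lemma in_vD_algebra_subset:
  assumes "G \<subseteq> hom0" "\<And>f. f \<in> H \<Longrightarrow> in_vD \<iota> v grad f \<in> in_vD_algebra \<iota> v grad G" "H \<subseteq> hom0"
  shows "in_vD_algebra \<iota> v grad H \<subseteq> in_vD_algebra \<iota> v grad G"
proof -
  let ?S = "\<lambda>G. range scal \<union> in_vD \<iota> v grad ` G"
  have closed: "?S X \<subseteq> carrier T" for X
    using E.scalar_simps(1) in_vD_closed by auto
  have G: "in_vD_algebra \<iota> v grad G = generate_ring T (?S G)"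
    using in_vD_algebra_eq(2)[OF assms(1)] by (simp add: generated_algebra_def)
  have "range scal \<subseteq> generate_ring T (?S G)"
    by (auto intro: generate_ring.incl)
  then have "generate_ring T (?S H) \<subseteq> generate_ring T (?S G)"
    using assms(2) closed
    by (intro T.generate_ring_min_subring1 T.generate_ring_is_subring) (auto simp: G)
  then show ?thesis
    using in_vD_algebra_eq(2)[OF assms(3)] G by (simp add: generated_algebra_def)
qed

lemma generated_algebra_eq_A:
  assumes "S \<subseteq> G" "G \<subseteq> hom0" "generated_algebra class_ring \<iota> S = A"
  shows "generated_algebra class_ring \<iota> G = A"
proof
  show "A \<subseteq> generated_algebra class_ring \<iota> G"
    using B.mono_generate_ring[of "range \<iota> \<union> S" "range \<iota> \<union> G"] assms(1,3)
    by (auto simp: generated_algebra_def)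
  show "generated_algebra class_ring \<iota> G \<subseteq> A"
    unfolding generated_algebra_def
    using assms(2) homogeneous_subset A_scalars
    by (intro B.generate_ring_min_subring1 A_subring) auto
qed

lemma khovanskii_basisI:
  assumes "G \<subseteq> hom0" "generated_algebra class_ring \<iota> G = A"
    and "\<And>f \<delta>. f \<in> grad \<delta> \<Longrightarrow> f \<noteq> 0 \<Longrightarrow> in_vD \<iota> v grad f \<in> in_vD_algebra \<iota> v grad G"
  shows "khovanskii_basis \<iota> v A grad G"
proof -
  have "in_vD_algebra \<iota> v grad hom0 \<subseteq> in_vD_algebra \<iota> v grad G"
    using assms(3) by (intro in_vD_algebra_subset[OF assms(1)]) (auto simp: homogeneous_def)
  then have "in_vD_algebra \<iota> v grad G = in_vD_algebra \<iota> v grad A"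
    using in_vD_algebra_mono[OF assms(1)] by (auto simp: in_vD_algebra_A)
  then show ?thesis
    using assms(1,2) in_vD_algebra_eq(2)[OF assms(1)] by (simp add: khovanskii_basis_def)
qed

text \<open>Without new remainders the constant sequence at \<open>G\<close> satisfies the recursion
  of the algorithm, and Dickson's lemma applies to the fixed finite set \<open>G\<close>.\<close>

lemma khovanskii_basis_no_new_remainders:
  assumes rules: "subduction_rule \<iota> v grad \<rho>" "subduction_terminates \<iota> v grad \<rho>" "kernel_rule \<iota> v grad \<kappa>"
    and G: "finite G" "G \<subseteq> hom0" "generated_algebra class_ring \<iota> G = A"
    and none: "new_remainders \<iota> v grad \<rho> \<kappa> G = {}"
  shows "khovanskii_basis \<iota> v A grad G"
proof (rule khovanskii_basisI[OF G(2,3)])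
  fix f \<delta> assume f: "f \<in> grad \<delta>" "f \<noteq> 0"
  have "\<exists>i :: nat. in_vD \<iota> v grad f \<in> in_vD_algebra \<iota> v grad G"
  proof (rule initial_form_eventually_generated[OF rules, where G = "\<lambda>_. G", OF _ _ _ _ f])
    fix m assume "\<And>i :: nat. Poly_Mapping.keys (m i) \<subseteq> G" "\<And>i. dg (m i) = \<delta>"
      "\<And>i j. i < j \<Longrightarrow> wt (m i) < wt (m j)"
    then show False
      using no_ascending_monomials[OF v_degree_zero_nonpos[OF rules(1,2)] G(1,2), of m] by blast
  qed (use G none in auto)
  then show "in_vD \<iota> v grad f \<in> in_vD_algebra \<iota> v grad G" by blast
qed

text \<open>With an empty list of generators the loop stops before any kernel is inspected. Then
  \<open>A\<close> consists of scalars, and every non-zero homogeneous element has value and degree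
  0, where a constant polynomial represents it.\<close>

lemma khovanskii_basis_empty:
  assumes "generated_algebra class_ring \<iota> {} = A"
  shows "khovanskii_basis \<iota> v A grad {}"
proof (rule khovanskii_basisI[OF _ assms])
  fix f \<delta> assume f: "f \<in> grad \<delta>" "f \<noteq> 0"
  have "f \<in> A"
    using f(1) grad_subset by blast
  then obtain p where p: "p \<in> polys_in {}" "f = subst \<iota> p"
    using assms generated_algebra_subst by blast
  have keys: "m = 0" if "m \<in> Poly_Mapping.keys p" for m
    using polys_in_keys[OF p(1) that] by simp
  have f': "f = \<iota> (Poly_Mapping.lookup p 0)"
  proof -
    have "p = Poly_Mapping.single 0 (Poly_Mapping.lookup p 0)"
      by (rule poly_mapping_eqI) (use keys in \<open>auto simp: lookup_single when_def in_keys_iff\<close>)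
    then have "f = subst \<iota> (Poly_Mapping.single 0 (Poly_Mapping.lookup p 0))"
      using p(2) by simp
    then show ?thesis
      by (simp add: B.mon_zero)
  qed
  have "v f = 0" "\<delta> = 0"
    using f f' v_scalar grad_unique[OF f(2,1), of 0] scalar_in_grad by auto
  then show "in_vD \<iota> v grad f \<in> in_vD_algebra \<iota> v grad {}"
    using f p keys
    by (intro in_vD_in_algebraI[OF _ p(1) f]) (auto simp: monomial_degree_def dest!: keys)
qed simp

section \<open>Correctness and termination of the loop\<close>

abbreviation khovanskii_step ::
  "('k, 'b) sub_rule \<Rightarrow> ('b set \<Rightarrow> ('b, 'k) mpoly set) \<Rightarrow> 'b set \<times> 'b set \<Rightarrow> 'b set \<times> 'b set" where
  "khovanskii_step \<rho> \<kappa> \<equiv> \<lambda>(G, G').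
    (G \<union> new_remainders \<iota> v grad \<rho> \<kappa> G, new_remainders \<iota> v grad \<rho> \<kappa> G)"

lemma khovanskii_algorithm_correct:
  assumes rules: "subduction_rule \<iota> v grad \<rho>" "subduction_terminates \<iota> v grad \<rho>" "kernel_rule \<iota> v grad \<kappa>"
    and fs: "set fs \<subseteq> hom0" "generated_algebra class_ring \<iota> (set fs) = A"
    and res: "khovanskii_algorithm \<iota> v grad \<rho> \<kappa> fs = Some G"
  shows "finite G" "khovanskii_basis \<iota> v A grad G"
proof -
  obtain G' where G': "while_option (\<lambda>(G, G'). G' \<noteq> {}) (khovanskii_step \<rho> \<kappa>) (set fs, set fs) = Some (G, G')"
    using res by (auto simp: khovanskii_algorithm_def)
  \<comment> \<open>If the last round found nothing, then \<open>G\<close> did not change in it and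
    has no new remainders. The second disjunct accounts for the empty input, where the tested set is
    empty before any round.\<close>
  let ?P = "\<lambda>(G, G'). finite G \<and> G \<subseteq> hom0 \<and> set fs \<subseteq> G \<and>
    ((G' :: 'b set) = {} \<longrightarrow> new_remainders \<iota> v grad \<rho> \<kappa> G = {} \<or> G = {} \<and> set fs = {})"
  have "?P (G, G')"
  proof (rule while_option_rule[OF _ G', where P = ?P])
    show "?P (set fs, set fs)"
      using fs(1) by auto
    fix s assume "?P s"
    then show "?P (khovanskii_step \<rho> \<kappa> s)"
      using new_remainders_props(1,2)[OF rules(1,3), of "fst s"] by (cases s) auto
  qed
  moreover have "G' = {}"
    using while_option_stop[OF G'] by simp
  ultimately have G: "finite G" "G \<subseteq> hom0" "set fs \<subseteq> G"
    and cases: "new_remainders \<iota> v grad \<rho> \<kappa> G = {} \<or> G = {} \<and> set fs = {}"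
    by auto
  show "finite G" by (rule G(1))
  from cases show "khovanskii_basis \<iota> v A grad G"
  proof
    assume "new_remainders \<iota> v grad \<rho> \<kappa> G = {}"
    then show ?thesis
      using khovanskii_basis_no_new_remainders[OF rules G(1,2) generated_algebra_eq_A[OF G(3,2) fs(2)]] by blast
  next
    assume "G = {} \<and> set fs = {}"
    then show ?thesis
      using khovanskii_basis_empty fs(2) by auto
  qed
qed

lemma khovanskii_algorithm_terminates:
  assumes rules: "subduction_rule \<iota> v grad \<rho>" "subduction_terminates \<iota> v grad \<rho>" "kernel_rule \<iota> v grad \<kappa>"
    and fs: "set fs \<subseteq> hom0" "generated_algebra class_ring \<iota> (set fs) = A"
    and H: "finite H" "khovanskii_basis \<iota> v A grad H"
  shows "khovanskii_algorithm \<iota> v grad \<rho> \<kappa> fs \<noteq> None"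
proof -
  have H_hom0: "H \<subseteq> hom0" and H_in: "in_vD_algebra \<iota> v grad H = in_vD_algebra \<iota> v grad hom0"
    using H(2) in_vD_algebra_eq(2)[of H] by (auto simp: khovanskii_basis_def in_vD_algebra_A)
  let ?s = "(set fs, set fs)"
  \<comment> \<open>Iterates of the loop body without its condition, hence defined for all
    \<open>i\<close> even after the loop has stopped.\<close>
  define G where "G i = fst ((khovanskii_step \<rho> \<kappa> ^^ i) ?s)" for i
  have step: "(khovanskii_step \<rho> \<kappa> ^^ Suc i) ?s =
      (G i \<union> new_remainders \<iota> v grad \<rho> \<kappa> (G i), new_remainders \<iota> v grad \<rho> \<kappa> (G i))" for i
    unfolding G_def by (cases "(khovanskii_step \<rho> \<kappa> ^^ i) ?s") simp
  have G_Suc: "G (Suc i) = G i \<union> new_remainders \<iota> v grad \<rho> \<kappa> (G i)" for i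
    unfolding G_def[of "Suc i"] step by simp
  have G_0: "G 0 = set fs"
    by (simp add: G_def)
  have G_props: "finite (G i) \<and> G i \<subseteq> hom0" for i
  proof (induction i)
    case 0
    show ?case using fs(1) by (simp add: G_0)
  next
    case (Suc i)
    then show ?case
      using new_remainders_props(1,2)[OF rules(1,3), of "G i"] by (simp add: G_Suc)
  qed
  have G_mono: "G i \<subseteq> G j" if "i \<le> j" for i j
    using that by (rule lift_Suc_mono_le[of G, rotated]) (simp add: G_Suc)
  have "\<exists>i. in_vD \<iota> v grad f \<in> in_vD_algebra \<iota> v grad (G i)" if "f \<in> H" for f
  proof -
    have f: "f \<in> grad (deg grad f)" "f \<noteq> 0"
      using that H_hom0 in_grad_deg by auto
    show ?thesis
    proof (rule initial_form_eventually_generated[where G = G, OF rules _ _ G_Suc _ f])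
      show "generated_algebra class_ring \<iota> (G 0) = A"
        using fs(2) by (simp add: G_0)
      fix m assume m: "\<And>i :: nat. Poly_Mapping.keys (m i) \<subseteq> G i" "\<And>i. dg (m i) = deg grad f"
        "\<And>i j. i < j \<Longrightarrow> wt (m i) < wt (m j)"
      \<comment> \<open>The sets \<open>G i\<close> may grow, so Dickson's lemma does not apply to
        the \<open>m i\<close> directly. The initial form of each monomial lies in the algebra
        belonging to \<open>H\<close>, which provides a monomial in \<open>H\<close> of the same
        value and degree.\<close>
      have "\<exists>n. Poly_Mapping.keys n \<subseteq> H \<and> wt n = wt (m i) \<and> dg n = deg grad f" for i
      proof -
        have "Poly_Mapping.keys (m i) \<subseteq> hom0"
          using m(1)[of i] G_props[of i] by blast
        note mi = mon_hom0[OF this]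
        have "in_vD \<iota> v grad (B.mon (m i)) \<in> in_vD_algebra \<iota> v grad H"
        proof -
          have "B.mon (m i) \<in> hom0"
            using mi grad_homogeneous by blast
          then show ?thesis
            unfolding H_in in_vD_algebra_eq(2)[OF order.refl] generated_algebra_def
            by (intro generate_ring.incl) blast
        qed
        then show ?thesis
          using monomial_of_in_vD_algebra[OF H_hom0 mi(3,1)] mi(2) m(2) by metis
      qed
      then obtain n where "\<And>i. Poly_Mapping.keys (n i) \<subseteq> H" "\<And>i. wt (n i) = wt (m i)"
          "\<And>i. dg (n i) = deg grad f"
        by metis
      then show False
        using no_ascending_monomials[OF v_degree_zero_nonpos[OF rules(1,2)] H(1) H_hom0, of n] m(3) by simp
    qed (use G_props in auto)
  qed
  then obtain k where k: "\<And>f. f \<in> H \<Longrightarrow> in_vD \<iota> v grad f \<in> in_vD_algebra \<iota> v grad (G (k f))"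
    by metis
  \<comment> \<open>One index serves the whole finite basis because the algebras increase with the
    index; the extra 0 keeps the maximum defined for empty \<open>H\<close>.\<close>
  define N where "N = Max (insert 0 (k ` H))"
  have N: "in_vD \<iota> v grad f \<in> in_vD_algebra \<iota> v grad (G N)" if "f \<in> H" for f
  proof -
    have "k f \<le> N"
      unfolding N_def using H(1) that by (intro Max_ge) auto
    then show ?thesis
      using k[OF that] in_vD_algebra_mono[OF G_mono] G_props by blast
  qed
  have "in_vD_algebra \<iota> v grad hom0 \<subseteq> in_vD_algebra \<iota> v grad (G N)"
    using in_vD_algebra_subset[OF _ N H_hom0] G_props[of N] H_in by simp
  moreover have "in_vD \<iota> v grad r \<in> in_vD_algebra \<iota> v grad hom0" if "r \<in> hom0" for r
    unfolding in_vD_algebra_eq(2)[OF order.refl] generated_algebra_def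
    using that by (intro generate_ring.incl) blast
  \<comment> \<open>A remainder would have its initial form outside the algebra of
    \<open>G N\<close>, which by now contains the initial forms of all non-zero homogeneous
    elements.\<close>
  ultimately have "new_remainders \<iota> v grad \<rho> \<kappa> (G N) = {}"
    using new_remainders_props(2,3)[OF rules(1,3), of "G N"] G_props[of N] by blast
  \<comment> \<open>The tested set of iterate \<open>Suc N\<close> consists of the remainders of
    \<open>G N\<close>, hence the shift by one.\<close>
  then have "snd ((khovanskii_step \<rho> \<kappa> ^^ Suc N) ?s) = {}"
    unfolding step by simp
  then have "\<exists>i. \<not> (\<lambda>(G, G'). G' \<noteq> {}) ((khovanskii_step \<rho> \<kappa> ^^ i) ?s)"
    by (metis (mono_tags, lifting) case_prod_beta)
  then show ?thesis
    unfolding khovanskii_algorithm_def while_option_def by auto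
qed

end

theorem proposition2p22:
  fixes \<iota> :: "'k::field \<Rightarrow> 'b::idom"
    and v :: "'b \<Rightarrow> 'g::linordered_ab_group_add"
    and A :: "'b set"
    and grad :: "'d::ab_group_add \<Rightarrow> 'b set"
    and \<rho> :: "('k, 'b) sub_rule"
    and \<kappa> :: "'b set \<Rightarrow> ('b, 'k) mpoly set"
    and fs :: "'b list"
  assumes "valued_graded_algebra \<iota> v A grad"
    and "subduction_rule \<iota> v grad \<rho>"
    and "kernel_rule \<iota> v grad \<kappa>"
    and "subduction_terminates \<iota> v grad \<rho>"
    and "set fs \<subseteq> homogeneous grad - {0}"
    and "generated_algebra class_ring \<iota> (set fs) = A"
  shows "(khovanskii_algorithm \<iota> v grad \<rho> \<kappa> fs \<noteq> None \<longleftrightarrow>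
            (\<exists>\<G>. finite \<G> \<and> khovanskii_basis \<iota> v A grad \<G>)) \<and>
         (\<forall>\<G>. khovanskii_algorithm \<iota> v grad \<rho> \<kappa> fs = Some \<G> \<longrightarrow>
            finite \<G> \<and> khovanskii_basis \<iota> v A grad \<G>)"
proof -
  interpret valued_graded_algebra \<iota> v A grad
    by (rule assms(1))
  have "finite \<G> \<and> khovanskii_basis \<iota> v A grad \<G>"
    if "khovanskii_algorithm \<iota> v grad \<rho> \<kappa> fs = Some \<G>" for \<G>
    using khovanskii_algorithm_correct[OF assms(2,4,3,5,6) that] by blast
  moreover have "khovanskii_algorithm \<iota> v grad \<rho> \<kappa> fs \<noteq> None"
    if "finite \<G>" "khovanskii_basis \<iota> v A grad \<G>" for \<G>
    using khovanskii_algorithm_terminates[OF assms(2,4,3,5,6) that] .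
  ultimately show ?thesis by blast
qed

end
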